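(* Let $\delta\in[0,1]$, let $P_d$ be a probability distribution on $\mathbb{Z}_+=\{0,1,2,\dots\}$, and let $\mu_s$ be a symmetric probability distribution on $(-\infty,+\infty]$, such that it is not the case that simultaneously $\mu_s=\delta_0$, $d=1$ almost surely under $P_d$, and $\delta\in\{0,1\}$. Let $\mathcal{Q}_s$ be the associated BP operator on LLR distributions. Then there is at most one non-trivial BP fixed point $\mu^*$ among LLR distributions, and it is symmetric. For every non-trivial LLR distribution $\mu$, the sequence $\mathcal{Q}_s^h\mu$ converges weakly as $h\to\infty$ to the same symmetric fixed point: to $\mu^*$ if it exists, and to the trivial distribution $\delta_0$ otherwise.
   Context: A probability distribution $\mu$ on $(-\infty,+\infty]$ is symmetric if $\mu[E]=\int e^{-r}\mathbf{1}\{-r\in E\}\,d\mu(r)$ for every measurable $E\subseteq(-\infty,+\infty)$. The trivial distribution is $\delta_0$, the unit mass at $0$. Weak convergence is that of probability measures on $(-\infty,+\infty]$ (test functions: bounded functions continuous on $(-\infty,+\infty]$). A probability distribution $\mu$ on $(-\infty,+\infty]$ is an LLR distribution if $\int e^{-r}d\mu(r)\le 1$. Its complement is the (unique) probability distribution $\mu^-$ on $[-\infty,+\infty)$ with $\mu^-[E]=\int e^{-r}\mathbf{1}\{r\in E\}\,d\mu(r)$ for every measurable $E\subseteq(-\infty,+\infty)$ (the remaining mass sits at $-\infty$). Every symmetric distribution is an LLR distribution. BP operator: for an LLR distribution $\mu$ with complement $\mu^-$, $\mathcal{Q}_s\mu$ is the law of $$R=\sum_{u=1}^dF_\delta(\hat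 R_u)+S,\qquad F_\delta(x)=\ln\frac{(1-\delta)e^x+\delta}{\delta e^x+1-\delta},$$ where $d\sim P_d$, $\hat R_u\sim(1-\delta)\mu+\delta\mu^-$ i.i.d., $S\sim\mu_s$, all jointly independent, and $F_\delta(\pm\infty)$ is defined by continuity. An LLR distribution $\mu$ is a BP fixed point if $\mathcal{Q}_s\mu=\mu$. *)

theory Defs
  imports "HOL-Probability.Probability" "HOL-Real_Asymp.Real_Asymp"
begin

text \<open>Distributions on $(-\infty,+\infty]$ and on $[-\infty,+\infty)$ are Borel probability measures
  on the extended reals that give no mass to the excluded endpoint.\<close>

definition dist_above_MInf :: "ereal measure \<Rightarrow> bool" where
  "dist_above_MInf \<mu> \<longleftrightarrow> prob_space \<mu> \<and> sets \<mu> = sets borel \<and> emeasure \<mu> {-\<infinity>} = 0"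

definition dist_below_PInf :: "ereal measure \<Rightarrow> bool" where
  "dist_below_PInf \<mu> \<longleftrightarrow> prob_space \<mu> \<and> sets \<mu> = sets borel \<and> emeasure \<mu> {\<infinity>} = 0"

text \<open>The function $r \mapsto e^{-r}$, extended by continuity to $\pm\infty$.\<close>

function exp_neg :: "ereal \<Rightarrow> ennreal" where
  "exp_neg (ereal x) = ennreal (exp (- x))"
| "exp_neg \<infinity> = 0"
| "exp_neg (-\<infinity>) = \<top>"
  by (metis ereal_cases) auto
termination by lexicographic_order

abbreviation trivial_dist :: "ereal measure" where
  "trivial_dist \<equiv> return borel 0"

definition symmetric_dist :: "ereal measure \<Rightarrow> bool" where
  "symmetric_dist \<mu> \<longleftrightarrow> dist_above_MInf \<mu> \<and>
     (\<forall>E\<in>sets borel. E \<subseteq> {-\<infinity><..<\<infinity>} \<longrightarrow>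
        emeasure \<mu> E = (\<integral>\<^sup>+ r. exp_neg r * indicator E (- r) \<partial>\<mu>))"

definition LLR_dist :: "ereal measure \<Rightarrow> bool" where
  "LLR_dist \<mu> \<longleftrightarrow> dist_above_MInf \<mu> \<and> (\<integral>\<^sup>+ r. exp_neg r \<partial>\<mu>) \<le> 1"

definition is_complement :: "ereal measure \<Rightarrow> ereal measure \<Rightarrow> bool" where
  "is_complement \<mu> \<nu> \<longleftrightarrow> dist_below_PInf \<nu> \<and>
     (\<forall>E\<in>sets borel. E \<subseteq> {-\<infinity><..<\<infinity>} \<longrightarrow>
        emeasure \<nu> E = (\<integral>\<^sup>+ r. exp_neg r * indicator E r \<partial>\<mu>))"

definition complement :: "ereal measure \<Rightarrow> ereal measure" where
  "complement \<mu> = (THE \<nu>. is_complement \<mu> \<nu>)"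

definition mixture :: "real \<Rightarrow> ereal measure \<Rightarrow> ereal measure \<Rightarrow> ereal measure" where
  "mixture \<delta> \<mu> \<nu> = measure_of UNIV (sets borel)
     (\<lambda>E. ennreal (1 - \<delta>) * emeasure \<mu> E + ennreal \<delta> * emeasure \<nu> E)"

text \<open>The values at $\pm\infty$ are the limits of the finite formula; see \<open>continuous_F_BP\<close> below.\<close>

function F_BP :: "real \<Rightarrow> ereal \<Rightarrow> ereal" where
  "F_BP \<delta> (ereal x) = ereal (ln (((1 - \<delta>) * exp x + \<delta>) / (\<delta> * exp x + 1 - \<delta>)))"
| "F_BP \<delta> \<infinity> = (if \<delta> = 0 then \<infinity> else if \<delta> = 1 then -\<infinity> else ereal (ln ((1 - \<delta>) / \<delta>)))"
| "F_BP \<delta> (-\<infinity>) = (if \<delta> = 0 then -\<infinity> else if \<delta> = 1 then \<infinity> else ereal (ln (\<delta> / (1 - \<delta>))))"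
  by (metis ereal_cases surj_pair) auto
termination by lexicographic_order

text \<open>The law of $R$, with $d$, $(\hat R_u)_u$ and $S$ realised as the coordinates of a product
  space; only the first $d$ terms of the infinite i.i.d. family enter the sum.\<close>

definition BP :: "real \<Rightarrow> nat pmf \<Rightarrow> ereal measure \<Rightarrow> ereal measure \<Rightarrow> ereal measure" where
  "BP \<delta> P \<mu>s \<mu> = distr
     (measure_pmf P \<Otimes>\<^sub>M
        ((\<Pi>\<^sub>M u\<in>(UNIV :: nat set). mixture \<delta> \<mu> (complement \<mu>)) \<Otimes>\<^sub>M \<mu>s))
     borel (\<lambda>(d, r, s). (\<Sum>u<d. F_BP \<delta> (r u)) + s)"

definition BP_fixed_point :: "real \<Rightarrow> nat pmf \<Rightarrow> ereal measure \<Rightarrow> ereal measure \<Rightarrow> bool" where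
  "BP_fixed_point \<delta> P \<mu>s \<mu> \<longleftrightarrow> LLR_dist \<mu> \<and> BP \<delta> P \<mu>s \<mu> = \<mu>"

text \<open>Weak convergence as measures on $(-\infty,+\infty]$: the test functions need not be continuous
  at $-\infty$, and their value there is irrelevant since it carries no mass.\<close>

definition weakly_converges :: "(nat \<Rightarrow> ereal measure) \<Rightarrow> ereal measure \<Rightarrow> bool" where
  "weakly_converges M \<mu> \<longleftrightarrow>
     (\<forall>f :: ereal \<Rightarrow> real. continuous_on {-\<infinity><..} f \<and> bounded (f ` {-\<infinity><..}) \<longrightarrow>
        (\<lambda>n. \<integral>r. f r \<partial>M n) \<longlonglongrightarrow> (\<integral>r. f r \<partial>\<mu>))"


text \<open>The definitions above are meaningful: the complement exists and is unique, the mixture is a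
  measure with the stated values, and the map defining the BP operator is measurable.\<close>

lemma exp_neg_measurable [measurable]: "exp_neg \<in> borel_measurable borel"
proof -
  have *: "exp_neg = (\<lambda>r. if r = \<infinity> then 0 else if r = -\<infinity> then \<top> else ennreal (exp (- real_of_ereal r)))"
  proof
    fix r :: ereal
    show "exp_neg r = (if r = \<infinity> then 0 else if r = -\<infinity> then \<top> else ennreal (exp (- real_of_ereal r)))"
      by (cases r) auto
  qed
  show ?thesis unfolding * by measurable
qed

lemma complement_ex1:
  assumes "LLR_dist \<mu>"
  shows "\<exists>!\<nu>. is_complement \<mu> \<nu>"
proof -
  have [measurable_cong]: "sets \<mu> = sets borel" and mInf: "emeasure \<mu> {-\<infinity>} = 0"
    and le: "(\<integral>\<^sup>+ r. exp_neg r \<partial>\<mu>) \<le> 1" and "prob_space \<mu>"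
    using assms by (auto simp: LLR_dist_def dist_above_MInf_def)
  have sp: "space \<mu> = UNIV" using sets_eq_imp_space_eq[OF \<open>sets \<mu> = _\<close>] by simp
  define I where "I = (\<integral>\<^sup>+ r. exp_neg r \<partial>\<mu>)"
  define D where "D = density \<mu> exp_neg"
  define m where "m E = emeasure D E + (1 - I) * indicator E (-\<infinity>)" for E :: "ereal set"
  define \<nu> where "\<nu> = measure_of UNIV (sets borel) m"
  have sD: "sets D = sets borel" by (simp add: D_def \<open>sets \<mu> = _\<close>)
  have mE: "emeasure \<nu> E = m E" if "E \<in> sets borel" for E
    unfolding \<nu>_def
  proof (rule emeasure_measure_of_sigma[OF _ _ _ that])
    show "sigma_algebra UNIV (sets (borel :: ereal measure))"
      using sets.sigma_algebra_axioms[of "borel :: ereal measure"] by simp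
    show "positive (sets borel) m" by (simp add: positive_def m_def)
    show "countably_additive (sets borel) m"
    proof (rule countably_additiveI)
      fix A :: "nat \<Rightarrow> ereal set"
      assume A: "range A \<subseteq> sets borel" "disjoint_family A"
      have 1: "(\<Sum>i. emeasure D (A i)) = emeasure D (\<Union>i. A i)"
        using A sD by (intro suminf_emeasure) auto
      have 2: "(\<Sum>i. indicator (A i) (-\<infinity>)) = (indicator (\<Union>i. A i) (-\<infinity>) :: ennreal)"
        using A by (intro suminf_indicator) auto
      show "(\<Sum>i. m (A i)) = m (\<Union>i. A i)"
        by (simp add: m_def 1 2 suminf_add[symmetric] ennreal_suminf_cmult)
    qed
  qed
  have sN: "sets \<nu> = sets borel"
    using sets.sigma_sets_eq[of "borel :: ereal measure"] by (simp add: \<nu>_def)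
  have spN: "space \<nu> = UNIV" using sets_eq_imp_space_eq[OF sN] by simp
  have D: "emeasure D E = (\<integral>\<^sup>+ r. exp_neg r * indicator E r \<partial>\<mu>)" if "E \<in> sets borel" for E
    unfolding D_def using that by (intro emeasure_density) (auto simp: \<open>sets \<mu> = _\<close>)
  have "emeasure \<nu> UNIV = 1"
    using le D[of UNIV] by (simp add: mE m_def I_def)
  then have "prob_space \<nu>" by (intro prob_spaceI) (simp add: spN)
  moreover have "emeasure \<nu> {\<infinity>} = 0"
  proof -
    have "(\<integral>\<^sup>+ r. exp_neg r * indicator {\<infinity>} r \<partial>\<mu>) = (\<integral>\<^sup>+ r. 0 \<partial>\<mu>)"
      by (intro nn_integral_cong) (auto simp: indicator_def)
    then show ?thesis by (simp add: mE m_def D)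
  qed
  ultimately have ex: "is_complement \<mu> \<nu>"
    by (auto simp: is_complement_def dist_below_PInf_def sN mE m_def D split: split_indicator)
  have "\<nu>1 = \<nu>2" if c: "is_complement \<mu> \<nu>1" "is_complement \<mu> \<nu>2" for \<nu>1 \<nu>2
  proof -
    define R where "R = {-\<infinity><..<\<infinity> :: ereal}"
    have R: "R \<in> sets borel" by (simp add: R_def)
    have s: "sets \<nu>1 = sets borel" "sets \<nu>2 = sets borel"
      using c by (auto simp: is_complement_def dist_below_PInf_def)
    have split: "emeasure N E = emeasure N (E \<inter> R) + (1 - emeasure N R) * indicator E (-\<infinity>)"
      if "dist_below_PInf N" "E \<in> sets borel" for N E
    proof -
      have sN: "sets N = sets borel" and pN: "prob_space N" and z: "emeasure N {\<infinity>} = 0"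
        using that by (auto simp: dist_below_PInf_def)
      have UN: "space N = UNIV" using sets_eq_imp_space_eq[OF sN] by simp
      have "emeasure N R \<noteq> \<infinity>"
        using prob_space.emeasure_le_1[OF pN, of R] by (auto simp: top_unique)
      then have "emeasure N (UNIV - R) = 1 - emeasure N R"
        using emeasure_compl[of R N] prob_space.emeasure_space_1[OF pN] R sN UN by simp
      moreover have "UNIV - R = {-\<infinity>} \<union> {\<infinity>}"
        unfolding R_def using less_ereal.simps by (auto simp: less_le)
      moreover have "emeasure N ({-\<infinity>} \<union> {\<infinity>}) = emeasure N {-\<infinity>}"
        using z sN by (intro emeasure_Un_null_set) (auto simp: null_sets_def)
      ultimately have m: "emeasure N {-\<infinity>} = 1 - emeasure N R" by simp
      have "emeasure N E = emeasure N (E \<inter> R) + emeasure N (E \<inter> (UNIV - R))"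
        using R that sN by (subst plus_emeasure) (auto intro!: arg_cong[where f="emeasure N"])
      moreover have "emeasure N (E \<inter> (UNIV - R)) = emeasure N {-\<infinity>} * indicator E (-\<infinity>)"
      proof (cases "-\<infinity> \<in> E")
        case True
        have "emeasure N (E \<inter> {\<infinity>}) \<le> emeasure N {\<infinity>}"
          using sN by (intro emeasure_mono) auto
        then have null: "E \<inter> {\<infinity>} \<in> null_sets N"
          using z sN that(2) by (simp add: null_sets_def)
        from True have "emeasure N (E \<inter> (UNIV - R)) = emeasure N ({-\<infinity>} \<union> (E \<inter> {\<infinity>}))"
          unfolding \<open>UNIV - R = _\<close> by (intro arg_cong[where f="emeasure N"]) auto
        also have "\<dots> = emeasure N {-\<infinity>}"
          using null sN by (intro emeasure_Un_null_set) auto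
        finally show ?thesis using True by simp
      next
        case False
        then have "E \<inter> (UNIV - R) \<subseteq> {\<infinity>}" unfolding \<open>UNIV - R = _\<close> by auto
        then have "emeasure N (E \<inter> (UNIV - R)) = 0"
          using emeasure_eq_0[of "{\<infinity>}" N] z sN by simp
        then show ?thesis using False by simp
      qed
      ultimately show ?thesis using m by simp
    qed
    have eqR: "emeasure \<nu>1 (E \<inter> R) = emeasure \<nu>2 (E \<inter> R)" if "E \<in> sets borel" for E
    proof -
      have "E \<inter> R \<in> sets borel" "E \<inter> R \<subseteq> {-\<infinity><..<\<infinity>}" using that R by (auto simp: R_def)
      then show ?thesis using c by (simp add: is_complement_def)
    qed
    show ?thesis
    proof (rule measure_eqI)
      fix E assume "E \<in> sets \<nu>1"
      then have E: "E \<in> sets borel" using s by simp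
      show "emeasure \<nu>1 E = emeasure \<nu>2 E"
        using split[OF _ E, of \<nu>1] split[OF _ E, of \<nu>2] c eqR[OF E] eqR[OF R]
        by (simp add: is_complement_def)
    qed (simp add: s)
  qed
  with ex show ?thesis by blast
qed

lemma sets_mixture [simp, measurable_cong]: "sets (mixture \<delta> \<mu> \<nu>) = sets borel"
  using sets.sigma_sets_eq[of "borel :: ereal measure"] by (simp add: mixture_def)

lemma emeasure_mixture:
  assumes "sets \<mu> = sets borel" "sets \<nu> = sets borel" "E \<in> sets borel"
  shows "emeasure (mixture \<delta> \<mu> \<nu>) E = ennreal (1 - \<delta>) * emeasure \<mu> E + ennreal \<delta> * emeasure \<nu> E"
  unfolding mixture_def
proof (rule emeasure_measure_of_sigma[OF _ _ _ assms(3)])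
  show "sigma_algebra UNIV (sets (borel :: ereal measure))"
    using sets.sigma_algebra_axioms[of "borel :: ereal measure"] by simp
  show "positive (sets borel) (\<lambda>E. ennreal (1 - \<delta>) * emeasure \<mu> E + ennreal \<delta> * emeasure \<nu> E)"
    by (simp add: positive_def)
  show "countably_additive (sets borel)
      (\<lambda>E. ennreal (1 - \<delta>) * emeasure \<mu> E + ennreal \<delta> * emeasure \<nu> E)"
  proof (rule countably_additiveI)
    fix A :: "nat \<Rightarrow> ereal set"
    assume A: "range A \<subseteq> sets borel" "disjoint_family A"
    have "(\<Sum>i. emeasure M (A i)) = emeasure M (\<Union>i. A i)" if "sets M = sets borel" for M
      using A that by (intro suminf_emeasure) auto
    then show "(\<Sum>i. ennreal (1 - \<delta>) * emeasure \<mu> (A i) + ennreal \<delta> * emeasure \<nu> (A i)) =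
        ennreal (1 - \<delta>) * emeasure \<mu> (\<Union>i. A i) + ennreal \<delta> * emeasure \<nu> (\<Union>i. A i)"
      using assms by (simp add: suminf_add[symmetric] ennreal_suminf_cmult)
  qed
qed

lemma continuous_F_BP:
  assumes "\<delta> \<in> {0..1}"
  shows "continuous_on UNIV (F_BP \<delta>)"
proof -
  define g where "g x = ln (((1 - \<delta>) * exp x + \<delta>) / (\<delta> * exp x + 1 - \<delta>))" for x :: real
  consider "\<delta> = 0" | "\<delta> = 1" | "0 < \<delta>" "\<delta> < 1" using assms by fastforce
  then show ?thesis
  proof cases
    case 1
    have "F_BP \<delta> = (\<lambda>x. x)"
    proof
      fix x show "F_BP \<delta> x = x" using 1 by (cases x) auto
    qed
    then show ?thesis by simp
  next
    case 2
    have "F_BP \<delta> = uminus"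
    proof
      fix x show "F_BP \<delta> x = - x" using 2 by (cases x) (auto simp: ln_div)
    qed
    then show ?thesis by (simp add: continuous_uminus_ereal)
  next
    case 3
    have Fg: "F_BP \<delta> (ereal x) = ereal (g x)" for x by (simp add: g_def)
    have cg: "isCont g x" for x
    proof -
      have "(1 - \<delta>) * exp x + \<delta> > 0" "\<delta> * exp x + 1 - \<delta> > 0"
        using 3 by (auto intro!: add_pos_pos simp: add_diff_eq[symmetric])
      then show ?thesis unfolding g_def
        by (intro continuous_intros) (auto simp: divide_pos_pos less_imp_neq[symmetric])
    qed
    have "isCont (F_BP \<delta>) x" for x
    proof -
      have "(F_BP \<delta> \<longlongrightarrow> F_BP \<delta> x) (at x)"
      proof (cases x)
        case (real y)
        have "((\<lambda>z. ereal (g z)) \<longlongrightarrow> ereal (g y)) (at y)"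
          using cg[of y] by (simp add: isCont_def)
        then show ?thesis
          unfolding real at_ereal filterlim_filtermap Fg .
      next
        case PInf
        have "((\<lambda>x. ((1 - \<delta>) * exp x + \<delta>) / (\<delta> * exp x + 1 - \<delta>)) \<longlongrightarrow> (1 - \<delta>) / \<delta>) at_top"
          using 3 by real_asymp (simp add: divide_inverse)
        then have "(g \<longlongrightarrow> ln ((1 - \<delta>) / \<delta>)) at_top"
          unfolding g_def using 3 by (intro tendsto_ln) auto
        then have "((\<lambda>z. F_BP \<delta> (ereal z)) \<longlongrightarrow> F_BP \<delta> \<infinity>) at_top"
          unfolding Fg using 3 by simp
        then show ?thesis
          unfolding PInf at_infty_ereal_eq_at_top filterlim_filtermap .
      next
        case MInf
        have "((\<lambda>x. ((1 - \<delta>) * exp x + \<delta>) / (\<delta> * exp x + 1 - \<delta>)) \<longlongrightarrow> \<delta> / (1 - \<delta>)) at_bot"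
          using 3 by real_asymp (simp add: divide_inverse)
        then have "(g \<longlongrightarrow> ln (\<delta> / (1 - \<delta>))) at_bot"
          unfolding g_def using 3 by (intro tendsto_ln) auto
        then have "((\<lambda>z. F_BP \<delta> (ereal z)) \<longlongrightarrow> F_BP \<delta> (-\<infinity>)) at_bot"
          unfolding Fg using 3 by simp
        moreover have "{-\<infinity><..} = UNIV - {-\<infinity> :: ereal}" by auto
        then have "at (-\<infinity>) = filtermap ereal at_bot"
          using at_right_MInf by (simp add: at_within_def)
        ultimately show ?thesis
          by (simp add: MInf filterlim_filtermap)
      qed
      then show ?thesis by (simp add: isCont_def)
    qed
    then show ?thesis by (simp add: continuous_on_eq_continuous_at)
  qed
qed

lemma BP_map_measurable:
  assumes "\<delta> \<in> {0..1}" and [measurable_cong]: "sets \<mu>s = sets borel"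
  shows "(\<lambda>(d, r, s). (\<Sum>u<d. F_BP \<delta> (r u)) + s) \<in> borel_measurable
     (measure_pmf P \<Otimes>\<^sub>M ((\<Pi>\<^sub>M u\<in>(UNIV :: nat set). mixture \<delta> \<mu> \<nu>) \<Otimes>\<^sub>M \<mu>s))"
proof -
  have [measurable]: "F_BP \<delta> \<in> borel_measurable borel"
    using continuous_F_BP[OF assms(1)] by (rule borel_measurable_continuous_onI)
  have [measurable_cong]: "sets (measure_pmf P) = sets (count_space UNIV)" by simp
  have *: "(\<lambda>(d, r, s). (\<Sum>u<d. F_BP \<delta> (r u)) + s) =
      (\<lambda>x. (\<lambda>d x. (\<Sum>u<d. F_BP \<delta> (fst (snd x) u)) + snd (snd x)) (fst x) x)"
    by (auto simp: fun_eq_iff)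
  show ?thesis
    unfolding * by (rule measurable_compose_countable) measurable
qed

end

theory Submission
  imports Defs
begin

text \<open>An LLR distribution is a binary-input channel, and BP acts on channels by composing with
  a binary symmetric channel, taking products and mixing. The proof uses the less-noisy order:
  \<open>A \<sqsubseteq> B\<close> if \<open>J A u \<le> J B u\<close> for every prior bias \<open>u\<close>, where \<open>J\<close> is, up to a factor, minus the second
  derivative of the mutual information with respect to the prior. The functional \<open>J\<close> is linear in the
  law, determines it, and behaves well under all ingredients of BP, which is therefore monotone.

  Letting \<open>D\<^sub>\<theta>\<close> denote composition with a binary symmetric channel of correlation \<open>\<theta>\<close>, a strict version
  of the stringy tree lemma of Evans, Kenyon, Peres and Schulman says that
  \<open>BP (D\<^sub>\<theta> N)\<close> exceeds \<open>D\<^sub>\<theta> (BP N)\<close> by a gap that is uniform in the prior. So if \<open>U\<close>, \<open>V\<close> are nontrivial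
  symmetric fixed points, then the largest \<open>\<theta>\<close> with \<open>D\<^sub>\<theta> U \<sqsubseteq> V\<close> must be \<open>1\<close>, which gives uniqueness.
  An arbitrary nontrivial \<open>N\<close> lies between \<open>D\<^sub>\<theta> U\<close> for small \<open>\<theta>\<close> and the perfect channel, where \<open>U\<close> is
  the limit of BP started at the perfect channel. The iterates of both bounds are monotone and converge
  to fixed points, hence to \<open>U\<close>, and they sandwich those of \<open>N\<close>.\<close>

section \<open>Channels and log-likelihood ratios\<close>

text \<open>Under prior bias \<open>u\<close>, an outcome with uniform-prior bias \<open>y\<close>
  has weight \<open>1 + u * y\<close> and posterior bias \<open>(y + u) / (1 + u * y)\<close>; the
  variance of the latter is \<open>(1 - u\<^sup>2)\<^sup>2 * J N u\<close>. Products force all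
  priors to be compared at once: after one factor shows bias \<open>a\<close>, the other is used at
  prior \<open>(a + u) / (1 + u * a)\<close>. The obstacle is that \<open>u\<close> ranges over an
  open interval at whose ends \<open>J\<close> may blow up, so strictness for each single
  \<open>u\<close> would not allow \<theta> to be enlarged. The gap in \<open>J\<close> has to be a
  constant free of \<open>u\<close>. It can then pay for raising \<theta>, because
  \<open>\<theta> * u\<close> stays away from \<plusminus>1 as long as \<theta> < 1. For 0 <
  \<theta> < 1 the gap is absent only when no product of two informative channels occurs, which is
  where the excluded case enters. Symmetry makes degradation comparable; it is required of the
  survey and of \<open>U\<close>, while the channel that \<open>U\<close> is compared with is
  arbitrary. So all LLR distributions come in directly, and the symmetry of nontrivial fixed points
  is a consequence.\<close>

lemma nn_integral_mixture:
  assumes [measurable_cong]: "sets \<mu> = sets borel" "sets \<nu> = sets borel"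
    and f: "f \<in> borel_measurable borel"
  shows "(\<integral>\<^sup>+ r. f r \<partial>mixture \<delta> \<mu> \<nu>) = ennreal (1 - \<delta>) * (\<integral>\<^sup>+ r. f r \<partial>\<mu>) + ennreal \<delta> * (\<integral>\<^sup>+ r. f r \<partial>\<nu>)"
  using f
proof (induction rule: borel_measurable_induct)
  case (cong f g)
  have "f = g" using cong(3) by (auto simp: fun_eq_iff)
  then show ?case using cong by simp
next
  case (set A)
  then show ?case by (simp add: emeasure_mixture[OF assms(1,2)] assms(1,2))
next
  case (mult u c)
  then have [measurable]: "u \<in> borel_measurable borel" by simp
  show ?case using mult by (simp add: nn_integral_cmult algebra_simps)
next
  case (add u v)
  then have [measurable]: "u \<in> borel_measurable borel" "v \<in> borel_measurable borel" by auto
  show ?case using add by (simp add: nn_integral_add algebra_simps)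
next
  case (seq U)
  have [measurable]: "\<And>i. U i \<in> borel_measurable borel" using seq by simp
  have eq: "(\<integral>\<^sup>+ r. (SUP i. U i r) \<partial>N) = (SUP i. \<integral>\<^sup>+ r. U i r \<partial>N)" if "sets N = sets borel" for N :: "ereal measure"
    using seq that by (intro nn_integral_monotone_convergence_SUP) (auto cong: measurable_cong_sets)
  have inc: "incseq (\<lambda>i. c * (\<integral>\<^sup>+ r. U i r \<partial>N))" for N :: "ereal measure" and c :: ennreal
    using seq by (auto simp: incseq_def le_fun_def intro!: mult_left_mono nn_integral_mono)
  have "(\<integral>\<^sup>+ r. (SUP i. U i r) \<partial>mixture \<delta> \<mu> \<nu>) =
      (SUP i. ennreal (1 - \<delta>) * (\<integral>\<^sup>+ r. U i r \<partial>\<mu>) + ennreal \<delta> * (\<integral>\<^sup>+ r. U i r \<partial>\<nu>))"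
    using seq by (simp add: eq)
  also have "\<dots> = (SUP i. ennreal (1 - \<delta>) * (\<integral>\<^sup>+ r. U i r \<partial>\<mu>)) + (SUP i. ennreal \<delta> * (\<integral>\<^sup>+ r. U i r \<partial>\<nu>))"
    by (intro ennreal_SUP_add inc)
  also have "\<dots> = ennreal (1 - \<delta>) * (\<integral>\<^sup>+ r. (SUP i. U i r) \<partial>\<mu>) + ennreal \<delta> * (\<integral>\<^sup>+ r. (SUP i. U i r) \<partial>\<nu>)"
    using assms(1,2) by (simp add: eq SUP_mult_left_ennreal)
  finally show ?case by (simp add: image_comp)
qed

text \<open>The posterior bias \<open>tanh (r / 2)\<close> of a uniform bit given log-likelihood ratio \<open>r\<close>.\<close>

definition bias :: "ereal \<Rightarrow> real" where
  "bias r = (if r = \<infinity> then 1 else if r = -\<infinity> then -1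
     else (exp (real_of_ereal r) - 1) / (exp (real_of_ereal r) + 1))"

text \<open>Constant beyond \<plusminus>1, which makes it continuous on the whole line;
  \<open>chan_compact\<close> can then apply it to a limit law whose support has not been
  located.\<close>

definition unbias :: "real \<Rightarrow> ereal" where
  "unbias y = (if 1 \<le> y then \<infinity> else if y \<le> -1 then -\<infinity> else ereal (ln ((1 + y) / (1 - y))))"

lemma bias_simps [simp]:
  "bias (ereal x) = (exp x - 1) / (exp x + 1)" "bias \<infinity> = 1" "bias (-\<infinity>) = -1" "bias 0 = 0"
  by (simp_all add: bias_def)

lemma bias_measurable [measurable]: "bias \<in> borel_measurable borel"
  unfolding bias_def[abs_def] by measurable

lemma exp_plus_1_pos: "exp x + 1 > (0::real)"
  by (simp add: add_pos_pos)

lemma exp_plus_1_nz [simp]: "exp x + 1 \<noteq> (0::real)"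
  using exp_plus_1_pos[of x] by linarith

lemma bias_le_1 [simp]: "bias r \<le> 1"
  by (cases r) (simp_all add: pos_divide_le_eq exp_plus_1_pos)

lemma bias_ge_m1 [simp]: "-1 \<le> bias r"
  by (cases r) (simp_all add: pos_le_divide_eq exp_plus_1_pos)

lemma abs_bias_le_1 [simp]: "\<bar>bias r\<bar> \<le> 1"
  using bias_le_1[of r] bias_ge_m1[of r] by linarith

lemma bias_uminus [simp]: "bias (- r) = - bias r"
proof (cases r)
  case (real x)
  have "(inverse E - 1) / (inverse E + 1) = - ((E - 1) / (E + 1))" if "E > 0" for E :: real
    using that add_pos_pos[OF that, of 1] by (simp add: divide_simps)
  then show ?thesis by (simp add: real exp_minus)
qed auto

lemma unbias_bias [simp]: "unbias (bias r) = r"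
proof (cases r)
  case (real x)
  define y where "y = (exp x - 1) / (exp x + 1)"
  have "y < 1" "-1 < y" 
    by (auto simp: y_def pos_divide_less_eq pos_less_divide_eq exp_plus_1_pos)
  moreover have "(1 + y) / (1 - y) = exp x"
  proof -
    have "1 + y = 2 * exp x / (exp x + 1)" "1 - y = 2 / (exp x + 1)"
      by (simp_all add: y_def divide_simps)
    then show ?thesis by simp
  qed
  ultimately show ?thesis by (simp add: real unbias_def flip: y_def)
qed (auto simp: unbias_def)

lemma bias_unbias: "bias (unbias y) = max (-1) (min 1 y)"
proof -
  have "bias (unbias y) = y" if "-1 < y" "y < 1"
  proof -
    have "(1 + y) / (1 - y) > 0" using that by simp
    then show ?thesis using that by (simp add: unbias_def field_simps)
  qed
  then show ?thesis by (auto simp: unbias_def)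
qed

lemma continuous_unbias: "continuous_on UNIV unbias"
proof (rule continuous_onI_mono)
  have "range unbias = UNIV" by (metis surj_def unbias_bias)
  then show "open (range unbias)" by simp
  fix x y :: real assume "x \<le> y"
  moreover have "(1 + x) / (1 - x) \<le> (1 + y) / (1 - y)" "0 < (1 + x) / (1 - x)"
    if "-1 < x" "y < 1" "x \<le> y"
    using that by (auto intro!: frac_le)
  ultimately show "unbias x \<le> unbias y"
    by (auto simp: unbias_def)
qed

lemma unbias_measurable [measurable]: "unbias \<in> borel_measurable borel"
  using continuous_unbias by (rule borel_measurable_continuous_onI)

text \<open>Correlations multiply along an edge. This is the tanh rule, and the reason for working
  with biases, where \<plusminus>\<infinity> become the ordinary values \<plusminus>1.\<close>

lemma bias_F_BP:
  assumes "\<delta> \<in> {0..1}"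
  shows "bias (F_BP \<delta> r) = (1 - 2 * \<delta>) * bias r"
proof (cases r)
  case (real x)
  have p: "(1 - \<delta>) * exp x + \<delta> > 0" "\<delta> * exp x + 1 - \<delta> > 0"
    using assms by (cases "\<delta> = 0"; cases "\<delta> = 1"; auto intro!: add_pos_pos simp: add_diff_eq[symmetric])+
  define a b where "a = (1 - \<delta>) * exp x + \<delta>" and "b = \<delta> * exp x + 1 - \<delta>"
  have ab: "a > 0" "b > 0" using p by (auto simp: a_def b_def)
  have "bias (F_BP \<delta> r) = (a / b - 1) / (a / b + 1)"
    using ab by (simp add: real a_def b_def)
  also have "\<dots> = (a - b) / (a + b)" using ab by (simp add: divide_simps)
  also have "a - b = (1 - 2 * \<delta>) * (exp x - 1)" by (simp add: a_def b_def algebra_simps)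
  also have "a + b = exp x + 1" by (simp add: a_def b_def algebra_simps)
  finally show ?thesis by (simp add: real)
next
  case PInf
  then show ?thesis using assms by (auto simp: field_simps)
next
  case MInf
  then show ?thesis using assms by (auto simp: field_simps)
qed

lemma F_BP_measurable: "\<delta> \<in> {0..1} \<Longrightarrow> F_BP \<delta> \<in> borel_measurable borel"
  using continuous_F_BP by (rule borel_measurable_continuous_onI)

text \<open>At \<open>-\<infinity>\<close> the product is \<open>\<top> * 0 = 0\<close> while the
  right side is 2. This loss is the mass of the complement at \<open>-\<infinity>\<close>, and the
  reason why \<open>exp_neg\<close> may integrate to less than 1.\<close>

lemma exp_neg_weight: "r \<noteq> -\<infinity> \<Longrightarrow> exp_neg r * ennreal (1 + bias r) = ennreal (1 - bias r)"
proof (cases r)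
  case (real x)
  have "exp (- x) * (1 + bias r) = 1 - bias r"
  proof -
    have "inverse E * (1 + (E - 1) / (E + 1)) = 1 - (E - 1) / (E + 1)" if "E > 0" for E :: real
      using that add_pos_pos[OF that, of 1] by (simp add: divide_simps)
    then show ?thesis by (simp add: real exp_minus)
  qed
  then show ?thesis using real by (simp flip: ennreal_mult')
qed auto

lemma exp_neg_weight': "exp_neg r * ennreal (1 + bias r) \<le> ennreal (1 - bias r)"
proof (cases "r = -\<infinity>")
  case False
  then show ?thesis using exp_neg_weight[of r] by simp
qed simp

text \<open>A channel is represented by the law \<open>N\<close> of its log-likelihood ratio under the uniform prior,
  which is any law with mean bias 0; given that the input bit is \<open>+1\<close>, the law is \<open>llr N\<close>.\<close>

definition chan :: "ereal measure \<Rightarrow> bool" where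
  "chan N \<longleftrightarrow> prob_space N \<and> sets N = sets borel \<and> (\<integral>r. bias r \<partial>N) = 0"

definition llr :: "ereal measure \<Rightarrow> ereal measure" where
  "llr N = density N (\<lambda>r. ennreal (1 + bias r))"

lemma chan_prob: "chan N \<Longrightarrow> prob_space N" and chan_sets: "chan N \<Longrightarrow> sets N = sets borel"
  and chan_mean: "chan N \<Longrightarrow> (\<integral>r. bias r \<partial>N) = 0"
  by (auto simp: chan_def)

lemma integrable_bounded_bias:
  assumes "prob_space N" "sets N = sets borel" "f \<in> borel_measurable borel" "\<And>r. \<bar>f r\<bar> \<le> B"
  shows "integrable N (f :: ereal \<Rightarrow> real)"
proof -
  interpret prob_space N by fact
  show ?thesis
    using assms by (intro integrable_const_bound[of _ B]) (auto cong: measurable_cong_sets)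
qed

lemma nn_integral_tilt:
  assumes "chan N" "\<bar>t\<bar> \<le> 1"
  shows "(\<integral>\<^sup>+ r. ennreal (1 + t * bias r) \<partial>N) = 1"
proof -
  interpret prob_space N using assms by (simp add: chan_def)
  have sp: "measure N (space N) = 1" by (rule prob_space)
  have i: "integrable N bias"
    using assms by (intro integrable_bounded_bias[of _ _ 1]) (auto simp: chan_def)
  have b: "\<bar>t * bias r\<bar> \<le> 1" for r
    using assms mult_mono[of "\<bar>t\<bar>" 1 "\<bar>bias r\<bar>" 1] by (simp add: abs_mult)
  have "0 \<le> 1 + t * bias r" for r using b[of r] by linarith
  then have "(\<integral>\<^sup>+ r. ennreal (1 + t * bias r) \<partial>N) = ennreal (\<integral>r. 1 + t * bias r \<partial>N)"
    using i by (intro nn_integral_eq_integral) auto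
  also have "(\<integral>r. 1 + t * bias r \<partial>N) = 1"
    using i sp assms by (simp add: chan_def)
  finally show ?thesis by simp
qed

lemma chan_iff:
  "chan N \<longleftrightarrow> prob_space N \<and> sets N = sets borel \<and> (\<integral>\<^sup>+ r. ennreal (1 + bias r) \<partial>N) = 1"
proof -
  have "(\<integral>r. bias r \<partial>N) = 0"
    if N: "prob_space N" "sets N = sets borel" and 1: "(\<integral>\<^sup>+ r. ennreal (1 + bias r) \<partial>N) = 1"
  proof -
    interpret prob_space N by fact
    have sp: "measure N (space N) = 1" by (rule prob_space)
    have i: "integrable N bias" using N by (intro integrable_bounded_bias[of _ _ 1]) auto
    have "0 \<le> 1 + bias r" for r using bias_ge_m1[of r] by linarith
    then have "(\<integral>\<^sup>+ r. ennreal (1 + bias r) \<partial>N) = ennreal (\<integral>r. 1 + bias r \<partial>N)"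
      using i by (intro nn_integral_eq_integral) auto
    then have "(\<integral>r. 1 + bias r \<partial>N) = 1"
      using 1 by (metis ennreal_eq_1)
    then show ?thesis using i sp by simp
  qed
  then show ?thesis using nn_integral_tilt[of N 1] by (auto simp: chan_def)
qed

lemma sets_llr: "chan N \<Longrightarrow> sets (llr N) = sets borel"
  by (simp add: llr_def chan_def)

lemma prob_density_tilt:
  assumes "chan N" "\<bar>t\<bar> \<le> 1"
  shows "prob_space (density N (\<lambda>r. ennreal (1 + t * bias r)))"
proof (rule prob_spaceI)
  have [measurable_cong]: "sets N = sets borel" using assms by (simp add: chan_def)
  show "emeasure (density N (\<lambda>r. ennreal (1 + t * bias r))) (space (density N (\<lambda>r. ennreal (1 + t * bias r)))) = 1"
    using nn_integral_tilt[OF assms] by (simp add: emeasure_density)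
qed

lemma emeasure_density_singleton:
  fixes f :: "ereal \<Rightarrow> ennreal"
  assumes N[measurable_cong]: "sets N = sets borel" and [measurable]: "f \<in> borel_measurable borel" and "f a = 0"
  shows "emeasure (density N f) {a} = 0"
proof -
  have "(\<integral>\<^sup>+ r. f r * indicator {a} r \<partial>N) = (\<integral>\<^sup>+ r. 0 \<partial>N)"
    using assms(3) by (intro nn_integral_cong) (auto simp: indicator_def)
  then show ?thesis by (subst emeasure_density) (auto simp: N)
qed

lemma LLR_llr:
  assumes "chan N"
  shows "LLR_dist (llr N)"
proof -
  have [measurable_cong]: "sets N = sets borel" using assms by (simp add: chan_def)
  have "prob_space (llr N)" using prob_density_tilt[OF assms, of 1] by (simp add: llr_def)
  moreover have "emeasure (llr N) {-\<infinity>} = 0"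
    unfolding llr_def using assms by (intro emeasure_density_singleton) (auto simp: chan_def)
  moreover have "(\<integral>\<^sup>+ r. exp_neg r \<partial>llr N) \<le> 1"
  proof -
    have "(\<integral>\<^sup>+ r. exp_neg r \<partial>llr N) = (\<integral>\<^sup>+ r. ennreal (1 + bias r) * exp_neg r \<partial>N)"
      unfolding llr_def by (subst nn_integral_density) auto
    also have "\<dots> \<le> (\<integral>\<^sup>+ r. ennreal (1 + (-1) * bias r) \<partial>N)"
      using exp_neg_weight' by (intro nn_integral_mono) (simp add: mult.commute)
    also have "\<dots> = 1" using assms by (intro nn_integral_tilt) auto
    finally show ?thesis .
  qed
  ultimately show ?thesis using assms
    by (simp add: LLR_dist_def dist_above_MInf_def sets_llr)
qed

text \<open>Given the bit -1, an outcome of bias \<open>b\<close> has weight \<open>1 - b\<close>.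
  On finite values this is \<open>exp_neg\<close> times the weight given +1; outcomes at
  \<open>-\<infinity>\<close>, which exclude +1, supply the remaining mass.\<close>

lemma complement_llr:
  assumes "chan N"
  shows "complement (llr N) = density N (\<lambda>r. ennreal (1 - bias r))"
proof -
  have [measurable_cong]: "sets N = sets borel" using assms by (simp add: chan_def)
  have "is_complement (llr N) (density N (\<lambda>r. ennreal (1 - bias r)))"
    unfolding is_complement_def dist_below_PInf_def
  proof (intro conjI ballI impI)
    show "prob_space (density N (\<lambda>r. ennreal (1 - bias r)))"
      using prob_density_tilt[OF assms, of "-1"] by simp
    show "sets (density N (\<lambda>r. ennreal (1 - bias r))) = sets borel" using assms by (simp add: chan_def)
    show "emeasure (density N (\<lambda>r. ennreal (1 - bias r))) {\<infinity>} = 0"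
      using assms by (intro emeasure_density_singleton) (auto simp: chan_def)
    fix E :: "ereal set" assume E[measurable]: "E \<in> sets borel" and "E \<subseteq> {-\<infinity><..<\<infinity>}"
    then have nE: "-\<infinity> \<notin> E" by auto
    have "(\<integral>\<^sup>+ r. exp_neg r * indicator E r \<partial>llr N) = (\<integral>\<^sup>+ r. ennreal (1 + bias r) * (exp_neg r * indicator E r) \<partial>N)"
      unfolding llr_def by (subst nn_integral_density) auto
    also have "\<dots> = (\<integral>\<^sup>+ r. ennreal (1 - bias r) * indicator E r \<partial>N)"
    proof (rule nn_integral_cong)
      fix r show "ennreal (1 + bias r) * (exp_neg r * indicator E r) = ennreal (1 - bias r) * indicator E r"
        using nE exp_neg_weight[of r] by (cases "r \<in> E") (auto simp: mult.commute)
    qed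
    finally show "emeasure (density N (\<lambda>r. ennreal (1 - bias r))) E = (\<integral>\<^sup>+ r. exp_neg r * indicator E r \<partial>llr N)"
      by (simp add: emeasure_density)
  qed
  then show ?thesis
    unfolding complement_def using complement_ex1[OF LLR_llr[OF assms]] by (intro the1_equality)
qed

lemma mixture_llr:
  assumes "chan N" "\<delta> \<in> {0..1}"
  shows "mixture \<delta> (llr N) (complement (llr N)) = density N (\<lambda>r. ennreal (1 + (1 - 2 * \<delta>) * bias r))"
proof (rule measure_eqI)
  have [measurable_cong]: "sets N = sets borel" using assms by (simp add: chan_def)
  show "sets (mixture \<delta> (llr N) (complement (llr N))) = sets (density N (\<lambda>r. ennreal (1 + (1 - 2 * \<delta>) * bias r)))"
    using assms by (simp add: chan_def)
  fix E assume "E \<in> sets (mixture \<delta> (llr N) (complement (llr N)))"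
  then have [measurable]: "E \<in> sets borel" by simp
  have "emeasure (mixture \<delta> (llr N) (complement (llr N))) E =
      ennreal (1 - \<delta>) * (\<integral>\<^sup>+ r. ennreal (1 + bias r) * indicator E r \<partial>N) +
      ennreal \<delta> * (\<integral>\<^sup>+ r. ennreal (1 - bias r) * indicator E r \<partial>N)"
    unfolding complement_llr[OF assms(1)]
    unfolding llr_def
    using assms by (subst emeasure_mixture) (simp_all add: chan_sets emeasure_density)
  also have "\<dots> = (\<integral>\<^sup>+ r. ennreal (1 - \<delta>) * (ennreal (1 + bias r) * indicator E r) +
      ennreal \<delta> * (ennreal (1 - bias r) * indicator E r) \<partial>N)"
    by (simp add: nn_integral_add nn_integral_cmult)
  also have "\<dots> = (\<integral>\<^sup>+ r. ennreal (1 + (1 - 2 * \<delta>) * bias r) * indicator E r \<partial>N)"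
  proof (rule nn_integral_cong)
    fix r
    have "0 \<le> 1 + bias r" "0 \<le> 1 - bias r" using bias_ge_m1[of r] bias_le_1[of r] by linarith+
    moreover have "(1 - \<delta>) * (1 + bias r) + \<delta> * (1 - bias r) = 1 + (1 - 2 * \<delta>) * bias r"
      by (simp add: algebra_simps)
    ultimately have "ennreal (1 - \<delta>) * ennreal (1 + bias r) + ennreal \<delta> * ennreal (1 - bias r) = ennreal (1 + (1 - 2 * \<delta>) * bias r)"
      using assms by (simp flip: ennreal_mult ennreal_plus)
    then show "ennreal (1 - \<delta>) * (ennreal (1 + bias r) * indicator E r) + ennreal \<delta> * (ennreal (1 - bias r) * indicator E r) =
        ennreal (1 + (1 - 2 * \<delta>) * bias r) * indicator E r"
      by (cases "r \<in> E") auto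
  qed
  finally show "emeasure (mixture \<delta> (llr N) (complement (llr N))) E = emeasure (density N (\<lambda>r. ennreal (1 + (1 - 2 * \<delta>) * bias r))) E"
    by (simp add: emeasure_density)
qed

lemma LLR_imp_llr:
  assumes "LLR_dist \<mu>"
  obtains N where "chan N" "\<mu> = llr N"
proof
  define \<nu> where "\<nu> = complement \<mu>"
  have \<mu>[measurable_cong]: "sets \<mu> = sets borel" and pm: "prob_space \<mu>" and m0: "emeasure \<mu> {-\<infinity>} = 0"
    using assms by (auto simp: LLR_dist_def dist_above_MInf_def)
  have c: "is_complement \<mu> \<nu>"
    unfolding \<nu>_def complement_def by (rule theI'[OF complement_ex1[OF assms]])
  then have \<nu>[measurable_cong]: "sets \<nu> = sets borel" and pn: "prob_space \<nu>" and n0: "emeasure \<nu> {\<infinity>} = 0"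
    by (auto simp: is_complement_def dist_below_PInf_def)
  \<comment> \<open>A uniform bit averages the two conditional laws.\<close>
  define N where "N = mixture (1/2) \<mu> \<nu>"
  have sN[measurable_cong]: "sets N = sets borel" by (simp add: N_def)
  have half: "ennreal (1/2) + ennreal (1/2) = 1"
    by (subst ennreal_plus[symmetric]) auto
  have pN: "prob_space N"
  proof (rule prob_spaceI)
    have "emeasure \<mu> UNIV = 1" "emeasure \<nu> UNIV = 1"
      using prob_space.emeasure_space_1[OF pm] prob_space.emeasure_space_1[OF pn]
        sets_eq_imp_space_eq[OF \<mu>] sets_eq_imp_space_eq[OF \<nu>] by auto
    then show "emeasure N (space N) = 1"
      using half by (simp add: N_def emeasure_mixture \<mu> \<nu> sets_eq_imp_space_eq[OF sets_mixture])
  qed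
  define fin where "fin = {-\<infinity><..<\<infinity> :: ereal}"
  have fin[measurable]: "fin \<in> sets borel" by (simp add: fin_def)
  have dens: "density \<nu> (indicator fin) = density \<mu> (\<lambda>r. exp_neg r * indicator fin r)"
  proof (rule measure_eqI)
    show "sets (density \<nu> (indicator fin)) = sets (density \<mu> (\<lambda>r. exp_neg r * indicator fin r))"
      by (simp add: \<mu> \<nu>)
    fix E assume "E \<in> sets (density \<nu> (indicator fin))"
    then have [measurable]: "E \<in> sets borel" by (simp add: \<nu>)
    have "emeasure (density \<nu> (indicator fin)) E = emeasure \<nu> (E \<inter> fin)"
      by (simp add: emeasure_density indicator_inter_arith[symmetric] \<nu> Int_commute)
    also have "\<dots> = (\<integral>\<^sup>+ r. exp_neg r * indicator (E \<inter> fin) r \<partial>\<mu>)"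
      using c by (simp add: is_complement_def fin_def)
    also have "\<dots> = emeasure (density \<mu> (\<lambda>r. exp_neg r * indicator fin r)) E"
      by (subst emeasure_density) (auto intro!: nn_integral_cong simp: indicator_def)
    finally show "emeasure (density \<nu> (indicator fin)) E = emeasure (density \<mu> (\<lambda>r. exp_neg r * indicator fin r)) E" .
  qed
  \<comment> \<open>The condition at \<open>-\<infinity>\<close> excludes the one point where
    \<open>\<nu>\<close> may have mass that \<open>\<mu>\<close> does not see. The factor
    \<open>1 + bias r\<close> of the integrand below vanishes there.\<close>
  have int\<nu>: "(\<integral>\<^sup>+ r. g r \<partial>\<nu>) = (\<integral>\<^sup>+ r. exp_neg r * g r \<partial>\<mu>)"
    if [measurable]: "g \<in> borel_measurable borel" and "g (-\<infinity>) = 0" for g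
  proof -
    have "AE r in \<nu>. r \<noteq> \<infinity>" using n0 by (intro AE_I[of _ _ "{\<infinity>}"]) (auto simp: \<nu>)
    then have "(\<integral>\<^sup>+ r. g r \<partial>\<nu>) = (\<integral>\<^sup>+ r. indicator fin r * g r \<partial>\<nu>)"
    proof (intro nn_integral_cong_AE, eventually_elim)
      fix r :: ereal assume "r \<noteq> \<infinity>"
      then show "g r = indicator fin r * g r"
        using that(2) by (cases r) (auto simp: fin_def)
    qed
    also have "\<dots> = (\<integral>\<^sup>+ r. g r \<partial>density \<nu> (indicator fin))"
      by (subst nn_integral_density) auto
    also have "\<dots> = (\<integral>\<^sup>+ r. exp_neg r * indicator fin r * g r \<partial>\<mu>)"
      unfolding dens by (subst nn_integral_density) auto
    also have "\<dots> = (\<integral>\<^sup>+ r. exp_neg r * g r \<partial>\<mu>)"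
    proof (rule nn_integral_cong)
      fix r show "exp_neg r * indicator fin r * g r = exp_neg r * g r"
        using that(2) by (cases r) (auto simp: fin_def indicator_def)
    qed
    finally show ?thesis .
  qed
  have eq: "\<mu> = llr N"
  proof (rule measure_eqI)
    show "sets \<mu> = sets (llr N)" by (simp add: \<mu> llr_def sN)
    fix E assume "E \<in> sets \<mu>"
    then have [measurable]: "E \<in> sets borel" by (simp add: \<mu>)
    let ?g = "\<lambda>r. ennreal (1 + bias r) * indicator E r"
    have "emeasure (llr N) E = (\<integral>\<^sup>+ r. ?g r \<partial>N)"
      by (simp add: llr_def emeasure_density)
    also have "\<dots> = ennreal (1/2) * (\<integral>\<^sup>+ r. ?g r \<partial>\<mu>) + ennreal (1/2) * (\<integral>\<^sup>+ r. exp_neg r * ?g r \<partial>\<mu>)"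
      unfolding N_def by (simp add: nn_integral_mixture \<mu> \<nu> int\<nu>)
    also have "\<dots> = (\<integral>\<^sup>+ r. ennreal (1/2) * ?g r + ennreal (1/2) * (exp_neg r * ?g r) \<partial>\<mu>)"
      by (simp add: nn_integral_add nn_integral_cmult)
    also have "\<dots> = (\<integral>\<^sup>+ r. indicator E r \<partial>\<mu>)"
    proof (rule nn_integral_cong_AE)
      have "AE r in \<mu>. r \<noteq> -\<infinity>" using m0 by (intro AE_I[of _ _ "{-\<infinity>}"]) (auto simp: \<mu>)
      then show "AE r in \<mu>. ennreal (1/2) * ?g r + ennreal (1/2) * (exp_neg r * ?g r) = indicator E r"
      proof eventually_elim
        fix r :: ereal assume r: "r \<noteq> -\<infinity>"
        have n: "0 \<le> 1 + bias r" "0 \<le> 1 - bias r" using bias_ge_m1[of r] bias_le_1[of r] by linarith+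
        have "ennreal (1/2) * ennreal (1 + bias r) + ennreal (1/2) * ennreal (1 - bias r) =
            ennreal (1/2 * (1 + bias r) + 1/2 * (1 - bias r))"
          using n by (subst (1 2) ennreal_mult[symmetric]) (auto intro!: ennreal_plus[symmetric])
        also have "\<dots> = 1" by (simp add: field_simps)
        finally have "ennreal (1/2) * ennreal (1 + bias r) + ennreal (1/2) * (exp_neg r * ennreal (1 + bias r)) = 1"
          unfolding exp_neg_weight[OF r] .
        then show "ennreal (1/2) * ?g r + ennreal (1/2) * (exp_neg r * ?g r) = indicator E r"
          by (cases "r \<in> E") auto
      qed
    qed
    finally show "emeasure \<mu> E = emeasure (llr N) E" by (simp add: \<mu>)
  qed
  show "\<mu> = llr N" by fact
  have "(\<integral>\<^sup>+ r. ennreal (1 + bias r) \<partial>N) = emeasure (llr N) UNIV"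
    by (simp add: llr_def emeasure_density)
  also have "\<dots> = 1"
    using prob_space.emeasure_space_1[OF pm] sets_eq_imp_space_eq[OF \<mu>] by (simp flip: eq)
  finally show "chan N" using pN sN by (simp add: chan_iff)
qed

section \<open>The BP operator on channels\<close>

lemma measure_eqI_nn_integral:
  assumes "sets M = sets borel" "sets N = sets borel"
    and "\<And>h. h \<in> borel_measurable borel \<Longrightarrow> (\<integral>\<^sup>+ r. h r \<partial>M) = (\<integral>\<^sup>+ r. h r \<partial>N)"
  shows "M = (N :: ereal measure)"
proof (rule measure_eqI)
  fix E assume "E \<in> sets M"
  then have E: "E \<in> sets borel" using assms by simp
  have "emeasure M E = (\<integral>\<^sup>+ r. indicator E r \<partial>M)" using E assms by simp
  also have "\<dots> = (\<integral>\<^sup>+ r. indicator E r \<partial>N)" using E by (intro assms) auto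
  also have "\<dots> = emeasure N E" using E assms by simp
  finally show "emeasure M E = emeasure N E" .
qed (use assms in simp)

lemma nn_integral_pair:
  assumes "prob_space N" "f \<in> borel_measurable (M \<Otimes>\<^sub>M N)"
  shows "(\<integral>\<^sup>+ z. f z \<partial>(M \<Otimes>\<^sub>M N)) = (\<integral>\<^sup>+ x. \<integral>\<^sup>+ y. f (x, y) \<partial>N \<partial>M)"
proof -
  interpret prob_space N by fact
  show ?thesis using assms by (simp add: nn_integral_fst)
qed

definition sum_law :: "ereal measure \<Rightarrow> ereal measure \<Rightarrow> ereal measure" where
  "sum_law M N = distr (M \<Otimes>\<^sub>M N) borel (\<lambda>(x, y). x + y)"

lemma nn_integral_sum_law:
  assumes [measurable_cong]: "sets M = sets borel" "sets N = sets borel" and "prob_space N"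
    and [measurable]: "h \<in> borel_measurable borel"
  shows "(\<integral>\<^sup>+ r. h r \<partial>sum_law M N) = (\<integral>\<^sup>+ x. \<integral>\<^sup>+ y. h (x + y) \<partial>N \<partial>M)"
  unfolding sum_law_def using assms(3)
  by (simp add: nn_integral_distr nn_integral_pair)

definition scale_chan :: "real \<Rightarrow> ereal measure \<Rightarrow> ereal measure" where
  "scale_chan \<delta> N = distr N borel (F_BP \<delta>)"

lemma nn_integral_scale_chan:
  assumes "sets N = sets borel" "\<delta> \<in> {0..1}" "h \<in> borel_measurable borel"
  shows "(\<integral>\<^sup>+ r. h r \<partial>scale_chan \<delta> N) = (\<integral>\<^sup>+ r. h (F_BP \<delta> r) \<partial>N)"
proof -
  have [measurable_cong]: "sets N = sets borel" by fact
  note F_BP_measurable[OF assms(2), measurable]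
  show ?thesis unfolding scale_chan_def using assms by (simp add: nn_integral_distr)
qed

lemma chan_scale_chan:
  assumes "chan N" "\<delta> \<in> {0..1}"
  shows "chan (scale_chan \<delta> N)"
proof -
  have [measurable_cong]: "sets N = sets borel" using assms by (simp add: chan_def)
  note F_BP_measurable[OF assms(2), measurable]
  have "prob_space (scale_chan \<delta> N)"
    unfolding scale_chan_def using chan_prob[OF assms(1)] by (intro prob_space.prob_space_distr) auto
  moreover have "(\<integral>\<^sup>+ r. ennreal (1 + bias r) \<partial>scale_chan \<delta> N) = 1"
    using assms nn_integral_tilt[of N "1 - 2 * \<delta>"]
    by (simp add: nn_integral_scale_chan chan_sets bias_F_BP abs_le_iff)
  ultimately show ?thesis by (simp add: chan_iff scale_chan_def)
qed

lemma llr_scale_chan: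
  assumes "chan N" "\<delta> \<in> {0..1}"
  shows "llr (scale_chan \<delta> N) = distr (mixture \<delta> (llr N) (complement (llr N))) borel (F_BP \<delta>)"
proof -
  have [measurable_cong]: "sets N = sets borel" using assms by (simp add: chan_def)
  note F_BP_measurable[OF assms(2), measurable]
  show ?thesis
    unfolding llr_def[of "scale_chan \<delta> N"] mixture_llr[OF assms] unfolding scale_chan_def
    using assms by (simp add: density_distr bias_F_BP)
qed

text \<open>Two observations of one uniform bit are correlated: averaging
  \<open>(1 \<plusminus> a) * (1 \<plusminus> b)\<close> over the bit gives the joint density
  \<open>1 + a * b\<close> relative to the product of the marginals. Opposite infinities, whose sum
  is a convention, get weight 0.\<close>

definition prod_chan :: "ereal measure \<Rightarrow> ereal measure \<Rightarrow> ereal measure" where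
  "prod_chan A B = distr (density (A \<Otimes>\<^sub>M B) (\<lambda>(x, y). ennreal (1 + bias x * bias y))) borel (\<lambda>(x, y). x + y)"

lemma sets_prod_chan [simp]: "sets (prod_chan A B) = sets borel"
  by (simp add: prod_chan_def)

lemma nn_integral_prod_chan:
  assumes A: "chan A" and B: "chan B" and [measurable]: "h \<in> borel_measurable borel"
  shows "(\<integral>\<^sup>+ r. h r \<partial>prod_chan A B) = (\<integral>\<^sup>+ x. \<integral>\<^sup>+ y. ennreal (1 + bias x * bias y) * h (x + y) \<partial>B \<partial>A)"
proof -
  have [measurable_cong]: "sets A = sets borel" "sets B = sets borel" using A B by (auto simp: chan_def)
  have "(\<integral>\<^sup>+ r. h r \<partial>prod_chan A B) =
      (\<integral>\<^sup>+ z. (case z of (x, y) \<Rightarrow> ennreal (1 + bias x * bias y)) * h (case z of (x, y) \<Rightarrow> x + y) \<partial>(A \<Otimes>\<^sub>M B))"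
    unfolding prod_chan_def by (simp add: nn_integral_distr nn_integral_density split_beta')
  then show ?thesis
    using chan_prob[OF B] by (simp add: nn_integral_pair split_beta')
qed

lemma abs_bias_mult_le_1: "\<bar>bias x * bias y\<bar> \<le> 1"
  using mult_mono[of "\<bar>bias x\<bar>" 1 "\<bar>bias y\<bar>" 1] by (simp add: abs_mult)

lemma one_plus_bias_mult_nonneg: "0 \<le> 1 + bias x * bias y"
  using abs_bias_mult_le_1[of x y] by linarith

lemma one_plus_bias_nonneg: "0 \<le> 1 + bias x"
  using bias_ge_m1[of x] by linarith

text \<open>The addition law of tanh, multiplied out so that it also holds at opposite infinities,
  where both sides are 0.\<close>

lemma bias_add: "(1 + bias x * bias y) * bias (x + y) = bias x + bias y"
proof (cases "\<bar>x\<bar> = \<infinity> \<or> \<bar>y\<bar> = \<infinity>")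
  case True
  then show ?thesis by (cases x; cases y) (auto simp: minus_divide_left)
next
  case False
  then obtain a b where ab: "x = ereal a" "y = ereal b" by (cases x; cases y) auto
  have "(1 + (p - 1) / (p + 1) * ((q - 1) / (q + 1))) * ((p * q - 1) / (p * q + 1)) =
      (p - 1) / (p + 1) + (q - 1) / (q + 1)" if "p > 0" "q > 0" for p q :: real
  proof -
    have "p + 1 > 0" "q + 1 > 0" "p * q + 1 > 0" using that by (auto intro: add_pos_pos)
    moreover have "1 + (p - 1) / (p + 1) * ((q - 1) / (q + 1)) = 2 * (p * q + 1) / ((p + 1) * (q + 1))"
      using calculation by (simp add: divide_simps) (simp add: algebra_simps)
    ultimately show ?thesis
      by (simp add: divide_simps) (simp add: algebra_simps)
  qed
  then show ?thesis by (simp add: ab exp_add)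
qed

lemma weight_add:
  "ennreal (1 + bias x * bias y) * ennreal (1 + bias (x + y)) = ennreal (1 + bias x) * ennreal (1 + bias y)"
proof -
  have "(1 + bias x * bias y) * (1 + bias (x + y)) = (1 + bias x) * (1 + bias y)"
    using bias_add[of x y] by (simp add: algebra_simps)
  then show ?thesis
    using one_plus_bias_mult_nonneg[of x y] one_plus_bias_nonneg by (simp flip: ennreal_mult)
qed

lemma chan_prod_chan:
  assumes A: "chan A" and B: "chan B"
  shows "chan (prod_chan A B)"
proof -
  have [measurable_cong]: "sets A = sets borel" "sets B = sets borel" using A B by (auto simp: chan_def)
  interpret A: prob_space A using A by (simp add: chan_def)
  have "emeasure (prod_chan A B) UNIV = (\<integral>\<^sup>+ r. 1 \<partial>prod_chan A B)"
    using sets_eq_imp_space_eq[OF sets_prod_chan] by simp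
  also have "\<dots> = (\<integral>\<^sup>+ x. \<integral>\<^sup>+ y. ennreal (1 + bias x * bias y) \<partial>B \<partial>A)"
    using assms by (subst nn_integral_prod_chan) auto
  also have "\<dots> = 1"
    using nn_integral_tilt[OF B] by (simp add: A.emeasure_space_1)
  finally have "prob_space (prod_chan A B)"
    using sets_eq_imp_space_eq[OF sets_prod_chan, of A B] by (intro prob_spaceI) simp
  moreover have "(\<integral>\<^sup>+ r. ennreal (1 + bias r) \<partial>prod_chan A B) = 1"
  proof -
    have "(\<integral>\<^sup>+ r. ennreal (1 + bias r) \<partial>prod_chan A B) = (\<integral>\<^sup>+ x. \<integral>\<^sup>+ y. ennreal (1 + bias x) * ennreal (1 + bias y) \<partial>B \<partial>A)"
      using assms by (subst nn_integral_prod_chan) (auto simp: weight_add)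
    also have "\<dots> = 1"
      using nn_integral_tilt[OF B, of 1] nn_integral_tilt[OF A, of 1] by (simp add: nn_integral_cmult)
    finally show ?thesis .
  qed
  ultimately show ?thesis by (simp add: chan_iff)
qed

lemma nn_integral_llr:
  assumes "chan N" "h \<in> borel_measurable borel"
  shows "(\<integral>\<^sup>+ r. h r \<partial>llr N) = (\<integral>\<^sup>+ r. ennreal (1 + bias r) * h r \<partial>N)"
proof -
  have [measurable_cong]: "sets N = sets borel" using assms by (simp add: chan_def)
  show ?thesis using assms unfolding llr_def by (simp add: nn_integral_density)
qed

lemma prob_space_llr: "chan N \<Longrightarrow> prob_space (llr N)"
  using LLR_llr by (auto simp: LLR_dist_def dist_above_MInf_def)

text \<open>Given the bit, the observations are independent, so the conditional log-likelihood
  ratios add. By \<open>weight_add\<close>, tilting by the bit turns the joint density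
  \<open>1 + a * b\<close> into \<open>(1 + a) * (1 + b)\<close>.\<close>

lemma sum_law_llr:
  assumes A: "chan A" and B: "chan B"
  shows "sum_law (llr A) (llr B) = llr (prod_chan A B)"
proof (rule measure_eqI_nn_integral)
  show "sets (sum_law (llr A) (llr B)) = sets borel" by (simp add: sum_law_def)
  show "sets (llr (prod_chan A B)) = sets borel" by (simp add: llr_def)
  fix h :: "ereal \<Rightarrow> ennreal" assume [measurable]: "h \<in> borel_measurable borel"
  have sA[measurable_cong]: "sets A = sets borel" and sB[measurable_cong]: "sets B = sets borel"
    using A B by (auto simp: chan_def)
  interpret B: prob_space B using B by (simp add: chan_def)
  have "(\<integral>\<^sup>+ r. h r \<partial>sum_law (llr A) (llr B)) = (\<integral>\<^sup>+ x. \<integral>\<^sup>+ y. h (x + y) \<partial>llr B \<partial>llr A)"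
    using assms by (simp add: nn_integral_sum_law sets_llr prob_space_llr)
  also have "\<dots> = (\<integral>\<^sup>+ x. \<integral>\<^sup>+ y. ennreal (1 + bias y) * h (x + y) \<partial>B \<partial>llr A)"
    using assms by (simp add: nn_integral_llr)
  also have "\<dots> = (\<integral>\<^sup>+ x. ennreal (1 + bias x) * (\<integral>\<^sup>+ y. ennreal (1 + bias y) * h (x + y) \<partial>B) \<partial>A)"
    using assms by (intro nn_integral_llr) auto
  also have "\<dots> = (\<integral>\<^sup>+ x. \<integral>\<^sup>+ y. ennreal (1 + bias x) * (ennreal (1 + bias y) * h (x + y)) \<partial>B \<partial>A)"
    by (simp add: nn_integral_cmult)
  also have "\<dots> = (\<integral>\<^sup>+ x. \<integral>\<^sup>+ y. ennreal (1 + bias x * bias y) * (ennreal (1 + bias (x + y)) * h (x + y)) \<partial>B \<partial>A)"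
    by (simp add: weight_add flip: mult.assoc)
  also have "\<dots> = (\<integral>\<^sup>+ r. ennreal (1 + bias r) * h r \<partial>prod_chan A B)"
    using assms by (subst nn_integral_prod_chan) auto
  also have "\<dots> = (\<integral>\<^sup>+ r. h r \<partial>llr (prod_chan A B))"
    using chan_prod_chan[OF A B] by (simp add: nn_integral_llr)
  finally show "(\<integral>\<^sup>+ r. h r \<partial>sum_law (llr A) (llr B)) = (\<integral>\<^sup>+ r. h r \<partial>llr (prod_chan A B))" .
qed

text \<open>The leaf channel \<open>X\<close> includes the noise on the edge. Placing the survey in the base case lets the
  recursion mirror \<open>(\<Sum>u<d. \<dots>) + s\<close>.\<close>

primrec star :: "ereal measure \<Rightarrow> ereal measure \<Rightarrow> nat \<Rightarrow> ereal measure" where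
  "star S X 0 = S"
| "star S X (Suc d) = prod_chan X (star S X d)"

definition BP_chan :: "real \<Rightarrow> nat pmf \<Rightarrow> ereal measure \<Rightarrow> ereal measure \<Rightarrow> ereal measure" where
  "BP_chan \<delta> P S N = measure_pmf P \<bind> star S (scale_chan \<delta> N)"

lemma chan_star: "chan S \<Longrightarrow> chan X \<Longrightarrow> chan (star S X d)"
  by (induction d) (auto simp: chan_prod_chan)

lemma star_measurable: 
  assumes "chan S" "chan X"
  shows "star S X \<in> measurable (measure_pmf P) (subprob_algebra borel)"
proof -
  have "star S X d \<in> space (subprob_algebra borel)" for d
    using chan_star[OF assms, of d] by (auto simp: space_subprob_algebra chan_def prob_space_imp_subprob_space)
  then show ?thesis by (simp add: measurable_pmf_measure1)
qed

lemma nn_integral_BP_chan: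
  assumes "chan S" "chan N" "\<delta> \<in> {0..1}" "h \<in> borel_measurable borel"
  shows "(\<integral>\<^sup>+ r. h r \<partial>BP_chan \<delta> P S N) = (\<integral>\<^sup>+ d. \<integral>\<^sup>+ r. h r \<partial>star S (scale_chan \<delta> N) d \<partial>measure_pmf P)"
  unfolding BP_chan_def
  by (rule nn_integral_bind[OF assms(4)]) (intro star_measurable assms chan_scale_chan)

lemma sets_BP_chan:
  assumes "chan S" "chan N" "\<delta> \<in> {0..1}"
  shows "sets (BP_chan \<delta> P S N) = sets borel"
  unfolding BP_chan_def
  using chan_star[OF assms(1) chan_scale_chan[OF assms(2,3)]] by (intro sets_bind) (auto simp: chan_def)

lemma chan_BP_chan:
  assumes "chan S" "chan N" "\<delta> \<in> {0..1}"
  shows "chan (BP_chan \<delta> P S N)"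
proof -
  note c = chan_star[OF assms(1) chan_scale_chan[OF assms(2,3)]]
  have "emeasure (BP_chan \<delta> P S N) (space (BP_chan \<delta> P S N)) = (\<integral>\<^sup>+ r. 1 \<partial>BP_chan \<delta> P S N)" by simp
  also have "\<dots> = 1"
    using c by (subst nn_integral_BP_chan[OF assms]) (auto simp: chan_def prob_space.emeasure_space_1)
  finally have "prob_space (BP_chan \<delta> P S N)" by (rule prob_spaceI)
  moreover have "(\<integral>\<^sup>+ r. ennreal (1 + bias r) \<partial>BP_chan \<delta> P S N) = 1"
    using c by (subst nn_integral_BP_chan[OF assms]) (auto simp: chan_iff)
  ultimately show ?thesis using assms by (simp add: chan_iff sets_BP_chan)
qed

definition node_law :: "real \<Rightarrow> ereal measure \<Rightarrow> ereal measure \<Rightarrow> nat \<Rightarrow> ereal measure" where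
  "node_law \<delta> M \<mu>s d = distr ((\<Pi>\<^sub>M u\<in>(UNIV :: nat set). M) \<Otimes>\<^sub>M \<mu>s) borel (\<lambda>(r, s). (\<Sum>u<d. F_BP \<delta> (r u)) + s)"

lemma nn_integral_node_law:
  assumes sM[measurable_cong]: "sets M = sets borel" "sets \<mu>s = sets borel"
    and p: "prob_space M" "prob_space \<mu>s" and d: "\<delta> \<in> {0..1}"
    and [measurable]: "h \<in> borel_measurable borel"
  shows "(\<integral>\<^sup>+ z. h z \<partial>node_law \<delta> M \<mu>s d) =
    (\<integral>\<^sup>+ r. \<integral>\<^sup>+ s. h ((\<Sum>u<d. F_BP \<delta> (r u)) + s) \<partial>\<mu>s \<partial>(\<Pi>\<^sub>M u\<in>(UNIV :: nat set). M))"
proof -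
  note F_BP_measurable[OF d, measurable]
  show ?thesis unfolding node_law_def using p by (simp add: nn_integral_distr nn_integral_pair split_beta')
qed

lemma node_law_0:
  assumes sM: "sets M = sets borel" "sets \<mu>s = sets borel"
    and p: "prob_space M" "prob_space \<mu>s" and d: "\<delta> \<in> {0..1}"
  shows "node_law \<delta> M \<mu>s 0 = \<mu>s"
proof (rule measure_eqI_nn_integral)
  interpret S: prob_space "\<Pi>\<^sub>M u\<in>(UNIV :: nat set). M" using p(1) by (intro prob_space_PiM)
  fix h :: "ereal \<Rightarrow> ennreal" assume "h \<in> borel_measurable borel"
  then show "(\<integral>\<^sup>+ z. h z \<partial>node_law \<delta> M \<mu>s 0) = (\<integral>\<^sup>+ z. h z \<partial>\<mu>s)"
    by (simp add: nn_integral_node_law[OF sM p d] S.emeasure_space_1)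
qed (simp_all add: node_law_def sM)

text \<open>An i.i.d. sequence is one independent term followed by a copy of itself
  (\<open>PiM_iter\<close>). Splitting off index 0 leaves \<open>k\<close> terms together with the
  survey, which is the shape of \<open>star\<close>.\<close>

lemma node_law_Suc:
  assumes sM[measurable_cong]: "sets M = sets borel" "sets \<mu>s = sets borel"
    and p: "prob_space M" "prob_space \<mu>s" and d: "\<delta> \<in> {0..1}"
  shows "node_law \<delta> M \<mu>s (Suc k) = sum_law (distr M borel (F_BP \<delta>)) (node_law \<delta> M \<mu>s k)"
proof (rule measure_eqI_nn_integral)
  note F_BP_measurable[OF d, measurable]
  interpret M: prob_space M by fact
  interpret \<mu>s: prob_space \<mu>s by fact
  interpret MM: product_prob_space "\<lambda>i. M" "UNIV :: nat set" ..
  interpret sequence_space M ..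
  have pS: "prob_space S" by (rule prob_space_PiM) (rule p)
  interpret S: prob_space S by fact
  have pn: "prob_space (node_law \<delta> M \<mu>s k)"
    unfolding node_law_def
    by (intro prob_space.prob_space_distr prob_space_pair pS p) measurable
  have sn: "sets (node_law \<delta> M \<mu>s k) = sets borel" by (simp add: node_law_def)
  fix h :: "ereal \<Rightarrow> ennreal" assume [measurable]: "h \<in> borel_measurable borel"
  define G where "G r = (\<integral>\<^sup>+ s. h ((\<Sum>u<Suc k. F_BP \<delta> (r u)) + s) \<partial>\<mu>s)" for r
  have G[measurable]: "G \<in> borel_measurable S" unfolding G_def by measurable
  have "(\<integral>\<^sup>+ z. h z \<partial>node_law \<delta> M \<mu>s (Suc k)) = (\<integral>\<^sup>+ r. G r \<partial>S)"
    unfolding G_def by (rule nn_integral_node_law[OF sM p d]) measurable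
  also have "\<dots> = (\<integral>\<^sup>+ r. G r \<partial>distr (M \<Otimes>\<^sub>M S) S (\<lambda>(s, \<omega>). case_nat s \<omega>))"
    by (simp add: PiM_iter)
  also have "\<dots> = (\<integral>\<^sup>+ z. G (case z of (s, \<omega>) \<Rightarrow> case_nat s \<omega>) \<partial>(M \<Otimes>\<^sub>M S))"
    by (subst nn_integral_distr) measurable
  also have "\<dots> = (\<integral>\<^sup>+ x. \<integral>\<^sup>+ \<omega>. G (case_nat x \<omega>) \<partial>S \<partial>M)"
    by (subst nn_integral_pair[OF pS]) auto
  also have "\<dots> = (\<integral>\<^sup>+ x. \<integral>\<^sup>+ z. h (F_BP \<delta> x + z) \<partial>node_law \<delta> M \<mu>s k \<partial>M)"
    by (simp add: G_def sum.lessThan_Suc_shift nn_integral_node_law[OF sM p d] add.assoc del: sum.lessThan_Suc)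
  also have "\<dots> = (\<integral>\<^sup>+ x. \<integral>\<^sup>+ z. h (x + z) \<partial>node_law \<delta> M \<mu>s k \<partial>distr M borel (F_BP \<delta>))"
  proof -
    interpret n: prob_space "node_law \<delta> M \<mu>s k" by fact
    note sn[measurable_cong]
    show ?thesis by (subst nn_integral_distr) measurable
  qed
  also have "\<dots> = (\<integral>\<^sup>+ z. h z \<partial>sum_law (distr M borel (F_BP \<delta>)) (node_law \<delta> M \<mu>s k))"
    by (subst nn_integral_sum_law) (auto simp: pn sn)
  finally show "(\<integral>\<^sup>+ z. h z \<partial>node_law \<delta> M \<mu>s (Suc k)) =
      (\<integral>\<^sup>+ z. h z \<partial>sum_law (distr M borel (F_BP \<delta>)) (node_law \<delta> M \<mu>s k))" .
qed (simp_all add: node_law_def sum_law_def)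

text \<open>For fixed \<open>d\<close> the terms peel off by \<open>node_law_Suc\<close> and combine
  by \<open>sum_law_llr\<close>. The law of \<open>d\<close> does not depend on the bit, so tilting
  by \<open>1 + bias\<close> commutes with mixing over \<open>d\<close>.\<close>

lemma BP_llr:
  assumes S: "chan S" and N: "chan N" and d: "\<delta> \<in> {0..1}"
  shows "BP \<delta> P (llr S) (llr N) = llr (BP_chan \<delta> P S N)"
proof (rule measure_eqI_nn_integral)
  define M where "M = mixture \<delta> (llr N) (complement (llr N))"
  note X = chan_scale_chan[OF N d]
  have sM: "sets M = sets borel" by (simp add: M_def)
  have pM: "prob_space M"
    unfolding M_def mixture_llr[OF N d] using d by (intro prob_density_tilt N) (auto simp: abs_le_iff)
  have FM: "distr M borel (F_BP \<delta>) = llr (scale_chan \<delta> N)"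
    unfolding M_def by (rule llr_scale_chan[OF N d, symmetric])
  have node: "node_law \<delta> M (llr S) k = llr (star S (scale_chan \<delta> N) k)" for k
  proof (induction k)
    case 0
    show ?case using S d sM pM by (simp add: node_law_0 sets_llr prob_space_llr)
  next
    case (Suc k)
    then show ?case using S d sM pM chan_star[OF S X]
      by (simp add: node_law_Suc sets_llr prob_space_llr FM sum_law_llr[OF X])
  qed
  show "sets (BP \<delta> P (llr S) (llr N)) = sets borel" by (simp add: BP_def)
  show "sets (llr (BP_chan \<delta> P S N)) = sets borel" by (rule sets_llr[OF chan_BP_chan[OF S N d]])
  fix h :: "ereal \<Rightarrow> ennreal" assume h[measurable]: "h \<in> borel_measurable borel"
  have pP: "prob_space ((\<Pi>\<^sub>M u\<in>(UNIV :: nat set). M) \<Otimes>\<^sub>M llr S)"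
    by (intro prob_space_pair prob_space_PiM pM prob_space_llr S)
  note meas = BP_map_measurable[OF d sets_llr[OF S], of P "llr N" "complement (llr N)", folded M_def]
  have measd: "(\<lambda>(r, s). (\<Sum>u<k. F_BP \<delta> (r u)) + s) \<in> borel_measurable ((\<Pi>\<^sub>M u\<in>(UNIV :: nat set). M) \<Otimes>\<^sub>M llr S)" for k
  proof -
    note sM[measurable_cong] sets_llr[OF S, measurable_cong] F_BP_measurable[OF d, measurable]
    show ?thesis by measurable
  qed
  have "(\<integral>\<^sup>+ z. h z \<partial>BP \<delta> P (llr S) (llr N)) =
      (\<integral>\<^sup>+ k. \<integral>\<^sup>+ y. h (case y of (r, s) \<Rightarrow> (\<Sum>u<k. F_BP \<delta> (r u)) + s) \<partial>((\<Pi>\<^sub>M u\<in>(UNIV :: nat set). M) \<Otimes>\<^sub>M llr S) \<partial>measure_pmf P)"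
    unfolding BP_def M_def[symmetric]
    by (subst nn_integral_distr[OF meas], simp add: h, subst nn_integral_pair[OF pP],
        rule measurable_compose[OF meas h]) (simp add: split_beta')
  also have "\<dots> = (\<integral>\<^sup>+ k. \<integral>\<^sup>+ z. h z \<partial>node_law \<delta> M (llr S) k \<partial>measure_pmf P)"
    unfolding node_law_def by (subst nn_integral_distr[OF measd]) simp_all
  also have "\<dots> = (\<integral>\<^sup>+ k. \<integral>\<^sup>+ z. ennreal (1 + bias z) * h z \<partial>star S (scale_chan \<delta> N) k \<partial>measure_pmf P)"
    unfolding node by (simp add: nn_integral_llr chan_star[OF S X])
  also have "\<dots> = (\<integral>\<^sup>+ z. ennreal (1 + bias z) * h z \<partial>BP_chan \<delta> P S N)"
    by (subst nn_integral_BP_chan[OF S N d]) auto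
  also have "\<dots> = (\<integral>\<^sup>+ z. h z \<partial>llr (BP_chan \<delta> P S N))"
    by (rule nn_integral_llr[OF chan_BP_chan[OF S N d] h, symmetric])
  finally show "(\<integral>\<^sup>+ z. h z \<partial>BP \<delta> P (llr S) (llr N)) = (\<integral>\<^sup>+ z. h z \<partial>llr (BP_chan \<delta> P S N))" .
qed

lemma BP_iterate_llr:
  assumes S: "chan S" and N: "chan N" and d: "\<delta> \<in> {0..1}"
  shows "chan ((BP_chan \<delta> P S ^^ h) N)"
    and "(BP \<delta> P (llr S) ^^ h) (llr N) = llr ((BP_chan \<delta> P S ^^ h) N)"
proof -
  have "chan ((BP_chan \<delta> P S ^^ h) N) \<and> (BP \<delta> P (llr S) ^^ h) (llr N) = llr ((BP_chan \<delta> P S ^^ h) N)"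
    by (induction h) (auto simp: N chan_BP_chan[OF S _ d] BP_llr[OF S _ d])
  then show "chan ((BP_chan \<delta> P S ^^ h) N)" "(BP \<delta> P (llr S) ^^ h) (llr N) = llr ((BP_chan \<delta> P S ^^ h) N)"
    by auto
qed

section \<open>The less-noisy order\<close>

definition J :: "ereal measure \<Rightarrow> real \<Rightarrow> real" where
  "J N u = (\<integral>r. (bias r)\<^sup>2 / (1 + u * bias r) \<partial>N)"

lemma one_plus_mult_ge:
  fixes u y :: real
  assumes "\<bar>y\<bar> \<le> 1"
  shows "1 - \<bar>u\<bar> \<le> 1 + u * y"
  using mult_mono[of "\<bar>u\<bar>" "\<bar>u\<bar>" "\<bar>y\<bar>" 1] assms abs_le_D2[of "u * y" "\<bar>u\<bar>"] by (simp add: abs_mult)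

lemma one_plus_mult_pos:
  fixes u y :: real
  assumes "\<bar>u\<bar> < 1" "\<bar>y\<bar> \<le> 1"
  shows "0 < 1 + u * y"
  using one_plus_mult_ge[OF assms(2), of u] assms(1) by linarith

text \<open>Of the two upper bounds, the first is uniform in \<open>y\<close> and serves
  integrability; the second integrates over a bias of mean 0 to \<open>1 / (1 - u\<^sup>2)\<close>,
  the value for the perfect channel.\<close>

lemma J_kernel_bounds:
  fixes u y :: real
  assumes "\<bar>u\<bar> < 1" "\<bar>y\<bar> \<le> 1"
  shows "0 \<le> y\<^sup>2 / (1 + u * y)" "y\<^sup>2 / (1 + u * y) \<le> 1 / (1 - \<bar>u\<bar>)" "y\<^sup>2 / (1 + u * y) \<le> (1 - u * y) / (1 - u\<^sup>2)"
proof -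
  have p: "0 < 1 + u * y" by (rule one_plus_mult_pos[OF assms])
  then show "0 \<le> y\<^sup>2 / (1 + u * y)" by simp
  have y: "y\<^sup>2 \<le> 1" using assms by (simp add: abs_square_le_1)
  show "y\<^sup>2 / (1 + u * y) \<le> 1 / (1 - \<bar>u\<bar>)"
    using assms y one_plus_mult_ge[OF assms(2), of u] by (intro frac_le) auto
  have u: "0 < 1 - u\<^sup>2" using assms by (simp add: abs_square_less_1)
  have "y\<^sup>2 * (1 - u\<^sup>2) \<le> (1 - u * y) * (1 + u * y)"
    using y by (simp add: algebra_simps power2_eq_square)
  then show "y\<^sup>2 / (1 + u * y) \<le> (1 - u * y) / (1 - u\<^sup>2)"
    using p u by (simp add: divide_simps mult.commute)
qed

lemma J_integrable:
  assumes "chan N" "\<bar>u\<bar> < 1"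
  shows "integrable N (\<lambda>r. (bias r)\<^sup>2 / (1 + u * bias r))"
proof (rule integrable_bounded_bias)
  fix r show "\<bar>(bias r)\<^sup>2 / (1 + u * bias r)\<bar> \<le> 1 / (1 - \<bar>u\<bar>)"
    unfolding abs_of_nonneg[OF J_kernel_bounds(1)[OF assms(2) abs_bias_le_1]]
    by (rule J_kernel_bounds(2)[OF assms(2) abs_bias_le_1])
qed (use assms in \<open>auto simp: chan_def\<close>)

lemma J_nonneg: "\<bar>u\<bar> < 1 \<Longrightarrow> 0 \<le> J N u"
  unfolding J_def by (intro integral_nonneg_AE AE_I2 J_kernel_bounds) auto

lemma integral_const_chan: "chan N \<Longrightarrow> (\<integral>r. c \<partial>N) = (c :: real)"
  using chan_prob[of N] by (simp add: prob_space.prob_space)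

lemma integrable_bias: "chan N \<Longrightarrow> integrable N bias"
  by (rule integrable_bounded_bias[of _ _ 1]) (auto simp: chan_def)

lemma J_le:
  assumes N: "chan N" and u: "\<bar>u\<bar> < 1"
  shows "J N u \<le> 1 / (1 - u\<^sup>2)"
proof -
  have i: "integrable N (\<lambda>r. (1 - u * bias r) / (1 - u\<^sup>2))"
    using integrable_bias[OF N] chan_prob[OF N] by (intro integrable_divide_zero Bochner_Integration.integrable_diff)
      (auto simp: prob_space.finite_measure finite_measure.integrable_const)
  have i1: "integrable N (\<lambda>r. 1 :: real)"
    using chan_prob[OF N] by (simp add: prob_space.finite_measure finite_measure.integrable_const)
  have "J N u \<le> (\<integral>r. (1 - u * bias r) / (1 - u\<^sup>2) \<partial>N)"
    unfolding J_def using J_kernel_bounds[OF u abs_bias_le_1]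
    by (intro integral_mono J_integrable N u i) auto
  also have "\<dots> = 1 / (1 - u\<^sup>2)"
    using integrable_bias[OF N] i1 chan_mean[OF N] integral_const_chan[OF N, of 1] by simp
  finally show ?thesis .
qed

lemma ennreal_J:
  assumes "chan N" "\<bar>u\<bar> < 1"
  shows "ennreal (J N u) = (\<integral>\<^sup>+ r. ennreal ((bias r)\<^sup>2 / (1 + u * bias r)) \<partial>N)"
  unfolding J_def using J_kernel_bounds[OF assms(2) abs_bias_le_1] J_integrable[OF assms]
  by (intro nn_integral_eq_integral[symmetric]) auto

lemma J_scale_chan:
  assumes "chan N" "\<delta> \<in> {0..1}"
  shows "J (scale_chan \<delta> N) u = (1 - 2 * \<delta>)\<^sup>2 * J N ((1 - 2 * \<delta>) * u)"
proof -
  have [measurable_cong]: "sets N = sets borel" using assms by (simp add: chan_def)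
  note F_BP_measurable[OF assms(2), measurable]
  show ?thesis
    unfolding J_def scale_chan_def using assms
    by (simp add: integral_distr bias_F_BP power_mult_distrib mult.left_commute mult.commute
        flip: integral_mult_right_zero)
qed

text \<open>The kernel of \<open>J\<close> for the product of two channels with posterior biases \<open>a\<close> and \<open>b\<close>. At
  \<open>a = -b = \<plusminus>1\<close>, where the posterior is undefined, it is \<open>0 / 0 = 0\<close> as desired.\<close>

definition K :: "real \<Rightarrow> real \<Rightarrow> real \<Rightarrow> real" where
  "K u a b = (a + b)\<^sup>2 / (1 + a * b + u * (a + b))"

lemma abs_add_le_one_plus_mult:
  fixes a b :: real
  assumes "\<bar>a\<bar> \<le> 1" "\<bar>b\<bar> \<le> 1"
  shows "\<bar>a + b\<bar> \<le> 1 + a * b"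
proof -
  have "0 \<le> (1 - a) * (1 - b)" "0 \<le> (1 + a) * (1 + b)" using assms by auto
  then show ?thesis by (simp add: algebra_simps abs_le_iff)
qed

text \<open>Since \<open>\<bar>a + b\<bar> \<le> 1 + a * b\<close>, the denominator is at least
  \<open>(1 - \<bar>u\<bar>) * \<bar>a + b\<bar>\<close>, which cancels one factor of the squared
  numerator. So the kernel stays bounded although its denominator can vanish.\<close>

lemma K_bounds:
  fixes u a b :: real
  assumes u: "\<bar>u\<bar> < 1" and a: "\<bar>a\<bar> \<le> 1" and b: "\<bar>b\<bar> \<le> 1"
  shows "0 \<le> K u a b" "K u a b \<le> 2 / (1 - \<bar>u\<bar>)"
proof -
  let ?w = "\<bar>a + b\<bar>" and ?z = "1 + a * b + u * (a + b)"
  have w: "?w \<le> 1 + a * b" by (rule abs_add_le_one_plus_mult[OF a b])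
  have "- (\<bar>u\<bar> * ?w) \<le> u * (a + b)" using abs_ge_minus_self[of "u * (a + b)"] by (simp add: abs_mult)
  then have z: "(1 - \<bar>u\<bar>) * ?w \<le> ?z" using w by (simp add: algebra_simps)
  have "0 \<le> (1 - \<bar>u\<bar>) * ?w" using u by simp
  then have z0: "0 \<le> ?z" using z by linarith
  then show "0 \<le> K u a b" by (simp add: K_def)
  show "K u a b \<le> 2 / (1 - \<bar>u\<bar>)"
  proof (cases "a + b = 0")
    case True
    then show ?thesis using u by (simp add: K_def)
  next
    case False
    then have p: "0 < (1 - \<bar>u\<bar>) * ?w" using u by simp
    have "K u a b \<le> ?w\<^sup>2 / ((1 - \<bar>u\<bar>) * ?w)"
      unfolding K_def using p z z0 by (simp add: frac_le)
    also have "\<dots> = ?w / (1 - \<bar>u\<bar>)" using False by (simp add: power2_eq_square del: abs_mult_self_eq)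
    also have "\<dots> \<le> 2 / (1 - \<bar>u\<bar>)"
      using u a b by (intro divide_right_mono) auto
    finally show ?thesis .
  qed
qed

lemma K_commute: "K u a b = K u b a"
  by (simp add: K_def algebra_simps)

lemma K_measurable [measurable]:
  "(\<lambda>z. K u (bias (fst z)) (bias (snd z))) \<in> borel_measurable (borel \<Otimes>\<^sub>M borel)"
  unfolding K_def by measurable

lemma integral_pair_bounded:
  fixes f :: "ereal \<Rightarrow> ereal \<Rightarrow> real"
  assumes A: "chan A" and B: "chan B"
    and f: "(\<lambda>z. f (fst z) (snd z)) \<in> borel_measurable (borel \<Otimes>\<^sub>M borel)"
    and bd: "\<And>x y. \<bar>f x y\<bar> \<le> C"
  shows "(\<integral>z. f (fst z) (snd z) \<partial>(A \<Otimes>\<^sub>M B)) = (\<integral>x. \<integral>y. f x y \<partial>B \<partial>A)"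
    and "(\<integral>y. \<integral>x. f x y \<partial>A \<partial>B) = (\<integral>x. \<integral>y. f x y \<partial>B \<partial>A)"
    and "integrable (A \<Otimes>\<^sub>M B) (\<lambda>z. f (fst z) (snd z))"
    and "integrable A (\<lambda>x. \<integral>y. f x y \<partial>B)"
    and "integrable B (\<lambda>y. f x y)"
proof -
  interpret A: prob_space A using A by (simp add: chan_def)
  interpret B: prob_space B using B by (simp add: chan_def)
  interpret AB: pair_prob_space A B ..
  have [measurable_cong]: "sets A = sets borel" "sets B = sets borel" using A B by (auto simp: chan_def)
  note f[measurable]
  show i: "integrable (A \<Otimes>\<^sub>M B) (\<lambda>z. f (fst z) (snd z))"
    using bd by (intro AB.integrable_const_bound[of _ C]) auto
  show 1: "(\<integral>z. f (fst z) (snd z) \<partial>(A \<Otimes>\<^sub>M B)) = (\<integral>x. \<integral>y. f x y \<partial>B \<partial>A)"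
    using AB.integral_fst'[OF i] by simp
  have i': "integrable (A \<Otimes>\<^sub>M B) (case_prod f)" using i by (simp add: split_beta')
  show "(\<integral>y. \<integral>x. f x y \<partial>A \<partial>B) = (\<integral>x. \<integral>y. f x y \<partial>B \<partial>A)"
    using AB.integral_snd[OF i'] AB.integral_fst[OF i'] by simp
  show "integrable A (\<lambda>x. \<integral>y. f x y \<partial>B)" using AB.integrable_fst[OF i'] by simp
  have "(\<lambda>y. (\<lambda>z. f (fst z) (snd z)) (x, y)) \<in> borel_measurable borel" by measurable
  then have [measurable]: "f x \<in> borel_measurable borel" by simp
  show "integrable B (\<lambda>y. f x y)"
    using bd by (intro B.integrable_const_bound[of _ C]) auto
qed

lemma abs_K_le: "\<bar>u\<bar> < 1 \<Longrightarrow> \<bar>K u (bias x) (bias y)\<bar> \<le> 2 / (1 - \<bar>u\<bar>)"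
  using K_bounds[OF _ abs_bias_le_1 abs_bias_le_1, of u x y] by simp

lemma weight_kernel:
  assumes u: "\<bar>u\<bar> < 1"
  shows "(1 + bias x * bias y) * ((bias (x + y))\<^sup>2 / (1 + u * bias (x + y))) = K u (bias x) (bias y)"
proof (cases "1 + bias x * bias y = 0")
  case True
  have "\<bar>bias x + bias y\<bar> \<le> 0"
    using abs_add_le_one_plus_mult[OF abs_bias_le_1 abs_bias_le_1, of x y] True by simp
  then show ?thesis using True by (simp add: K_def)
next
  case False
  define p q w where "p = 1 + bias x * bias y" and "q = bias x + bias y" and "w = bias (x + y)"
  have p: "p \<noteq> 0" "p * w = q" using False bias_add[of x y] by (auto simp: p_def q_def w_def)
  have "p * (w\<^sup>2 / (1 + u * w)) = (p * w)\<^sup>2 / (p * (1 + u * w))"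
    using p(1) by (simp add: power2_eq_square)
  also have "p * (1 + u * w) = p + u * (p * w)" by (simp add: algebra_simps)
  finally have "p * (w\<^sup>2 / (1 + u * w)) = (p * w)\<^sup>2 / (p + u * (p * w))" .
  then show ?thesis unfolding p(2) by (simp add: K_def p_def q_def w_def)
qed

lemma J_prod_chan:
  assumes A: "chan A" and B: "chan B" and u: "\<bar>u\<bar> < 1"
  shows "J (prod_chan A B) u = (\<integral>x. \<integral>y. K u (bias x) (bias y) \<partial>B \<partial>A)"
proof -
  have [measurable_cong]: "sets A = sets borel" "sets B = sets borel" using A B by (auto simp: chan_def)
  have "J (prod_chan A B) u = (\<integral>z. K u (bias (fst z)) (bias (snd z)) \<partial>(A \<Otimes>\<^sub>M B))"
    unfolding J_def prod_chan_def
    by (simp add: integral_distr integral_density one_plus_bias_mult_nonneg split_beta'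
        weight_kernel[OF u, unfolded times_divide_eq_right])
  also have "\<dots> = (\<integral>x. \<integral>y. K u (bias x) (bias y) \<partial>B \<partial>A)"
    using abs_K_le[OF u] by (intro integral_pair_bounded A B) auto
  finally show ?thesis .
qed

lemma J_prod_chan_commute:
  assumes A: "chan A" and B: "chan B" and u: "\<bar>u\<bar> < 1"
  shows "J (prod_chan A B) u = J (prod_chan B A) u"
  using integral_pair_bounded(2)[OF A B, of "\<lambda>x y. K u (bias x) (bias y)", OF _ abs_K_le[OF u]]
  by (simp add: J_prod_chan[OF A B u] J_prod_chan[OF B A u] K_commute)

lemma posterior_bound:
  fixes a u :: real
  assumes "\<bar>u\<bar> < 1" "\<bar>a\<bar> < 1"
  shows "\<bar>(a + u) / (1 + u * a)\<bar> < 1"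
proof -
  have "0 < (1 - a) * (1 - u)" "0 < (1 + a) * (1 + u)" using assms by auto
  then have "\<bar>a + u\<bar> < 1 + u * a" by (simp add: algebra_simps abs_less_iff)
  moreover have "0 < 1 + u * a" using one_plus_mult_pos[of u a] assms by simp
  ultimately show ?thesis by simp
qed

lemma integral_affine2:
  fixes f g :: "ereal \<Rightarrow> real"
  assumes B: "chan B" and "integrable B f" "integrable B g"
  shows "(\<integral>y. c0 + c1 * f y + c2 * g y \<partial>B) = c0 + c1 * (\<integral>y. f y \<partial>B) + c2 * (\<integral>y. g y \<partial>B)"
proof -
  have "integrable B (\<lambda>r. c0)"
    using chan_prob[OF B] by (simp add: prob_space.finite_measure finite_measure.integrable_const)
  then show ?thesis using assms integral_const_chan[OF B, of c0] by simp
qed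

text \<open>The chain rule of information at second order: seeing bias \<open>a\<close> contributes
  \<open>a\<^sup>2 / (1 + u * a)\<close> and moves the prior to
  \<open>(a + u) / (1 + u * a)\<close>, at which \<open>B\<close> is then used. If
  \<open>\<bar>a\<bar> = 1\<close> the bit is known and the new prior leaves the open interval on
  which \<open>J\<close> is controlled; the factor \<open>(1 - a\<^sup>2)\<^sup>2\<close> removes
  that term.\<close>

lemma integral_K:
  assumes B: "chan B" and u: "\<bar>u\<bar> < 1" and a: "\<bar>a\<bar> \<le> 1"
  shows "(\<integral>y. K u a (bias y) \<partial>B) =
    a\<^sup>2 / (1 + u * a) + (1 - a\<^sup>2)\<^sup>2 / (1 + u * a) ^ 3 * J B ((a + u) / (1 + u * a))"
proof -
  define p v where "p = 1 + u * a" and "v = (a + u) / (1 + u * a)"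
  have p: "p > 0" unfolding p_def by (rule one_plus_mult_pos[OF u a])
  have pv: "p * v = a + u" using p by (simp add: v_def p_def)
  note ib = integrable_bias[OF B]
  have i1: "integrable B (\<lambda>r. c :: real)" for c
    using chan_prob[OF B] by (simp add: prob_space.finite_measure finite_measure.integrable_const)
  show ?thesis
  proof (cases "\<bar>a\<bar> = 1")
    case True
    then have a2: "a\<^sup>2 = 1" by (metis power2_abs one_power2)
    then have aa: "a * a = 1" by (simp add: power2_eq_square)
    have "K u a (bias y) = (1 + a * bias y) / p" for y
    proof (cases "a + bias y = 0")
      case True
      then have "1 + a * bias y = 0" using aa by (simp add: eq_neg_iff_add_eq_0[symmetric])
      then show ?thesis using True by (simp add: K_def)
    next
      case False
      have e: "1 + a * bias y = a * (a + bias y)" using aa by (simp add: algebra_simps)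
      have "a * p = a + u * (a * a)" by (simp add: p_def algebra_simps)
      then have "1 + a * bias y + u * (a + bias y) = (a + bias y) * (a * p)"
        unfolding e aa by (simp add: algebra_simps)
      then have "K u a (bias y) = (a + bias y) / (a * p)"
        using False by (simp add: K_def power2_eq_square)
      also have "\<dots> = (a * (a + bias y)) / (a * a * p)" using True by auto
      finally show ?thesis unfolding e using aa by simp
    qed
    then have "(\<integral>y. K u a (bias y) \<partial>B) = (\<integral>y. (1 + a * bias y) / p \<partial>B)" by simp
    also have "\<dots> = 1 / p" using ib i1[of 1] chan_mean[OF B] integral_const_chan[OF B, of 1] by simp
    finally show ?thesis by (simp add: a2 p_def)
  next
    case False
    then have a1: "\<bar>a\<bar> < 1" using a by simp
    have v: "\<bar>v\<bar> < 1" unfolding v_def by (rule posterior_bound[OF u a1])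
    have av: "1 - a * v = (1 - a\<^sup>2) / p"
      using p by (simp add: v_def p_def[symmetric] divide_simps) (simp add: p_def algebra_simps power2_eq_square)
    \<comment> \<open>Division of \<open>(a + y)\<^sup>2\<close> by \<open>1 + v * y\<close> in
      ascending powers of \<open>y\<close>, stopped when the remainder is a multiple of
      \<open>y\<^sup>2\<close>. The linear term then integrates to 0.\<close>
    have K: "K u a y = a\<^sup>2 / p + (2 * a - v * a\<^sup>2) / p * y + ((1 - a * v)\<^sup>2 / p) * (y\<^sup>2 / (1 + v * y))"
      if "\<bar>y\<bar> \<le> 1" for y
    proof -
      have q: "1 + v * y > 0" by (rule one_plus_mult_pos[OF v that])
      have "1 + a * y + u * (a + y) = p + (p * v) * y" unfolding pv by (simp add: p_def algebra_simps)
      then have "K u a y = (a + y)\<^sup>2 / (p * (1 + v * y))" by (simp add: K_def algebra_simps)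
      also have "(a + y)\<^sup>2 = (a\<^sup>2 + (2 * a - v * a\<^sup>2) * y) * (1 + v * y) + (1 - a * v)\<^sup>2 * y\<^sup>2"
        by (simp add: algebra_simps power2_eq_square)
      also have "\<dots> / (p * (1 + v * y)) = a\<^sup>2 / p + (2 * a - v * a\<^sup>2) / p * y + ((1 - a * v)\<^sup>2 / p) * (y\<^sup>2 / (1 + v * y))"
        using p q by (simp add: add_divide_distrib distrib_right)
      finally show ?thesis .
    qed
    have "(\<integral>y. K u a (bias y) \<partial>B) =
        (\<integral>y. a\<^sup>2 / p + (2 * a - v * a\<^sup>2) / p * bias y + ((1 - a * v)\<^sup>2 / p) * ((bias y)\<^sup>2 / (1 + v * bias y)) \<partial>B)"
      by (simp add: K)
    also have "\<dots> = a\<^sup>2 / p + (1 - a * v)\<^sup>2 / p * J B v"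
      unfolding integral_affine2[OF B ib J_integrable[OF B v]] chan_mean[OF B] J_def by simp
    also have "(1 - a * v)\<^sup>2 / p = (1 - a\<^sup>2)\<^sup>2 / p ^ 3"
      unfolding av by (simp add: power_divide power2_eq_square power3_eq_cube)
    finally show ?thesis by (simp add: p_def v_def)
  qed
qed

section \<open>The order and the monotonicity of BP\<close>

definition less_noisy :: "ereal measure \<Rightarrow> ereal measure \<Rightarrow> bool" (infix "\<sqsubseteq>" 50) where
  "A \<sqsubseteq> B \<longleftrightarrow> (\<forall>u. \<bar>u\<bar> < 1 \<longrightarrow> J A u \<le> J B u)"

lemma less_noisyD: "A \<sqsubseteq> B \<Longrightarrow> \<bar>u\<bar> < 1 \<Longrightarrow> J A u \<le> J B u"
  by (simp add: less_noisy_def)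

lemma less_noisy_refl [simp]: "A \<sqsubseteq> A" and less_noisy_trans [trans]: "A \<sqsubseteq> B \<Longrightarrow> B \<sqsubseteq> C \<Longrightarrow> A \<sqsubseteq> C"
  by (force simp: less_noisy_def)+

lemma integral_K_mono:
  assumes B: "chan B" and B': "chan B'" and le: "B \<sqsubseteq> B'" and u: "\<bar>u\<bar> < 1" and a: "\<bar>a\<bar> \<le> 1"
  shows "(\<integral>y. K u a (bias y) \<partial>B) \<le> (\<integral>y. K u a (bias y) \<partial>B')"
proof (cases "\<bar>a\<bar> = 1")
  case True
  then have "a\<^sup>2 = 1" by (metis power2_abs one_power2)
  then show ?thesis by (simp add: integral_K[OF B u a] integral_K[OF B' u a])
next
  case False
  then have "\<bar>(a + u) / (1 + u * a)\<bar> < 1" using a by (intro posterior_bound u) auto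
  moreover have "0 \<le> (1 - a\<^sup>2)\<^sup>2 / (1 + u * a) ^ 3" using one_plus_mult_pos[OF u a] by simp
  ultimately show ?thesis
    using le by (simp only: integral_K[OF B u a] integral_K[OF B' u a])
      (intro add_left_mono mult_left_mono, auto simp: less_noisy_def)
qed

lemma prod_chan_mono_right:
  assumes A: "chan A" and B: "chan B" and B': "chan B'" and le: "B \<sqsubseteq> B'"
  shows "prod_chan A B \<sqsubseteq> prod_chan A B'"
  unfolding less_noisy_def
proof (intro allI impI)
  fix u :: real assume u: "\<bar>u\<bar> < 1"
  note i = integral_pair_bounded(4)[OF A _ _ abs_K_le[OF u]]
  show "J (prod_chan A B) u \<le> J (prod_chan A B') u"
    unfolding J_prod_chan[OF A B u] J_prod_chan[OF A B' u]
    by (intro integral_mono i B B' integral_K_mono le u) auto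
qed

lemma prod_chan_mono:
  assumes A: "chan A" and B: "chan B" and A': "chan A'" and B': "chan B'"
    and "A \<sqsubseteq> A'" "B \<sqsubseteq> B'"
  shows "prod_chan A B \<sqsubseteq> prod_chan A' B'"
proof -
  have "prod_chan A B \<sqsubseteq> prod_chan A B'" by (intro prod_chan_mono_right assms)
  also have "prod_chan A B' \<sqsubseteq> prod_chan A' B'"
    using prod_chan_mono_right[OF B' A A' \<open>A \<sqsubseteq> A'\<close>] J_prod_chan_commute[OF B'] A A'
    by (simp add: less_noisy_def)
  finally show ?thesis .
qed

lemma star_mono:
  assumes "chan S" "chan X" "chan X'" "X \<sqsubseteq> X'"
  shows "star S X d \<sqsubseteq> star S X' d"
  by (induction d) (auto intro!: prod_chan_mono assms chan_star)

lemma abs_scale_less_1: "\<delta> \<in> {0..1} \<Longrightarrow> \<bar>u\<bar> < 1 \<Longrightarrow> \<bar>(1 - 2 * \<delta>) * u\<bar> < (1 :: real)"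
  using mult_mono[of "\<bar>1 - 2 * \<delta>\<bar>" 1 "\<bar>u\<bar>" "\<bar>u\<bar>"] by (auto simp: abs_mult abs_le_iff)

lemma scale_chan_mono:
  assumes "chan N" "chan N'" "\<delta> \<in> {0..1}" "N \<sqsubseteq> N'"
  shows "scale_chan \<delta> N \<sqsubseteq> scale_chan \<delta> N'"
  unfolding less_noisy_def
proof (intro allI impI)
  fix u :: real assume "\<bar>u\<bar> < 1"
  then have "\<bar>(1 - 2 * \<delta>) * u\<bar> < 1" using assms by (intro abs_scale_less_1)
  then show "J (scale_chan \<delta> N) u \<le> J (scale_chan \<delta> N') u"
    using assms by (simp add: J_scale_chan less_noisyD mult_left_mono)
qed

lemma integrable_measure_pmf_bounded:
  fixes f :: "nat \<Rightarrow> real"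
  assumes "\<And>d. \<bar>f d\<bar> \<le> C"
  shows "integrable (measure_pmf P) f"
  using assms by (intro measure_pmf.integrable_const_bound[of _ C]) auto

lemma abs_J_le: "chan N \<Longrightarrow> \<bar>u\<bar> < 1 \<Longrightarrow> \<bar>J N u\<bar> \<le> 1 / (1 - u\<^sup>2)"
  using J_nonneg[of u N] J_le[of N u] by simp

lemma J_BP_chan:
  assumes S: "chan S" and N: "chan N" and d: "\<delta> \<in> {0..1}" and u: "\<bar>u\<bar> < 1"
  shows "J (BP_chan \<delta> P S N) u = measure_pmf.expectation P (\<lambda>k. J (star S (scale_chan \<delta> N) k) u)"
proof -
  note c = chan_star[OF S chan_scale_chan[OF N d]]
  have i: "integrable (measure_pmf P) (\<lambda>k. J (star S (scale_chan \<delta> N) k) u)"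
    using abs_J_le[OF c u] by (intro integrable_measure_pmf_bounded)
  have "ennreal (J (BP_chan \<delta> P S N) u) = (\<integral>\<^sup>+ k. ennreal (J (star S (scale_chan \<delta> N) k) u) \<partial>measure_pmf P)"
    unfolding ennreal_J[OF chan_BP_chan[OF S N d] u] ennreal_J[OF c u]
    by (intro nn_integral_BP_chan S N d) measurable
  also have "\<dots> = ennreal (measure_pmf.expectation P (\<lambda>k. J (star S (scale_chan \<delta> N) k) u))"
    using i by (intro nn_integral_eq_integral) (auto intro: J_nonneg u)
  finally show ?thesis
    using u by (simp add: J_nonneg integral_nonneg)
qed

lemma BP_chan_mono:
  assumes S: "chan S" and N: "chan N" and N': "chan N'" and d: "\<delta> \<in> {0..1}"
    and le: "scale_chan \<delta> N \<sqsubseteq> scale_chan \<delta> N'"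
  shows "BP_chan \<delta> P S N \<sqsubseteq> BP_chan \<delta> P S N'"
  unfolding less_noisy_def
proof (intro allI impI)
  fix u :: real assume u: "\<bar>u\<bar> < 1"
  note X = chan_scale_chan[OF N d] and X' = chan_scale_chan[OF N' d]
  show "J (BP_chan \<delta> P S N) u \<le> J (BP_chan \<delta> P S N') u"
    unfolding J_BP_chan[OF S N d u] J_BP_chan[OF S N' d u]
  proof (intro integral_mono)
    show "integrable (measure_pmf P) (\<lambda>k. J (star S (scale_chan \<delta> N) k) u)"
      using abs_J_le[OF chan_star[OF S X] u] by (intro integrable_measure_pmf_bounded)
    show "integrable (measure_pmf P) (\<lambda>k. J (star S (scale_chan \<delta> N') k) u)"
      using abs_J_le[OF chan_star[OF S X'] u] by (intro integrable_measure_pmf_bounded)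
    show "J (star S (scale_chan \<delta> N) k) u \<le> J (star S (scale_chan \<delta> N') k) u" for k
      using star_mono[OF S X X' le] u by (rule less_noisyD)
  qed
qed

section \<open>\<open>J\<close> determines the channel; compactness\<close>

lemma integrable_bias_power:
  assumes N: "chan N" and u: "\<bar>u\<bar> < 1"
  shows "integrable N (\<lambda>r. bias r ^ k)" "integrable N (\<lambda>r. bias r ^ k / (1 + u * bias r))"
    "\<bar>\<integral>r. bias r ^ k / (1 + u * bias r) \<partial>N\<bar> \<le> 1 / (1 - \<bar>u\<bar>)"
proof -
  have p: "\<bar>bias r ^ k\<bar> \<le> 1" for r
    by (simp add: power_abs power_le_one)
  show "integrable N (\<lambda>r. bias r ^ k)"
    using N p by (intro integrable_bounded_bias[of _ _ 1]) (auto simp: chan_def)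
  have q: "\<bar>bias r ^ k / (1 + u * bias r)\<bar> \<le> 1 / (1 - \<bar>u\<bar>)" for r
    using one_plus_mult_ge[OF abs_bias_le_1, of u r] u p[of r] by (simp add: abs_divide frac_le)
  show i: "integrable N (\<lambda>r. bias r ^ k / (1 + u * bias r))"
    using N q by (intro integrable_bounded_bias[of _ _ "1 / (1 - \<bar>u\<bar>)"]) (auto simp: chan_def)
  interpret prob_space N using N by (simp add: chan_def)
  have "\<bar>\<integral>r. bias r ^ k / (1 + u * bias r) \<partial>N\<bar> \<le> (\<integral>r. \<bar>bias r ^ k / (1 + u * bias r)\<bar> \<partial>N)"
    by (rule integral_abs_bound)
  also have "\<dots> \<le> (\<integral>r. 1 / (1 - \<bar>u\<bar>) \<partial>N)"
    using q i by (intro integral_mono integrable_abs) auto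
  finally show "\<bar>\<integral>r. bias r ^ k / (1 + u * bias r) \<partial>N\<bar> \<le> 1 / (1 - \<bar>u\<bar>)"
    unfolding integral_const_chan[OF N] .
qed

lemma bias_power_step:
  assumes N: "chan N" and u: "\<bar>u\<bar> < 1"
  shows "(\<integral>r. bias r ^ k / (1 + u * bias r) \<partial>N) =
    (\<integral>r. bias r ^ k \<partial>N) - u * (\<integral>r. bias r ^ Suc k / (1 + u * bias r) \<partial>N)"
proof -
  have "bias r ^ k / (1 + u * bias r) = bias r ^ k - u * (bias r ^ Suc k / (1 + u * bias r))" for r
    using one_plus_mult_pos[OF u abs_bias_le_1, of r] by (simp add: divide_simps) (simp add: algebra_simps)
  then show ?thesis
    using integrable_bias_power(1)[OF N u, of k] integrable_bias_power(2)[OF N u, of "Suc k"]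
    by (simp only: Bochner_Integration.integral_diff integrable_mult_right integral_mult_right_zero)
qed

text \<open>Expanding \<open>J\<close> at \<open>u = 0\<close> recovers the moments of the bias one after the other.\<close>

lemma moments_eq:
  assumes A: "chan A" and B: "chan B" and eq: "\<And>u. \<bar>u\<bar> < 1 \<Longrightarrow> J A u = J B u"
  shows "(\<integral>r. bias r ^ k \<partial>A) = (\<integral>r. bias r ^ k \<partial>B)"
proof -
  let ?D = "\<lambda>N k u. \<integral>r. bias r ^ k / (1 + u * bias r) \<partial>N" and ?m = "\<lambda>N k. \<integral>r. bias r ^ k \<partial>N"
  have m: "?m A k = ?m B k" if eqk: "\<And>u. u \<noteq> 0 \<Longrightarrow> \<bar>u\<bar> < 1 \<Longrightarrow> ?D A k u = ?D B k u" for k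
  proof (rule ccontr)
    define d where "d = \<bar>?m A k - ?m B k\<bar>"
    assume "?m A k \<noteq> ?m B k"
    then have d: "d > 0" by (simp add: d_def)
    \<comment> \<open>Chosen so that \<open>u / (1 - u) = d / 4\<close>: the two remainders together
      are then at most \<open>d / 2\<close>.\<close>
    define u where "u = d / (d + 4)"
    have u: "0 < u" "u < 1" using d by (auto simp: u_def field_simps)
    then have u': "\<bar>u\<bar> < 1" by simp
    have "?m A k - ?m B k = u * ?D A (Suc k) u - u * ?D B (Suc k) u"
      using bias_power_step[OF A u', of k] bias_power_step[OF B u', of k] eqk[of u] u by simp
    then have "d \<le> u * \<bar>?D A (Suc k) u\<bar> + u * \<bar>?D B (Suc k) u\<bar>"
      using abs_triangle_ineq4[of "u * ?D A (Suc k) u" "u * ?D B (Suc k) u"] u by (simp add: d_def abs_mult)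
    also have "\<dots> \<le> u * (1 / (1 - \<bar>u\<bar>)) + u * (1 / (1 - \<bar>u\<bar>))"
      using u by (intro add_mono mult_left_mono integrable_bias_power(3) A B u') auto
    also have "u * (1 / (1 - \<bar>u\<bar>)) = d / 4"
    proof -
      have "1 - \<bar>u\<bar> = 4 / (d + 4)" using d by (simp add: u_def field_simps)
      then show ?thesis using d by (simp add: u_def)
    qed
    also have "d / 4 + d / 4 = d / 2" by simp
    finally show False using d by simp
  qed
  \<comment> \<open>\<open>J\<close> is the case of power 2, and each later step divides by
    \<open>u\<close>. The moments of order 0 and 1 are invisible in \<open>J\<close> but agree for
    all channels.\<close>
  have D: "?D A (k + 2) u = ?D B (k + 2) u" if "u \<noteq> 0" "\<bar>u\<bar> < 1" for k u
    using that
  proof (induction k arbitrary: u)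
    case 0
    then show ?case using eq[of u] by (simp add: J_def numeral_2_eq_2)
  next
    case (Suc k)
    have "?m A (k + 2) = ?m B (k + 2)" by (rule m) (rule Suc.IH)
    then have "u * ?D A (Suc (k + 2)) u = u * ?D B (Suc (k + 2)) u"
      using bias_power_step[OF A Suc.prems(2), of "k + 2"] bias_power_step[OF B Suc.prems(2), of "k + 2"]
        Suc.IH[OF Suc.prems] by linarith
    then show ?case using Suc.prems by simp
  qed
  show ?thesis
  proof (cases k rule: nat.exhaust[case_names 0 Suc])
    case 0
    then show ?thesis using integral_const_chan[OF A, of 1] integral_const_chan[OF B, of 1] by simp
  next
    case (Suc j)
    show ?thesis
    proof (cases j)
      case 0
      then show ?thesis using Suc A B by (simp add: chan_def)
    next
      fix i assume "j = Suc i"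
      then have "k = i + 2" using Suc by simp
      then show ?thesis using m[of "i + 2"] D by simp
    qed
  qed
qed

lemma bias_law_real_distribution:
  assumes "chan N"
  shows "real_distribution (distr N borel bias)"
proof -
  have [measurable_cong]: "sets N = sets borel" using assms by (simp add: chan_def)
  show ?thesis
    using chan_prob[OF assms] by (intro real_distribution.intro prob_space.prob_space_distr real_distribution_axioms.intro) auto
qed

lemma distr_unbias_bias:
  assumes "chan N"
  shows "distr (distr N borel bias) borel unbias = N"
proof -
  have [measurable_cong]: "sets N = sets borel" using assms by (simp add: chan_def)
  show ?thesis using assms by (simp add: distr_distr comp_def distr_id2 chan_def)
qed

text \<open>The bias is bounded, so the exponential series may be integrated term by term; hence the
  moments determine the law.\<close>

lemma char_bias_law:
  assumes N: "chan N"
  shows "(\<lambda>k. (\<i> * of_real t) ^ k /\<^sub>R fact k * of_real (\<integral>r. bias r ^ k \<partial>N)) sums char (distr N borel bias) t"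
proof -
  have [measurable_cong]: "sets N = sets borel" using N by (simp add: chan_def)
  let ?f = "\<lambda>k r. (\<i> * of_real t) ^ k /\<^sub>R fact k * complex_of_real (bias r ^ k)"
  have f: "?f k r = (\<i> * of_real (t * bias r)) ^ k /\<^sub>R fact k" for k r
    by (simp add: power_mult_distrib)
  have i: "integrable N (\<lambda>r. complex_of_real (bias r ^ k))" for k
    using integrable_bias_power(1)[OF N, of 0 k] by (intro integrable_of_real) simp
  have nf: "norm (?f k r) \<le> \<bar>t\<bar> ^ k /\<^sub>R fact k" for k r
  proof -
    have "norm (?f k r) = (\<bar>t\<bar> ^ k /\<^sub>R fact k) * \<bar>bias r\<bar> ^ k"
      by (simp add: norm_mult norm_power norm_inverse abs_mult power_mult_distrib power_abs)
    also have "\<dots> \<le> (\<bar>t\<bar> ^ k /\<^sub>R fact k) * 1"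
      by (intro mult_left_mono power_le_one) auto
    finally show ?thesis by simp
  qed
  have "(\<lambda>k. integral\<^sup>L N (?f k)) sums (\<integral>r. (\<Sum>k. ?f k r) \<partial>N)"
  proof (rule sums_integral)
    show if_k: "integrable N (?f k)" for k using i by (intro integrable_mult_right)
    have s: "summable (\<lambda>k. \<bar>t\<bar> ^ k /\<^sub>R fact k)" by (rule summable_exp_generic)
    show "AE r in N. summable (\<lambda>k. norm (?f k r))"
      using nf by (intro AE_I2 summable_comparison_test'[OF s, of 0]) simp
    show "summable (\<lambda>k. \<integral>r. norm (?f k r) \<partial>N)"
    proof (rule summable_comparison_test'[OF s, of 0])
      fix k
      have "(\<integral>r. norm (?f k r) \<partial>N) \<le> (\<integral>r. \<bar>t\<bar> ^ k /\<^sub>R fact k \<partial>N)"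
        using nf if_k chan_prob[OF N] by (intro integral_mono integrable_norm)
          (auto simp: prob_space.finite_measure finite_measure.integrable_const)
      then show "norm (\<integral>r. norm (?f k r) \<partial>N) \<le> \<bar>t\<bar> ^ k /\<^sub>R fact k"
        unfolding integral_const_chan[OF N] by (simp add: integral_nonneg)
    qed
  qed
  also have "(\<lambda>k. integral\<^sup>L N (?f k)) = (\<lambda>k. (\<i> * of_real t) ^ k /\<^sub>R fact k * of_real (\<integral>r. bias r ^ k \<partial>N))"
    by (simp only: integral_mult_right_zero integral_complex_of_real)
  also have "(\<integral>r. (\<Sum>k. ?f k r) \<partial>N) = char (distr N borel bias) t"
    unfolding char_def f by (subst integral_distr) (auto simp: exp_def)
  finally show ?thesis .
qed

lemma J_determines:
  assumes A: "chan A" and B: "chan B" and eq: "\<And>u. \<bar>u\<bar> < 1 \<Longrightarrow> J A u = J B u"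
  shows "A = B"
proof -
  have m: "(\<integral>r. bias r ^ k \<partial>A) = (\<integral>r. bias r ^ k \<partial>B)" for k
    using A B eq by (rule moments_eq)
  have "char (distr A borel bias) = char (distr B borel bias)"
  proof
    fix t
    show "char (distr A borel bias) t = char (distr B borel bias) t"
      using char_bias_law[OF A, of t] char_bias_law[OF B, of t] unfolding m
      by (rule sums_unique2)
  qed
  then have "distr A borel bias = distr B borel bias"
    by (intro Levy_uniqueness bias_law_real_distribution A B)
  then show ?thesis using distr_unbias_bias[OF A] distr_unbias_bias[OF B] by metis
qed

lemma less_noisy_antisym: "chan A \<Longrightarrow> chan B \<Longrightarrow> A \<sqsubseteq> B \<Longrightarrow> B \<sqsubseteq> A \<Longrightarrow> A = B"
  by (rule J_determines) (auto simp: less_noisy_def intro!: order_antisym)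

section \<open>Compactness and weak convergence\<close>

lemma integral_bias_law:
  fixes g :: "real \<Rightarrow> real"
  assumes "chan N" and [measurable]: "g \<in> borel_measurable borel"
  shows "(\<integral>y. g y \<partial>distr N borel bias) = (\<integral>r. g (bias r) \<partial>N)"
proof -
  have [measurable_cong]: "sets N = sets borel" using assms by (simp add: chan_def)
  show ?thesis by (subst integral_distr) auto
qed

text \<open>Biases live in a compact interval, so tightness is free, and mass escaping to
  \<plusminus>\<infinity> on the log-likelihood scale is kept as mass near \<plusminus>1. The
  identity is an admissible test function, so the mean stays 0 and the limit is again a
  channel.\<close>

lemma chan_compact:
  fixes N :: "nat \<Rightarrow> ereal measure"
  assumes N: "\<And>n. chan (N n)"
  obtains r :: "nat \<Rightarrow> nat" and M where "strict_mono r" "chan M"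
    "\<And>g :: real \<Rightarrow> real. continuous_on {-1..1} g \<Longrightarrow>
       (\<lambda>n. \<integral>x. g (bias x) \<partial>N (r n)) \<longlonglongrightarrow> (\<integral>x. g (bias x) \<partial>M)"
proof -
  define \<mu> where "\<mu> n = distr (N n) borel bias" for n
  have rd: "real_distribution (\<mu> n)" for n
    unfolding \<mu>_def by (rule bias_law_real_distribution[OF N])
  have "tight \<mu>"
    unfolding tight_def
  proof (intro conjI allI impI rd)
    fix \<epsilon> :: real assume "\<epsilon> > 0"
    \<comment> \<open>The interval is open on the left, so it has to start below -1.\<close>
    have "measure (\<mu> n) {-2<..1} = 1" for n
    proof -
      have [measurable_cong]: "sets (N n) = sets borel" using N by (simp add: chan_def)
      have "-2 < bias x" for x by (rule less_le_trans[OF _ bias_ge_m1]) simp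
      then have "measure (\<mu> n) {-2<..1} = measure (N n) (space (N n))"
        unfolding \<mu>_def by (subst measure_distr) (auto intro!: arg_cong[where f="measure (N n)"])
      then show ?thesis using prob_space.prob_space[OF chan_prob[OF N], of n] by simp
    qed
    then show "\<exists>a b. a < b \<and> (\<forall>n. 1 - \<epsilon> < measure (\<mu> n) {a<..b})"
      using \<open>\<epsilon> > 0\<close> by (intro exI[of _ "-2"] exI[of _ 1]) simp
  qed
  then obtain r L where r: "strict_mono r" and L: "real_distribution L" and w: "weak_conv_m (\<mu> \<circ> id \<circ> r) L"
    using tight_imp_convergent_subsubsequence[of \<mu> id] by (auto simp: strict_mono_id)
  interpret L: real_distribution L by fact
  define M where "M = distr L borel unbias"
  have M: "prob_space M" "sets M = sets borel" unfolding M_def by (auto intro: L.prob_space_distr)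
  have lim: "(\<lambda>n. \<integral>x. g (bias x) \<partial>N (r n)) \<longlonglongrightarrow> (\<integral>x. g (bias x) \<partial>M)"
    if g: "continuous_on {-1..1} g" for g :: "real \<Rightarrow> real"
  proof -
    \<comment> \<open>Weak convergence asks for a test function on the whole line, while
      \<open>g\<close> is continuous on the interval only. The clamp is the one in
      \<open>bias_unbias\<close>, which replaces a statement about the support of
      \<open>L\<close>.\<close>
    define h where "h y = g (max (-1) (min 1 y))" for y
    have h: "continuous_on UNIV h"
      unfolding h_def by (rule continuous_on_compose2[OF g]) (auto intro!: continuous_intros)
    have "bounded (g ` {-1..1})"
      by (rule compact_imp_bounded[OF compact_continuous_image[OF g compact_Icc]])
    then obtain B where B: "\<forall>y\<in>{-1..1}. norm (g y) \<le> B"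
      unfolding bounded_iff by blast
    have [measurable]: "h \<in> borel_measurable borel" using h by (rule borel_measurable_continuous_onI)
    have "(\<lambda>n. integral\<^sup>L ((\<mu> \<circ> id \<circ> r) n) h) \<longlonglongrightarrow> integral\<^sup>L L h"
    proof (rule weak_conv_imp_integral_bdd_continuous_conv[OF _ L w])
      show "real_distribution ((\<mu> \<circ> id \<circ> r) n)" for n unfolding comp_def by (rule rd)
      show "isCont h x" for x using h by (simp add: continuous_on_eq_continuous_at)
      show "norm (h x) \<le> B" for x unfolding h_def by (rule B[rule_format]) simp
    qed
    moreover have "integral\<^sup>L ((\<mu> \<circ> id \<circ> r) n) h = (\<integral>x. g (bias x) \<partial>N (r n))" for n
      unfolding \<mu>_def comp_def id_def by (subst integral_bias_law[OF N]) (auto simp: h_def)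
    moreover have "integral\<^sup>L L h = (\<integral>x. g (bias x) \<partial>M)"
    proof -
      have "(\<integral>x. g (bias x) \<partial>M) = (\<integral>x. h (bias x) \<partial>M)" by (simp add: h_def)
      also have "\<dots> = (\<integral>y. h (bias (unbias y)) \<partial>L)" unfolding M_def by (subst integral_distr) auto
      also have "\<dots> = (\<integral>y. h y \<partial>L)" by (simp add: bias_unbias h_def)
      finally show ?thesis ..
    qed
    ultimately show ?thesis by (simp only:)
  qed
  have "(\<lambda>n. \<integral>x. bias x \<partial>N (r n)) \<longlonglongrightarrow> (\<integral>x. bias x \<partial>M)"
    using lim[of "\<lambda>y. y"] by simp
  then have "(\<lambda>n. 0) \<longlonglongrightarrow> (\<integral>x. bias x \<partial>M)"
    unfolding chan_mean[OF N] .
  from LIMSEQ_const_iff[THEN iffD1, OF this, symmetric] have "chan M" using M by (simp add: chan_def)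
  show ?thesis by (rule that[OF r \<open>chan M\<close> lim])
qed

lemma continuous_J_kernel:
  assumes "\<bar>u\<bar> < 1"
  shows "continuous_on {-1..1} (\<lambda>y::real. y\<^sup>2 / (1 + u * y))"
proof -
  have "1 + u * y \<noteq> 0" if "y \<in> {-1..1}" for y
    using one_plus_mult_pos[OF assms, of y] that by (simp add: abs_le_iff)
  then show ?thesis by (intro continuous_intros) auto
qed

definition J_converges :: "(nat \<Rightarrow> ereal measure) \<Rightarrow> ereal measure \<Rightarrow> bool" where
  "J_converges N M \<longleftrightarrow> (\<forall>u. \<bar>u\<bar> < 1 \<longrightarrow> (\<lambda>n. J (N n) u) \<longlonglongrightarrow> J M u)"

lemma J_convergesD: "J_converges N M \<Longrightarrow> \<bar>u\<bar> < 1 \<Longrightarrow> (\<lambda>n. J (N n) u) \<longlonglongrightarrow> J M u"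
  by (simp add: J_converges_def)

lemma J_limit_exists:
  assumes N: "\<And>n. chan (N n)" and c: "\<And>u. \<bar>u\<bar> < 1 \<Longrightarrow> convergent (\<lambda>n. J (N n) u)"
  obtains M where "chan M" "J_converges N M"
proof -
  obtain r M where r: "strict_mono r" and M: "chan M" and
    g: "\<And>g :: real \<Rightarrow> real. continuous_on {-1..1} g \<Longrightarrow>
       (\<lambda>n. \<integral>x. g (bias x) \<partial>N (r n)) \<longlonglongrightarrow> (\<integral>x. g (bias x) \<partial>M)"
    using chan_compact[of N] N by metis
  have "(\<lambda>n. J (N n) u) \<longlonglongrightarrow> J M u" if u: "\<bar>u\<bar> < 1" for u
  proof -
    obtain l where l: "(\<lambda>n. J (N n) u) \<longlonglongrightarrow> l" using c[OF u] by (auto simp: convergent_def)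
    have "(\<lambda>n. J (N (r n)) u) \<longlonglongrightarrow> J M u"
      unfolding J_def by (rule g[OF continuous_J_kernel[OF u]])
    moreover have "(\<lambda>n. J (N (r n)) u) \<longlonglongrightarrow> l"
      using LIMSEQ_subseq_LIMSEQ[OF l r] by (simp add: comp_def)
    ultimately show ?thesis using l LIMSEQ_unique by blast
  qed
  then show ?thesis using M that by (simp add: J_converges_def)
qed

text \<open>A subsequence violating the claim has, by compactness, a further subsequence converging
  to some channel. That channel has the same \<open>J\<close> as \<open>M\<close>, hence equals
  \<open>M\<close>, a contradiction.\<close>

lemma J_converges_imp_integral:
  fixes g :: "real \<Rightarrow> real"
  assumes N: "\<And>n. chan (N n)" and M: "chan M" and c: "J_converges N M"
    and g: "continuous_on {-1..1} g"
  shows "(\<lambda>n. \<integral>x. g (bias x) \<partial>N n) \<longlonglongrightarrow> (\<integral>x. g (bias x) \<partial>M)"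
proof (rule ccontr)
  let ?a = "\<lambda>n. \<integral>x. g (bias x) \<partial>N n" and ?l = "\<integral>x. g (bias x) \<partial>M"
  assume "\<not> ?a \<longlonglongrightarrow> ?l"
  then obtain e where e: "e > 0" and "\<And>n. \<exists>m\<ge>n. \<not> dist (?a m) ?l < e"
    unfolding lim_sequentially by blast
  then have "infinite {m. e \<le> dist (?a m) ?l}"
    unfolding infinite_nat_iff_unbounded_le by (auto simp: not_less)
  then obtain s :: "nat \<Rightarrow> nat" where s: "strict_mono s" "\<And>n. e \<le> dist (?a (s n)) ?l"
    using infinite_enumerate by blast
  obtain r M' where r: "strict_mono r" and M': "chan M'" and
    h: "\<And>g :: real \<Rightarrow> real. continuous_on {-1..1} g \<Longrightarrow>
       (\<lambda>n. \<integral>x. g (bias x) \<partial>N (s (r n))) \<longlonglongrightarrow> (\<integral>x. g (bias x) \<partial>M')"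
    using chan_compact[of "\<lambda>n. N (s n)"] N by metis
  have "M' = M"
  proof (rule J_determines[OF M' M])
    fix u :: real assume u: "\<bar>u\<bar> < 1"
    have "(\<lambda>n. J (N (s (r n))) u) \<longlonglongrightarrow> J M' u"
      unfolding J_def by (rule h[OF continuous_J_kernel[OF u]])
    moreover have "(\<lambda>n. J (N (s (r n))) u) \<longlonglongrightarrow> J M u"
      using LIMSEQ_subseq_LIMSEQ[OF J_convergesD[OF c u] strict_mono_o[OF s(1) r]] by (simp add: comp_def)
    ultimately show "J M' u = J M u" by (rule LIMSEQ_unique)
  qed
  then have "(\<lambda>n. ?a (s (r n))) \<longlonglongrightarrow> ?l" using h[OF g] by simp
  then obtain n where "dist (?a (s (r n))) ?l < e"
    using e unfolding lim_sequentially by blast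
  then show False using s(2)[of "r n"] by simp
qed

lemma weakly_converges_llr:
  assumes N: "\<And>n. chan (N n)" and M: "chan M" and c: "J_converges N M"
  shows "weakly_converges (\<lambda>n. llr (N n)) (llr M)"
  unfolding weakly_converges_def
proof (intro allI impI, elim conjE)
  fix f :: "ereal \<Rightarrow> real"
  assume f: "continuous_on {-\<infinity><..} f" and "bounded (f ` {-\<infinity><..})"
  then obtain B where B: "\<And>r. r > -\<infinity> \<Longrightarrow> \<bar>f r\<bar> \<le> B" by (auto simp: bounded_iff)
  have "(\<lambda>r. if r \<in> {-\<infinity><..} then f r else f (-\<infinity>)) \<in> borel_measurable borel"
    by (intro borel_measurable_continuous_on_if f) auto
  also have "(\<lambda>r. if r \<in> {-\<infinity><..} then f r else f (-\<infinity>)) = f"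
    by (auto simp: fun_eq_iff)
  finally have fm[measurable]: "f \<in> borel_measurable borel" .
  \<comment> \<open>The density of \<open>llr\<close> supplies the factor \<open>1 + y\<close>. As
    \<open>f\<close> is bounded on \<open>{-\<infinity><..}\<close>, this factor makes
    \<open>g\<close> continuous at -1 within the interval, whatever \<open>f\<close> does near
    \<open>-\<infinity>\<close>.\<close>
  define g where "g y = (1 + y) * f (unbias y)" for y
  have int: "(\<integral>r. f r \<partial>llr A) = (\<integral>r. g (bias r) \<partial>A)" if "chan A" for A
  proof -
    have [measurable_cong]: "sets A = sets borel" using that by (simp add: chan_def)
    show ?thesis unfolding llr_def
      by (subst integral_density) (auto simp: g_def one_plus_bias_nonneg)
  qed
  have "continuous_on {-1..1} g"
    unfolding continuous_on_eq_continuous_within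
  proof
    fix y :: real assume y: "y \<in> {-1..1}"
    show "continuous (at y within {-1..1}) g"
    proof (cases "y = -1")
      case False
      then have y': "y \<in> {-1<..}" using y by auto
      have "continuous_on {-1<..} (\<lambda>y. f (unbias y))"
        by (rule continuous_on_compose2[OF f continuous_on_subset[OF continuous_unbias]]) (auto simp: unbias_def)
      then have "continuous_on {-1<..} g"
        unfolding g_def by (intro continuous_intros)
      then have "isCont g y" using y' by (simp add: continuous_on_eq_continuous_at)
      then show ?thesis by (rule continuous_at_imp_continuous_within)
    next
      case True
      have "(g \<longlongrightarrow> 0) (at (-1) within {-1..1})"
      proof (rule Lim_null_comparison)
        show "\<forall>\<^sub>F y in at (-1) within {-1..1}. norm (g y) \<le> (1 + y) * B"
        proof (rule eventually_at_filter[THEN iffD2], rule eventuallyI, intro impI)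
          fix y :: real assume "y \<noteq> -1" "y \<in> {-1..1}"
          then have "unbias y > -\<infinity>" "1 + y \<ge> 0" by (auto simp: unbias_def)
          then show "norm (g y) \<le> (1 + y) * B"
            using B by (auto simp: g_def abs_mult intro!: mult_left_mono)
        qed
        show "((\<lambda>y. (1 + y) * B) \<longlongrightarrow> 0) (at (-1) within {-1..1})"
          by (rule tendsto_eq_intros refl | simp)+
      qed
      then show ?thesis using True by (simp add: continuous_within g_def)
    qed
  qed
  then show "(\<lambda>n. \<integral>r. f r \<partial>llr (N n)) \<longlonglongrightarrow> (\<integral>r. f r \<partial>llr M)"
    unfolding int[OF N] int[OF M] by (rule J_converges_imp_integral[OF N M c])
qed

section \<open>Symmetry and continuity\<close>

text \<open>Stated through \<open>J\<close>, so that it passes directly to limits, scalings and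
  mixtures; \<open>even_chan_iff\<close> translates it into invariance of the law under
  negation.\<close>

definition even_chan :: "ereal measure \<Rightarrow> bool" where
  "even_chan N \<longleftrightarrow> (\<forall>u. \<bar>u\<bar> < 1 \<longrightarrow> J N (- u) = J N u)"

lemma chan_uminus:
  assumes "chan N"
  shows "chan (distr N borel uminus)" "J (distr N borel uminus) u = J N (- u)"
proof -
  have [measurable_cong]: "sets N = sets borel" using assms by (simp add: chan_def)
  show "chan (distr N borel uminus)"
    using assms by (auto simp: chan_def integral_distr intro: prob_space.prob_space_distr)
  show "J (distr N borel uminus) u = J N (- u)"
    unfolding J_def by (subst integral_distr) auto
qed

lemma even_chan_iff:
  assumes "chan N"
  shows "even_chan N \<longleftrightarrow> distr N borel uminus = N"
proof
  assume "even_chan N"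
  then show "distr N borel uminus = N"
    using assms by (intro J_determines chan_uminus) (auto simp: chan_uminus even_chan_def)
next
  assume "distr N borel uminus = N"
  then show "even_chan N"
    using chan_uminus(2)[OF assms] by (simp add: even_chan_def)
qed

lemma integral_uminus:
  assumes N: "chan N" "even_chan N" and [measurable]: "f \<in> borel_measurable borel"
  shows "(\<integral>r. f (- r) \<partial>N) = (\<integral>r. f r \<partial>N :: real)"
proof -
  have [measurable_cong]: "sets N = sets borel" using N by (simp add: chan_def)
  have "(\<integral>r. f r \<partial>N) = (\<integral>r. f r \<partial>distr N borel uminus)"
    using N by (simp add: even_chan_iff)
  also have "\<dots> = (\<integral>r. f (- r) \<partial>N)" by (subst integral_distr) auto
  finally show ?thesis by simp
qed

text \<open>With no mass at \<open>-\<infinity>\<close>, the mass at \<infinity> is what the finite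
  values leave of 1. This matches the symmetry condition, which tests only sets of finite
  values.\<close>

lemma dist_above_MInf_eqI:
  assumes M: "dist_above_MInf M" and N: "dist_above_MInf N"
    and eq: "\<And>E. E \<in> sets borel \<Longrightarrow> E \<subseteq> {-\<infinity><..<\<infinity>} \<Longrightarrow> emeasure M E = emeasure N E"
  shows "M = N"
proof (rule measure_eqI)
  show "sets M = sets N" using M N by (simp add: dist_above_MInf_def)
  define fin where "fin = {-\<infinity><..<\<infinity> :: ereal}"
  have fin: "fin \<in> sets borel" by (simp add: fin_def)
  have cases: "emeasure A E = emeasure A (E \<inter> fin) + (if \<infinity> \<in> E then 1 - emeasure A fin else 0)"
    if A: "dist_above_MInf A" and E: "E \<in> sets borel" for A E
  proof -
    interpret prob_space A using A by (simp add: dist_above_MInf_def)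
    have sA: "sets A = sets borel" and z: "emeasure A {-\<infinity>} = 0"
      using A by (auto simp: dist_above_MInf_def)
    have UA: "space A = UNIV" using sets_eq_imp_space_eq[OF sA] by simp
    have split: "emeasure A E = emeasure A (E \<inter> fin) + (if \<infinity> \<in> E then emeasure A {\<infinity>} else 0)"
      if E: "E \<in> sets borel" for E
    proof -
      have "r \<in> fin" if "r \<noteq> \<infinity>" "r \<noteq> -\<infinity>" for r using that by (cases r) (auto simp: fin_def)
      then have "E = (E \<inter> fin \<union> (E \<inter> {\<infinity>})) \<union> (E \<inter> {-\<infinity>})" by auto
      then have "emeasure A E = emeasure A ((E \<inter> fin \<union> (E \<inter> {\<infinity>})) \<union> (E \<inter> {-\<infinity>}))" by simp
      also have "\<dots> = emeasure A (E \<inter> fin \<union> (E \<inter> {\<infinity>}))"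
      proof (rule emeasure_Un_null_set)
        have "emeasure A (E \<inter> {-\<infinity>}) \<le> emeasure A {-\<infinity>}" by (intro emeasure_mono) (auto simp: sA)
        then show "E \<inter> {-\<infinity>} \<in> null_sets A" using z E by (simp add: null_sets_def sA)
      qed (use E fin sA in auto)
      also have "\<dots> = emeasure A (E \<inter> fin) + emeasure A (E \<inter> {\<infinity>})"
        using E fin sA by (intro plus_emeasure[symmetric]) (auto simp: fin_def)
      also have "emeasure A (E \<inter> {\<infinity>}) = (if \<infinity> \<in> E then emeasure A {\<infinity>} else 0)" by auto
      finally show ?thesis .
    qed
    have "emeasure A fin + emeasure A {\<infinity>} = 1"
      using split[of UNIV] emeasure_space_1 UA by simp
    then have "emeasure A {\<infinity>} = 1 - emeasure A fin"
      using ennreal_add_diff_cancel_left[of "emeasure A fin" "emeasure A {\<infinity>}"] emeasure_finite[of fin]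
      by (simp add: top_unique)
    then show ?thesis using split[OF E] by simp
  qed
  fix E assume "E \<in> sets M"
  then have E: "E \<in> sets borel" using M by (simp add: dist_above_MInf_def)
  have "emeasure M (E \<inter> fin) = emeasure N (E \<inter> fin)" "emeasure M fin = emeasure N fin"
    using E fin by (auto intro!: eq simp: fin_def)
  then show "emeasure M E = emeasure N E" using cases[OF M E] cases[OF N E] by simp
qed

text \<open>\<open>J\<close> can be read off from the tilted law: the density gives a second factor
  \<open>1 + y\<close>, and \<open>(1 + y)\<^sup>2 / (1 + u * y) = 1 + (2 - u) * y + (1 - u)\<^sup>2
  * (y\<^sup>2 / (1 + u * y))\<close>, whose linear term has mean 0.\<close>

lemma llr_inj: "chan A \<Longrightarrow> chan B \<Longrightarrow> llr A = llr B \<Longrightarrow> A = B"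
proof (rule J_determines)
  fix u :: real assume A: "chan A" and B: "chan B" and eq: "llr A = llr B" and u: "\<bar>u\<bar> < 1"
  have "(\<integral>r. (1 + bias r) / (1 + u * bias r) \<partial>llr N) = 1 + (1 - u)\<^sup>2 * J N u" if N: "chan N" for N
  proof -
    have [measurable_cong]: "sets N = sets borel" using N by (simp add: chan_def)
    have "(\<integral>r. (1 + bias r) / (1 + u * bias r) \<partial>llr N) =
        (\<integral>r. (1 + bias r) * ((1 + bias r) / (1 + u * bias r)) \<partial>N)"
      unfolding llr_def by (subst integral_density) (auto simp: one_plus_bias_nonneg)
    also have "\<dots> = (\<integral>r. 1 + (2 - u) * bias r + (1 - u)\<^sup>2 * ((bias r)\<^sup>2 / (1 + u * bias r)) \<partial>N)"
    proof (rule Bochner_Integration.integral_cong)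
      fix r
      define y where "y = bias r"
      have p: "1 + u * y > 0" unfolding y_def by (rule one_plus_mult_pos[OF u]) simp
      have "(1 + y) * (1 + y) = (1 + (2 - u) * y) * (1 + u * y) + (1 - u)\<^sup>2 * y\<^sup>2"
        by (simp add: algebra_simps power2_eq_square)
      then have "(1 + y) * ((1 + y) / (1 + u * y)) =
          ((1 + (2 - u) * y) * (1 + u * y) + (1 - u)\<^sup>2 * y\<^sup>2) / (1 + u * y)"
        by (simp only: times_divide_eq_right)
      also have "\<dots> = 1 + (2 - u) * y + (1 - u)\<^sup>2 * (y\<^sup>2 / (1 + u * y))"
        using p by (simp add: add_divide_distrib del: distrib_right distrib_left)
      finally have "(1 + y) * ((1 + y) / (1 + u * y)) = 1 + (2 - u) * y + (1 - u)\<^sup>2 * (y\<^sup>2 / (1 + u * y))" .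
      then show "(1 + bias r) * ((1 + bias r) / (1 + u * bias r)) =
          1 + (2 - u) * bias r + (1 - u)\<^sup>2 * ((bias r)\<^sup>2 / (1 + u * bias r))" unfolding y_def .
    qed simp
    also have "\<dots> = 1 + (1 - u)\<^sup>2 * J N u"
      unfolding integral_affine2[OF N integrable_bias[OF N] J_integrable[OF N u]] chan_mean[OF N] J_def by simp
    finally show ?thesis .
  qed
  from this[OF A] this[OF B] have "(1 - u)\<^sup>2 * J A u = (1 - u)\<^sup>2 * J B u"
    unfolding eq by linarith
  moreover have "(1 - u)\<^sup>2 \<noteq> 0" using u by (simp add: abs_less_iff)
  ultimately show "J A u = J B u" by (metis mult_left_cancel)
qed

lemma symmetric_dist_imp_LLR:
  assumes "symmetric_dist \<mu>"
  shows "LLR_dist \<mu>"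
proof -
  have m: "dist_above_MInf \<mu>" and s[measurable_cong]: "sets \<mu> = sets borel"
    and p: "prob_space \<mu>" and z: "emeasure \<mu> {-\<infinity>} = 0"
    using assms by (auto simp: symmetric_dist_def dist_above_MInf_def)
  let ?F = "{-\<infinity><..<\<infinity> :: ereal}"
  have "AE r in \<mu>. r \<noteq> -\<infinity>" using z by (intro AE_I[of _ _ "{-\<infinity>}"]) (auto simp: s)
  then have "(\<integral>\<^sup>+ r. exp_neg r \<partial>\<mu>) = (\<integral>\<^sup>+ r. exp_neg r * indicator ?F (- r) \<partial>\<mu>)"
  proof (intro nn_integral_cong_AE, eventually_elim)
    fix r :: ereal assume "r \<noteq> -\<infinity>"
    then show "exp_neg r = exp_neg r * indicator ?F (- r)" by (cases r) auto
  qed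
  also have "\<dots> = emeasure \<mu> ?F" using assms by (simp add: symmetric_dist_def)
  also have "\<dots> \<le> 1" by (rule prob_space.emeasure_le_1[OF p])
  finally show ?thesis using m by (simp add: LLR_dist_def)
qed

text \<open>Reflecting and weighting by \<open>exp_neg\<close> swaps the two input values, so on
  sets of finite values the right side of the symmetry condition is the law of the reflected channel
  given +1.\<close>

lemma symmetric_dist_llr:
  assumes N: "chan N"
  shows "symmetric_dist (llr N) \<longleftrightarrow> even_chan N"
proof -
  have [measurable_cong]: "sets N = sets borel" using N by (simp add: chan_def)
  note N' = chan_uminus(1)[OF N]
  have d: "dist_above_MInf (llr N)" if "chan N" for N using LLR_llr[OF that] by (simp add: LLR_dist_def)
  have e: "(\<integral>\<^sup>+ r. exp_neg r * indicator E (- r) \<partial>llr N) = emeasure (llr (distr N borel uminus)) E"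
    if [measurable]: "E \<in> sets borel" and E: "E \<subseteq> {-\<infinity><..<\<infinity>}" for E
  proof -
    have "(\<integral>\<^sup>+ r. exp_neg r * indicator E (- r) \<partial>llr N) =
        (\<integral>\<^sup>+ r. ennreal (1 + bias r) * (exp_neg r * indicator E (- r)) \<partial>N)"
      by (rule nn_integral_llr[OF N]) measurable
    also have "\<dots> = (\<integral>\<^sup>+ r. ennreal (1 + bias (- r)) * indicator E (- r) \<partial>N)"
    proof (rule nn_integral_cong)
      fix r :: ereal
      show "ennreal (1 + bias r) * (exp_neg r * indicator E (- r)) = ennreal (1 + bias (- r)) * indicator E (- r)"
      proof (cases "- r \<in> E")
        case True
        then have "r \<noteq> -\<infinity>" using E by auto
        then show ?thesis using True exp_neg_weight[of r] by (simp add: mult.commute)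
      qed simp
    qed
    also have "\<dots> = (\<integral>\<^sup>+ r. ennreal (1 + bias r) * indicator E r \<partial>distr N borel uminus)"
      by (subst nn_integral_distr) auto
    also have "\<dots> = emeasure (llr (distr N borel uminus)) E"
      unfolding llr_def by (simp add: emeasure_density)
    finally show ?thesis .
  qed
  show ?thesis
  proof
    assume s: "symmetric_dist (llr N)"
    have "llr N = llr (distr N borel uminus)"
      using s e by (intro dist_above_MInf_eqI d N N') (auto simp: symmetric_dist_def)
    then show "even_chan N" using llr_inj[OF N N'] by (simp add: even_chan_iff[OF N])
  next
    assume "even_chan N"
    then have "distr N borel uminus = N" by (simp add: even_chan_iff[OF N])
    then show "symmetric_dist (llr N)" using e d[OF N] by (simp add: symmetric_dist_def)
  qed
qed

lemma even_scale_chan: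
  assumes "chan N" "\<delta> \<in> {0..1}" "even_chan N"
  shows "even_chan (scale_chan \<delta> N)"
  unfolding even_chan_def
proof (intro allI impI)
  fix u :: real assume "\<bar>u\<bar> < 1"
  then have "\<bar>(1 - 2 * \<delta>) * u\<bar> < 1" using assms by (intro abs_scale_less_1)
  then show "J (scale_chan \<delta> N) (- u) = J (scale_chan \<delta> N) u"
    using assms by (simp add: J_scale_chan even_chan_def)
qed

lemma even_prod_chan:
  assumes A: "chan A" "even_chan A" and B: "chan B" "even_chan B"
  shows "even_chan (prod_chan A B)"
  unfolding even_chan_def
proof (intro allI impI)
  fix u :: real assume u: "\<bar>u\<bar> < 1"
  then have u': "\<bar>- u\<bar> < 1" by simp
  have K: "K (- u) a b = K u (- a) (- b)" for a b by (simp add: K_def algebra_simps power2_eq_square)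
  have [measurable]: "(\<lambda>x. \<integral>y. K u (bias x) (bias y) \<partial>B) \<in> borel_measurable borel"
  proof -
    interpret B: prob_space B using B by (simp add: chan_def)
    have [measurable_cong]: "sets B = sets borel" using B by (simp add: chan_def)
    have "(\<lambda>x. \<integral>y. (\<lambda>(x, y). K u (bias x) (bias y)) (x, y) \<partial>B) \<in> borel_measurable borel"
      by (rule B.borel_measurable_lebesgue_integral) (simp add: split_beta')
    then show ?thesis by simp
  qed
  have "J (prod_chan A B) (- u) = (\<integral>x. \<integral>y. K u (bias (- x)) (bias (- y)) \<partial>B \<partial>A)"
    by (simp add: J_prod_chan[OF A(1) B(1) u'] K)
  also have "\<dots> = (\<integral>x. \<integral>y. K u (bias (- x)) (bias y) \<partial>B \<partial>A)"
    by (subst integral_uminus[OF B, where f = "\<lambda>y. K u _ (bias y)"]) (auto simp: K_def)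
  also have "\<dots> = J (prod_chan A B) u"
    unfolding J_prod_chan[OF A(1) B(1) u] by (rule integral_uminus[OF A]) measurable
  finally show "J (prod_chan A B) (- u) = J (prod_chan A B) u" .
qed

lemma even_star: "chan S \<Longrightarrow> even_chan S \<Longrightarrow> chan X \<Longrightarrow> even_chan X \<Longrightarrow> even_chan (star S X d)"
  by (induction d) (simp_all add: even_prod_chan chan_star)

lemma even_BP_chan:
  assumes "chan S" "even_chan S" "chan N" "even_chan N" "\<delta> \<in> {0..1}"
  shows "even_chan (BP_chan \<delta> P S N)"
  unfolding even_chan_def
proof (intro allI impI)
  fix u :: real assume u: "\<bar>u\<bar> < 1"
  then have u': "\<bar>- u\<bar> < 1" by simp
  have "even_chan (star S (scale_chan \<delta> N) k)" for k
    using assms by (intro even_star chan_scale_chan even_scale_chan)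
  then have "J (star S (scale_chan \<delta> N) k) (- u) = J (star S (scale_chan \<delta> N) k) u" for k
    using u unfolding even_chan_def by blast
  then show "J (BP_chan \<delta> P S N) (- u) = J (BP_chan \<delta> P S N) u"
    by (simp only: J_BP_chan[OF assms(1,3,5) u] J_BP_chan[OF assms(1,3,5) u'])
qed

lemma even_J_converges: "(\<And>n. even_chan (N n)) \<Longrightarrow> J_converges N M \<Longrightarrow> even_chan M"
  unfolding even_chan_def
proof (intro allI impI)
  fix u :: real
  assume e: "\<And>n. \<forall>u. \<bar>u\<bar> < 1 \<longrightarrow> J (N n) (- u) = J (N n) u" and c: "J_converges N M" and u: "\<bar>u\<bar> < 1"
  then have "(\<lambda>n. J (N n) u) \<longlonglongrightarrow> J M (- u)" using J_convergesD[OF c, of "- u"] by simp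
  then show "J M (- u) = J M u" using J_convergesD[OF c u] by (rule LIMSEQ_unique)
qed

text \<open>BP is continuous along monotone sequences, which avoids continuity of products under weak limits.\<close>

definition chain :: "bool \<Rightarrow> (nat \<Rightarrow> ereal measure) \<Rightarrow> bool" where
  "chain up N \<longleftrightarrow> (\<forall>m n. m \<le> n \<longrightarrow> (if up then N m \<sqsubseteq> N n else N n \<sqsubseteq> N m))"

lemma double_limit_incr:
  fixes a :: "nat \<Rightarrow> nat \<Rightarrow> real"
  assumes mono: "\<And>m m' n n'. m \<le> m' \<Longrightarrow> n \<le> n' \<Longrightarrow> a m n \<le> a m' n'"
    and b: "\<And>m. (\<lambda>n. a m n) \<longlonglongrightarrow> b m" and c: "b \<longlonglongrightarrow> c"
  shows "(\<lambda>n. a n n) \<longlonglongrightarrow> c"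
proof (rule LIMSEQ_I)
  have ab: "a m n \<le> b m" for m n
    by (rule incseq_le[OF _ b]) (auto simp: incseq_def intro: mono)
  have "incseq b"
    unfolding incseq_def by (intro allI impI LIMSEQ_le[OF b b] exI[of _ 0]) (auto intro: mono)
  then have bc: "b m \<le> c" for m by (rule incseq_le[OF _ c])
  fix e :: real assume e: "e > 0"
  obtain m where m: "dist (b m) c < e / 2"
    using c e by (metis half_gt_zero lim_sequentially order_refl)
  obtain n where n: "dist (a m n) (b m) < e / 2"
    using b[of m] e by (metis half_gt_zero lim_sequentially order_refl)
  have "norm (a k k - c) < e" if "max m n \<le> k" for k
  proof -
    have "a m n \<le> a k k" "a k k \<le> c" using mono[of m k n k] ab[of k k] bc[of k] that by auto
    then show ?thesis using m n unfolding dist_real_def real_norm_def by linarith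
  qed
  then show "\<exists>no. \<forall>n\<ge>no. norm (a n n - c) < e" by blast
qed

lemma double_limit:
  fixes a :: "nat \<Rightarrow> nat \<Rightarrow> real"
  assumes mono: "\<And>m m' n n'. m \<le> m' \<Longrightarrow> n \<le> n' \<Longrightarrow> if up then a m n \<le> a m' n' else a m' n' \<le> a m n"
    and b: "\<And>m. (\<lambda>n. a m n) \<longlonglongrightarrow> b m" and c: "b \<longlonglongrightarrow> c"
  shows "(\<lambda>n. a n n) \<longlonglongrightarrow> c"
proof (cases up)
  case True
  then show ?thesis using mono b c by (intro double_limit_incr[of a b c]) auto
next
  case False
  then have "(\<lambda>n. - a n n) \<longlonglongrightarrow> - c"
    using mono b c by (intro double_limit_incr[of "\<lambda>m n. - a m n" "\<lambda>m. - b m"] tendsto_minus) auto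
  then show ?thesis by (rule tendsto_minus_cancel)
qed

lemma integral_K_bound:
  assumes B: "chan B" and u: "\<bar>u\<bar> < 1" and a: "\<bar>a\<bar> \<le> 1"
  shows "\<bar>\<integral>y. K u a (bias y) \<partial>B\<bar> \<le> 2 / (1 - \<bar>u\<bar>)"
proof -
  have k: "\<bar>K u a (bias y)\<bar> \<le> 2 / (1 - \<bar>u\<bar>)" for y
    using K_bounds[OF u a abs_bias_le_1, of y] by simp
  have i: "integrable B (\<lambda>y. K u a (bias y))"
    by (rule integrable_bounded_bias[OF chan_prob[OF B] chan_sets[OF B] _ k]) (unfold K_def, measurable)
  have "\<bar>\<integral>y. K u a (bias y) \<partial>B\<bar> \<le> (\<integral>y. \<bar>K u a (bias y)\<bar> \<partial>B)" by (rule integral_abs_bound)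
  also have "\<dots> \<le> (\<integral>y. 2 / (1 - \<bar>u\<bar>) \<partial>B)"
    using k i chan_prob[OF B] by (intro integral_mono integrable_abs)
      (auto simp: prob_space.finite_measure finite_measure.integrable_const)
  finally show ?thesis unfolding integral_const_chan[OF B] .
qed

lemma prod_chan_tendsto_right:
  assumes A: "chan A" and B: "\<And>n. chan (B n)" and M: "chan M" and c: "J_converges B M"
  shows "J_converges (\<lambda>n. prod_chan A (B n)) (prod_chan A M)"
  unfolding J_converges_def
proof (intro allI impI)
  fix u :: real assume u: "\<bar>u\<bar> < 1"
  interpret prob_space A using A by (simp add: chan_def)
  note m = integral_pair_bounded(4)[OF A _ _ abs_K_le[OF u], THEN borel_measurable_integrable]
  show "(\<lambda>n. J (prod_chan A (B n)) u) \<longlonglongrightarrow> J (prod_chan A M) u"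
    unfolding J_prod_chan[OF A B u] J_prod_chan[OF A M u]
  proof (rule integral_dominated_convergence[where w = "\<lambda>_. 2 / (1 - \<bar>u\<bar>)"])
    show "(\<lambda>x. \<integral>y. K u (bias x) (bias y) \<partial>M) \<in> borel_measurable A" by (intro m M) measurable
    show "(\<lambda>x. \<integral>y. K u (bias x) (bias y) \<partial>B n) \<in> borel_measurable A" for n by (intro m B) measurable
    show "AE x in A. norm (\<integral>y. K u (bias x) (bias y) \<partial>B n) \<le> 2 / (1 - \<bar>u\<bar>)" for n
      using integral_K_bound[OF B u abs_bias_le_1] by simp
    show "AE x in A. (\<lambda>n. \<integral>y. K u (bias x) (bias y) \<partial>B n) \<longlonglongrightarrow> (\<integral>y. K u (bias x) (bias y) \<partial>M)"
    proof (rule AE_I2)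
      fix x
      define a where "a = bias x"
      have a: "\<bar>a\<bar> \<le> 1" by (simp add: a_def)
      show "(\<lambda>n. \<integral>y. K u (bias x) (bias y) \<partial>B n) \<longlonglongrightarrow> (\<integral>y. K u (bias x) (bias y) \<partial>M)"
        unfolding a_def[symmetric] integral_K[OF B u a] integral_K[OF M u a]
      proof (cases "\<bar>a\<bar> = 1")
        case True
        then have "a\<^sup>2 = 1" by (metis power2_abs one_power2)
        then show "(\<lambda>n. a\<^sup>2 / (1 + u * a) + (1 - a\<^sup>2)\<^sup>2 / (1 + u * a) ^ 3 * J (B n) ((a + u) / (1 + u * a)))
          \<longlonglongrightarrow> a\<^sup>2 / (1 + u * a) + (1 - a\<^sup>2)\<^sup>2 / (1 + u * a) ^ 3 * J M ((a + u) / (1 + u * a))" by simp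
      next
        case False
        then show "(\<lambda>n. a\<^sup>2 / (1 + u * a) + (1 - a\<^sup>2)\<^sup>2 / (1 + u * a) ^ 3 * J (B n) ((a + u) / (1 + u * a)))
          \<longlonglongrightarrow> a\<^sup>2 / (1 + u * a) + (1 - a\<^sup>2)\<^sup>2 / (1 + u * a) ^ 3 * J M ((a + u) / (1 + u * a))"
          using a by (intro tendsto_add tendsto_const tendsto_mult_left J_convergesD[OF c] posterior_bound u) auto
      qed
    qed
  qed simp
qed

text \<open>\<open>prod_chan_tendsto_right\<close> handles one moving factor. When both move, the
  diagonal has the iterated limit because \<open>J\<close> of the product is monotone in either
  index.\<close>

lemma prod_chan_tendsto:
  assumes A: "\<And>n. chan (A n)" and B: "\<And>n. chan (B n)" and L: "chan L" and M: "chan M"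
    and c: "J_converges A L" "J_converges B M" and mono: "chain up A" "chain up B"
  shows "J_converges (\<lambda>n. prod_chan (A n) (B n)) (prod_chan L M)"
  unfolding J_converges_def
proof (intro allI impI)
  fix u :: real assume u: "\<bar>u\<bar> < 1"
  show "(\<lambda>n. J (prod_chan (A n) (B n)) u) \<longlonglongrightarrow> J (prod_chan L M) u"
  proof (rule double_limit[where a = "\<lambda>m n. J (prod_chan (A m) (B n)) u" and b = "\<lambda>m. J (prod_chan (A m) M) u" and up = up])
    show "(\<lambda>n. J (prod_chan (A m) (B n)) u) \<longlonglongrightarrow> J (prod_chan (A m) M) u" for m
      by (rule J_convergesD[OF prod_chan_tendsto_right[OF A B M c(2)] u])
    show "(\<lambda>m. J (prod_chan (A m) M) u) \<longlonglongrightarrow> J (prod_chan L M) u"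
      unfolding J_prod_chan_commute[OF A M u] J_prod_chan_commute[OF L M u]
      by (rule J_convergesD[OF prod_chan_tendsto_right[OF M A L c(1)] u])
    fix m m' n n' :: nat assume "m \<le> m'" "n \<le> n'"
    then have "if up then prod_chan (A m) (B n) \<sqsubseteq> prod_chan (A m') (B n')
        else prod_chan (A m') (B n') \<sqsubseteq> prod_chan (A m) (B n)"
      using mono by (auto simp: chain_def intro!: prod_chan_mono A B)
    then show "if up then J (prod_chan (A m) (B n)) u \<le> J (prod_chan (A m') (B n')) u
        else J (prod_chan (A m') (B n')) u \<le> J (prod_chan (A m) (B n)) u"
      using u by (auto simp: less_noisy_def split: if_splits)
  qed
qed

lemma star_tendsto:
  assumes S: "chan S" and X: "\<And>n. chan (X n)" and L: "chan L" and c: "J_converges X L" and mono: "chain up X"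
  shows "J_converges (\<lambda>n. star S (X n) d) (star S L d)"
proof (induction d)
  case 0
  show ?case by (simp add: J_converges_def)
next
  case (Suc d)
  have "chain up (\<lambda>n. star S (X n) d)"
    using mono star_mono[OF S X X] by (auto simp: chain_def)
  then show ?case unfolding star.simps
    by (intro prod_chan_tendsto[OF X _ L _ c Suc mono] chan_star S X L)
qed

lemma BP_chan_tendsto:
  assumes S: "chan S" and N: "\<And>n. chan (N n)" and L: "chan L" and d: "\<delta> \<in> {0..1}"
    and c: "J_converges N L" and mono: "chain up N"
  shows "J_converges (\<lambda>n. BP_chan \<delta> P S (N n)) (BP_chan \<delta> P S L)"
  unfolding J_converges_def
proof (intro allI impI)
  fix u :: real assume u: "\<bar>u\<bar> < 1"
  note X = chan_scale_chan[OF N d] and XL = chan_scale_chan[OF L d]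
  have cX: "J_converges (\<lambda>n. scale_chan \<delta> (N n)) (scale_chan \<delta> L)"
    using J_convergesD[OF c abs_scale_less_1[OF d]]
    by (auto simp: J_converges_def J_scale_chan[OF N d] J_scale_chan[OF L d] intro!: tendsto_mult_left)
  have mX: "chain up (\<lambda>n. scale_chan \<delta> (N n))"
    using mono scale_chan_mono[OF N N d] by (auto simp: chain_def)
  show "(\<lambda>n. J (BP_chan \<delta> P S (N n)) u) \<longlonglongrightarrow> J (BP_chan \<delta> P S L) u"
    unfolding J_BP_chan[OF S N d u] J_BP_chan[OF S L d u]
  proof (rule integral_dominated_convergence[where w = "\<lambda>_. 1 / (1 - u\<^sup>2)"])
    show "AE k in measure_pmf P. (\<lambda>n. J (star S (scale_chan \<delta> (N n)) k) u) \<longlonglongrightarrow> J (star S (scale_chan \<delta> L) k) u"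
      using J_convergesD[OF star_tendsto[OF S X XL cX mX] u] by simp
    show "AE k in measure_pmf P. norm (J (star S (scale_chan \<delta> (N n)) k) u) \<le> 1 / (1 - u\<^sup>2)" for n
      using abs_J_le[OF chan_star[OF S X] u] by simp
  qed auto
qed

lemma monotone_J_limit:
  assumes N: "\<And>n. chan (N n)" and mono: "chain up N"
  obtains M where "chan M" "J_converges N M"
proof -
  have c: "convergent (\<lambda>n. J (N n) u)" if u: "\<bar>u\<bar> < 1" for u
  proof -
    have "Bseq (\<lambda>n. J (N n) u)"
      using abs_J_le[OF N u] by (intro BseqI'[of _ "1 / (1 - u\<^sup>2)"]) simp
    moreover have "monoseq (\<lambda>n. J (N n) u)"
      using mono u unfolding monoseq_def chain_def less_noisy_def by (cases up) auto
    ultimately show ?thesis by (rule Bseq_monoseq_convergent)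
  qed
  show ?thesis
  proof (rule J_limit_exists[OF N])
    show "convergent (\<lambda>n. J (N n) u)" if "\<bar>u\<bar> < 1" for u by (rule c[OF that])
  qed (rule that)
qed

text \<open>Averaging the kernel at \<open>u\<close> and \<open>-u\<close> leaves a function
  increasing in \<open>(bias r)\<^sup>2\<close>; in this form \<open>degrade_mono_param\<close>
  compares degradations pointwise.\<close>

lemma J_even:
  assumes N: "chan N" "even_chan N" and u: "\<bar>u\<bar> < 1"
  shows "J N u = (\<integral>r. (bias r)\<^sup>2 / (1 - u\<^sup>2 * (bias r)\<^sup>2) \<partial>N)"
    and "integrable N (\<lambda>r. (bias r)\<^sup>2 / (1 - u\<^sup>2 * (bias r)\<^sup>2))"
proof -
  have u': "\<bar>- u\<bar> < 1" using u by simp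
  note i = J_integrable[OF N(1) u] J_integrable[OF N(1) u']
  have e: "(bias r)\<^sup>2 / (1 - u\<^sup>2 * (bias r)\<^sup>2) =
      ((bias r)\<^sup>2 / (1 + u * bias r) + (bias r)\<^sup>2 / (1 + - u * bias r)) / 2" for r
  proof -
    define y where "y = bias r"
    have "1 + u * y > 0" "1 + - u * y > 0"
      unfolding y_def by (rule one_plus_mult_pos, fact u, simp, rule one_plus_mult_pos, fact u', simp)
    moreover have "1 - u\<^sup>2 * y\<^sup>2 = (1 + u * y) * (1 + - u * y)" by (simp add: algebra_simps power2_eq_square)
    ultimately have "y\<^sup>2 / (1 - u\<^sup>2 * y\<^sup>2) = (y\<^sup>2 / (1 + u * y) + y\<^sup>2 / (1 + - u * y)) / 2"
      by (simp add: divide_simps) (simp add: algebra_simps)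
    then show ?thesis unfolding y_def .
  qed
  show "integrable N (\<lambda>r. (bias r)\<^sup>2 / (1 - u\<^sup>2 * (bias r)\<^sup>2))"
    unfolding e using i by (intro integrable_divide_zero Bochner_Integration.integrable_add) auto
  have "(\<integral>r. (bias r)\<^sup>2 / (1 - u\<^sup>2 * (bias r)\<^sup>2) \<partial>N) = (J N u + J N (- u)) / 2"
    unfolding e J_def using i by (simp del: mult_minus_left)
  then show "J N u = (\<integral>r. (bias r)\<^sup>2 / (1 - u\<^sup>2 * (bias r)\<^sup>2) \<partial>N)"
    using N u by (simp add: even_chan_def)
qed

section \<open>The strict stringy tree lemma\<close>

definition degrade :: "real \<Rightarrow> ereal measure \<Rightarrow> ereal measure" where
  "degrade \<theta> N = scale_chan ((1 - \<theta>) / 2) N"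

lemma degrade_param: "\<theta> \<in> {0..1} \<Longrightarrow> (1 - \<theta>) / 2 \<in> {0..1 :: real}"
  by auto

lemma abs_degrade_less_1: "\<theta> \<in> {0..1} \<Longrightarrow> \<bar>u\<bar> < 1 \<Longrightarrow> \<bar>\<theta> * u\<bar> < (1 :: real)"
  using mult_mono[of "\<bar>\<theta>\<bar>" 1 "\<bar>u\<bar>" "\<bar>u\<bar>"] by (simp add: abs_mult)

lemma chan_degrade: "chan N \<Longrightarrow> \<theta> \<in> {0..1} \<Longrightarrow> chan (degrade \<theta> N)"
  unfolding degrade_def by (intro chan_scale_chan degrade_param)

lemma even_degrade: "chan N \<Longrightarrow> even_chan N \<Longrightarrow> \<theta> \<in> {0..1} \<Longrightarrow> even_chan (degrade \<theta> N)"
  unfolding degrade_def by (intro even_scale_chan degrade_param)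

lemma J_degrade: "chan N \<Longrightarrow> \<theta> \<in> {0..1} \<Longrightarrow> J (degrade \<theta> N) u = \<theta>\<^sup>2 * J N (\<theta> * u)"
  unfolding degrade_def by (subst J_scale_chan[OF _ degrade_param]) (auto simp: field_simps)

lemma integral_degrade:
  assumes N: "chan N" and t: "\<theta> \<in> {0..1}" and [measurable]: "f \<in> borel_measurable borel"
  shows "(\<integral>r. f r \<partial>degrade \<theta> N) = (\<integral>r. f (F_BP ((1 - \<theta>) / 2) r) \<partial>N :: real)"
proof -
  have [measurable_cong]: "sets N = sets borel" using N by (simp add: chan_def)
  note F_BP_measurable[OF degrade_param[OF t], measurable]
  show ?thesis unfolding degrade_def scale_chan_def by (subst integral_distr) auto
qed

lemma bias_F_degrade: "\<theta> \<in> {0..1} \<Longrightarrow> bias (F_BP ((1 - \<theta>) / 2) r) = \<theta> * bias r"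
  by (subst bias_F_BP[OF degrade_param]) (auto simp: field_simps)

text \<open>Consecutive symmetric noises commute, so degrading the argument of BP degrades each leaf
  channel.\<close>

lemma degrade_scale_chan:
  assumes "chan N" "\<theta> \<in> {0..1}" "\<delta> \<in> {0..1}"
  shows "scale_chan \<delta> (degrade \<theta> N) = degrade \<theta> (scale_chan \<delta> N)"
  using assms
  by (intro J_determines chan_scale_chan chan_degrade)
    (simp_all add: J_scale_chan J_degrade chan_degrade chan_scale_chan mult.assoc mult.left_commute)

lemma J_prod_degrade:
  assumes A: "chan A" and B: "chan B" and t: "\<theta> \<in> {0..1}" and u: "\<bar>u\<bar> < 1"
  shows "J (prod_chan (degrade \<theta> A) (degrade \<theta> B)) u = (\<integral>x. \<integral>y. K u (\<theta> * bias x) (\<theta> * bias y) \<partial>B \<partial>A)"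
proof -
  let ?A = "degrade \<theta> A" and ?B = "degrade \<theta> B"
  note A' = chan_degrade[OF A t] and B' = chan_degrade[OF B t]
  have "(\<lambda>x. \<integral>y. K u (bias x) (bias y) \<partial>?B) \<in> borel_measurable ?A"
    by (rule borel_measurable_integrable[OF integral_pair_bounded(4)[OF A' B' _ abs_K_le[OF u]]]) measurable
  then have m: "(\<lambda>x. \<integral>y. K u (bias x) (bias y) \<partial>?B) \<in> borel_measurable borel"
    using chan_sets[OF A'] by (simp cong: measurable_cong_sets)
  have m2: "(\<lambda>y. K u a (bias y)) \<in> borel_measurable borel" for a unfolding K_def by measurable
  have "J (prod_chan ?A ?B) u = (\<integral>x. \<integral>y. K u (bias x) (bias y) \<partial>?B \<partial>?A)"
    by (rule J_prod_chan[OF A' B' u])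
  also have "\<dots> = (\<integral>x. \<integral>y. K u (\<theta> * bias x) (bias y) \<partial>?B \<partial>A)"
    by (subst integral_degrade[OF A t m]) (simp add: bias_F_degrade[OF t])
  also have "\<dots> = (\<integral>x. \<integral>y. K u (\<theta> * bias x) (\<theta> * bias y) \<partial>B \<partial>A)"
    by (subst integral_degrade[OF B t m2]) (simp add: bias_F_degrade[OF t])
  finally show ?thesis .
qed

section \<open>Convexity estimates for the symmetrised kernel\<close>

lemma inverse_tangent:
  fixes z z' :: real
  assumes "z > 0" "z' > 0"
  shows "1 / z + (z - z') / z\<^sup>2 \<le> 1 / z'"
proof -
  have "1 / z' - (1 / z + (z - z') / z\<^sup>2) = (z - z')\<^sup>2 / (z\<^sup>2 * z')"
    using assms by (simp add: divide_simps power2_eq_square) (simp add: algebra_simps)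
  moreover have "0 \<le> (z - z')\<^sup>2 / (z\<^sup>2 * z')" using assms by simp
  ultimately show ?thesis by linarith
qed

lemma hyperbola_pair_tangent:
  fixes c c' q v :: real
  assumes "\<bar>v * q\<bar> < c" "\<bar>v * q\<bar> < c'"
  shows "q\<^sup>2 / (c + v * q) + q\<^sup>2 / (c - v * q) + (c - c') * (q\<^sup>2 / (c + v * q)\<^sup>2 + q\<^sup>2 / (c - v * q)\<^sup>2)
    \<le> q\<^sup>2 / (c' + v * q) + q\<^sup>2 / (c' - v * q)"
proof -
  have p: "c + v * q > 0" "c - v * q > 0" "c' + v * q > 0" "c' - v * q > 0" using assms by linarith+
  have "q\<^sup>2 * (1 / (c + v * q) + (c + v * q - (c' + v * q)) / (c + v * q)\<^sup>2) \<le> q\<^sup>2 * (1 / (c' + v * q))"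
    "q\<^sup>2 * (1 / (c - v * q) + (c - v * q - (c' - v * q)) / (c - v * q)\<^sup>2) \<le> q\<^sup>2 * (1 / (c' - v * q))"
    using p by (intro mult_left_mono inverse_tangent; simp)+
  then show ?thesis by (simp add: algebra_simps)
qed

text \<open>Brings the tangent slopes of a pair into the form
  \<open>2 * (W * ((1 + k * W) / (1 - k * W)\<^sup>2))\<close> with
  \<open>W = (q / c)\<^sup>2\<close> and \<open>k = v\<^sup>2\<close>, so that two pairs can be
  compared through one variable by \<open>convex_gap\<close>.\<close>

lemma squares_pair:
  fixes c q v :: real
  assumes "\<bar>v * q\<bar> < c"
  shows "q\<^sup>2 / (c + v * q)\<^sup>2 + q\<^sup>2 / (c - v * q)\<^sup>2 =
    2 * ((q / c)\<^sup>2 * ((1 + v\<^sup>2 * (q / c)\<^sup>2) / (1 - v\<^sup>2 * (q / c)\<^sup>2)\<^sup>2))"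
proof -
  have c: "c > 0" using assms by linarith
  define w where "w = q / c"
  have q: "q = c * w" using c by (simp add: w_def)
  have "\<bar>v * w\<bar> < 1" using assms c by (simp add: w_def abs_mult)
  then have p: "1 + v * w > 0" "1 - v * w > 0" by (simp_all add: abs_less_iff)
  have "c + v * q = c * (1 + v * w)" "c - v * q = c * (1 - v * w)" by (simp_all add: q algebra_simps)
  then have "q\<^sup>2 / (c + v * q)\<^sup>2 + q\<^sup>2 / (c - v * q)\<^sup>2 = w\<^sup>2 / (1 + v * w)\<^sup>2 + w\<^sup>2 / (1 - v * w)\<^sup>2"
    using c by (simp add: q power_mult_distrib)
  also have "\<dots> = (w\<^sup>2 * (1 - v * w)\<^sup>2 + w\<^sup>2 * (1 + v * w)\<^sup>2) / ((1 + v * w)\<^sup>2 * (1 - v * w)\<^sup>2)"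
    using p by (subst add_frac_eq) auto
  also have "(1 + v * w)\<^sup>2 * (1 - v * w)\<^sup>2 = (1 - v\<^sup>2 * w\<^sup>2)\<^sup>2"
    by (simp add: power2_eq_square algebra_simps)
  also have "w\<^sup>2 * (1 - v * w)\<^sup>2 + w\<^sup>2 * (1 + v * w)\<^sup>2 = 2 * (w\<^sup>2 * (1 + v\<^sup>2 * w\<^sup>2))"
    by (simp add: power2_eq_square algebra_simps)
  finally show ?thesis unfolding w_def by simp
qed

text \<open>The factor \<open>(1 + k * x) / (1 - k * x)\<^sup>2\<close> is increasing and at least
  1, so its product with \<open>x\<close> grows at least as fast as \<open>x\<close>.\<close>

lemma convex_gap:
  fixes X W k :: real
  assumes "0 \<le> X" "X \<le> W" "0 \<le> k" "k * W < 1"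
  shows "W - X \<le> W * ((1 + k * W) / (1 - k * W)\<^sup>2) - X * ((1 + k * X) / (1 - k * X)\<^sup>2)"
proof -
  have kX: "k * X \<le> k * W" "0 \<le> k * X" using assms by (auto intro: mult_left_mono)
  have "(1 - k * W)\<^sup>2 \<le> (1 - k * X)\<^sup>2" using kX assms by (intro power_mono) auto
  then have "(1 + k * X) / (1 - k * X)\<^sup>2 \<le> (1 + k * W) / (1 - k * W)\<^sup>2"
    using kX assms by (intro frac_le) auto
  then have 1: "X * ((1 + k * X) / (1 - k * X)\<^sup>2) \<le> X * ((1 + k * W) / (1 - k * W)\<^sup>2)"
    using assms by (intro mult_left_mono)
  have "(1 - k * W)\<^sup>2 \<le> 1" using kX assms by (intro power_le_one) auto
  moreover have "0 < (1 - k * W)\<^sup>2" using assms by simp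
  ultimately have "1 \<le> (1 + k * W) / (1 - k * W)\<^sup>2"
    using kX by (simp add: le_divide_eq)
  then have "(W - X) * 1 \<le> (W - X) * ((1 + k * W) / (1 - k * W)\<^sup>2)"
    using assms by (intro mult_left_mono) auto
  then have "W - X \<le> W * ((1 + k * W) / (1 - k * W)\<^sup>2) - X * ((1 + k * W) / (1 - k * W)\<^sup>2)"
    by (simp only: left_diff_distrib mult_1_right)
  with 1 show ?thesis by linarith
qed

text \<open>\<open>s\<close> interpolates between two placements of the noise. With
  \<open>v = \<theta> * u\<close>, \<open>\<theta>\<^sup>2 * H s v\<close> is the kernel of
  degrading the product at \<open>s = 1\<close>, where both factors share one noise bit, and that of
  degrading the factors independently at \<open>s = \<theta>\<^sup>2\<close>.\<close>

definition H :: "real \<Rightarrow> real \<Rightarrow> real \<Rightarrow> real \<Rightarrow> real" where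
  "H s v a b = (a + b)\<^sup>2 / (1 + s * (a * b) + v * (a + b))"

text \<open>Symmetric channels give opposite biases equal weight, so only this sum matters under the
  integral. The symmetrisation is essential: a single \<open>H s v a b\<close> with
  \<open>a * b < 0\<close> and \<open>a + b \<noteq> 0\<close> increases in \<open>s\<close> where
  its denominator is positive.\<close>

definition sign_sum :: "(real \<Rightarrow> real \<Rightarrow> real) \<Rightarrow> real \<Rightarrow> real \<Rightarrow> real" where
  "sign_sum F a b = F a b + F a (- b) + F (- a) b + F (- a) (- b)"

lemma sign_sum_abs: "sign_sum F \<bar>a\<bar> \<bar>b\<bar> = sign_sum F a b"
  by (cases "0 \<le> a"; cases "0 \<le> b") (simp_all add: sign_sum_def)

lemma sign_sum_H:
  "sign_sum (H s v) a b =
    (a + b)\<^sup>2 / (1 + s * (a * b) + v * (a + b)) + (a + b)\<^sup>2 / (1 + s * (a * b) - v * (a + b)) +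
    ((a - b)\<^sup>2 / (1 - s * (a * b) + v * (a - b)) + (a - b)\<^sup>2 / (1 - s * (a * b) - v * (a - b)))"
proof -
  have "(- a + b)\<^sup>2 = (a - b)\<^sup>2" "(- a - b)\<^sup>2 = (a + b)\<^sup>2" by (simp_all add: power2_eq_square algebra_simps)
  then show ?thesis by (simp add: sign_sum_def H_def algebra_simps)
qed

text \<open>Correlating the two noises can only hurt: the symmetrised kernel is decreasing in \<open>s\<close>. Each of
  its four terms is a hyperbola in \<open>s\<close>, so it lies above its tangent at the larger parameter.\<close>

lemma sign_sum_H_gain:
  assumes a: "0 \<le> a" "a \<le> 1" and b: "0 \<le> b" "b \<le> 1"
    and s: "s' \<le> s" "s \<le> 1" and v: "v\<^sup>2 \<le> s'" "\<bar>v\<bar> < 1"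
  shows "sign_sum (H s v) a b + 8 * (s - s') * (1 - s)\<^sup>2 * (a\<^sup>2 * b\<^sup>2) \<le> sign_sum (H s' v) a b"
proof -
  define p q r c c' e e' where "p = a * b" and "q = a + b" and "r = a - b" and "c = 1 + s * p"
    and "c' = 1 + s' * p" and "e = 1 - s * p" and "e' = 1 - s' * p"
  note defs = p_def q_def r_def c_def c'_def e_def e'_def
  have s0: "0 \<le> s'" "0 \<le> s" using v(1) s zero_le_power2[of v] by linarith+
  have p: "0 \<le> p" "p \<le> 1" using a b by (auto simp: p_def mult_le_one)
  have q0: "0 \<le> q" using a b by (simp add: q_def)
  \<comment> \<open>\<open>v\<^sup>2 \<le> s'\<close> puts \<open>c' - \<bar>v\<bar> * q\<close>
    above the positive product
    \<open>(1 - \<bar>v\<bar> * a) * (1 - \<bar>v\<bar> * b)\<close>.\<close>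
  have c'q: "\<bar>v * q\<bar> < c'"
  proof -
    have "\<bar>v\<bar> * a < 1" "\<bar>v\<bar> * b < 1"
      using v(2) a b mult_left_mono[of a 1 "\<bar>v\<bar>"] mult_left_mono[of b 1 "\<bar>v\<bar>"] by auto
    then have "0 < (1 - \<bar>v\<bar> * a) * (1 - \<bar>v\<bar> * b)" by simp
    also have "\<dots> = 1 + v\<^sup>2 * p - \<bar>v\<bar> * q"
      by (simp add: p_def q_def algebra_simps power2_eq_square)
    also have "\<dots> \<le> c' - \<bar>v\<bar> * q" using v(1) p by (simp add: c'_def mult_right_mono)
    finally show ?thesis using q0 by (simp add: abs_mult)
  qed
  have c'c: "c' \<le> c" using s p by (simp add: c_def c'_def mult_right_mono)
  then have cq: "\<bar>v * q\<bar> < c" using c'q by linarith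
  have ee': "e \<le> e'" using s p by (simp add: e_def e'_def mult_right_mono)
  have sum: "sign_sum (H s v) a b = q\<^sup>2 / (c + v * q) + q\<^sup>2 / (c - v * q) + (r\<^sup>2 / (e + v * r) + r\<^sup>2 / (e - v * r))"
    "sign_sum (H s' v) a b = q\<^sup>2 / (c' + v * q) + q\<^sup>2 / (c' - v * q) + (r\<^sup>2 / (e' + v * r) + r\<^sup>2 / (e' - v * r))"
    unfolding sign_sum_H defs by simp_all
  have cc': "c - c' = (s - s') * p" and e'e: "e - e' = - ((s - s') * p)"
    by (simp_all add: defs algebra_simps)
  note plus = hyperbola_pair_tangent[OF cq c'q, unfolded cc']
  have rp: "\<bar>r\<bar> \<le> 1 - p"
  proof -
    have "0 \<le> (1 - a) * (1 + b)" "0 \<le> (1 + a) * (1 - b)" using a b by auto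
    then show ?thesis by (simp add: r_def p_def algebra_simps abs_le_iff)
  qed
  show ?thesis
  \<comment> \<open>In the first case \<open>e = 0\<close>, so the pair with \<open>r\<close> has no
    tangent; its terms and the claimed gain vanish since \<open>r = 0\<close> and
    \<open>s = 1\<close>.\<close>
  proof (cases "p = 1 \<and> s = 1")
    case True
    then have "r = 0" "s = 1" using rp by auto
    moreover have "0 \<le> (s - s') * p * (q\<^sup>2 / (c + v * q)\<^sup>2 + q\<^sup>2 / (c - v * q)\<^sup>2)"
      using s p by (intro mult_nonneg_nonneg add_nonneg_nonneg) auto
    ultimately show ?thesis unfolding sum using plus by simp
  next
    case False
    have er: "\<bar>v * r\<bar> < e"
    proof (cases "p = 1")
      case True
      then have "r = 0" "s < 1" using rp False s by auto
      then show ?thesis using True by (simp add: e_def)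
    next
      case p1: False
      then have "\<bar>v\<bar> * \<bar>r\<bar> \<le> \<bar>v\<bar> * (1 - p)" "\<bar>v\<bar> * (1 - p) < 1 - p"
        using rp v(2) p by (auto intro: mult_left_mono)
      moreover have "1 - p \<le> e" using s p mult_right_mono[of s 1 p] by (simp add: e_def)
      ultimately show ?thesis by (simp add: abs_mult)
    qed
    then have e'r: "\<bar>v * r\<bar> < e'" using ee' by linarith
    note minus = hyperbola_pair_tangent[OF er e'r, unfolded e'e]
    define W X where "W = (q / c)\<^sup>2" and "X = (r / e)\<^sup>2"
    have c0: "c > 0" "e > 0" using cq er by linarith+
    \<comment> \<open>Passing from \<open>s\<close> to \<open>s'\<close> shrinks \<open>c\<close>
      and enlarges \<open>e\<close> by the same amount \<open>(s - s') * p\<close>. The net effect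
      is thus decided by the slopes of the two pairs, which \<open>W\<close> and \<open>X\<close>
      govern.\<close>
    have WX: "W - X = 4 * p * ((1 - s * a\<^sup>2) * (1 - s * b\<^sup>2)) / (c * e)\<^sup>2"
    proof -
      have "W - X = ((q * e)\<^sup>2 - (r * c)\<^sup>2) / (c * e)\<^sup>2"
        using c0 by (simp add: W_def X_def power_divide power_mult_distrib diff_divide_distrib)
      also have "(q * e)\<^sup>2 - (r * c)\<^sup>2 = 4 * p * ((1 - s * a\<^sup>2) * (1 - s * b\<^sup>2))"
        by (simp add: defs algebra_simps power2_eq_square)
      finally show ?thesis .
    qed
    have ge: "4 * p * (1 - s)\<^sup>2 \<le> W - X"
    proof -
      have "a\<^sup>2 \<le> 1" "b\<^sup>2 \<le> 1" using a b by (auto intro: power_le_one)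
      then have "s * a\<^sup>2 \<le> s * 1" "s * b\<^sup>2 \<le> s * 1"
        using s0 by (auto intro: mult_left_mono simp del: mult_1_right)
      then have "(1 - s) * (1 - s) \<le> (1 - s * a\<^sup>2) * (1 - s * b\<^sup>2)"
        using s by (intro mult_mono) auto
      then have n: "4 * p * (1 - s)\<^sup>2 \<le> 4 * p * ((1 - s * a\<^sup>2) * (1 - s * b\<^sup>2))"
        using p by (simp add: power2_eq_square mult_left_mono)
      have "c * e = 1 - (s * p)\<^sup>2" by (simp add: defs algebra_simps power2_eq_square)
      then have "c * e \<le> 1" by simp
      then have "(c * e)\<^sup>2 \<le> 1" using c0 by (intro power_le_one) auto
      moreover have "0 < (c * e)\<^sup>2" using c0 by simp
      ultimately have "x \<le> x / (c * e)\<^sup>2" if "0 \<le> x" for x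
        using that by (simp add: le_divide_eq mult_left_le)
      moreover have "0 \<le> 4 * p * ((1 - s * a\<^sup>2) * (1 - s * b\<^sup>2))"
        by (rule order_trans[OF _ n]) (use p in simp)
      ultimately show ?thesis unfolding WX using n by (meson order_trans)
    qed
    have "0 \<le> 4 * p * (1 - s)\<^sup>2" using p by simp
    with ge have XW: "X \<le> W" by linarith
    have kW: "v\<^sup>2 * W < 1"
    proof -
      have "\<bar>v * q / c\<bar> < 1" using cq c0 by simp
      then have "(v * q / c)\<^sup>2 < 1" by (simp add: abs_square_less_1)
      then show ?thesis by (simp add: W_def power_divide power_mult_distrib)
    qed
    have "4 * p * (1 - s)\<^sup>2 \<le> W * ((1 + v\<^sup>2 * W) / (1 - v\<^sup>2 * W)\<^sup>2) - X * ((1 + v\<^sup>2 * X) / (1 - v\<^sup>2 * X)\<^sup>2)"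
      using ge convex_gap[OF _ XW _ kW] by (auto simp: X_def)
    then have gap: "8 * p * (1 - s)\<^sup>2 \<le>
        (q\<^sup>2 / (c + v * q)\<^sup>2 + q\<^sup>2 / (c - v * q)\<^sup>2) - (r\<^sup>2 / (e + v * r)\<^sup>2 + r\<^sup>2 / (e - v * r)\<^sup>2)"
      unfolding squares_pair[OF cq] squares_pair[OF er] W_def[symmetric] X_def[symmetric] by linarith
    have "(s - s') * p * (8 * p * (1 - s)\<^sup>2) \<le> (s - s') * p *
        ((q\<^sup>2 / (c + v * q)\<^sup>2 + q\<^sup>2 / (c - v * q)\<^sup>2) - (r\<^sup>2 / (e + v * r)\<^sup>2 + r\<^sup>2 / (e - v * r)\<^sup>2))"
      using s p by (intro mult_left_mono gap) auto
    moreover have "(s - s') * p * (8 * p * (1 - s)\<^sup>2) = 8 * (s - s') * (1 - s)\<^sup>2 * (a\<^sup>2 * b\<^sup>2)"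
      by (simp only: p_def power2_eq_square mult.assoc mult.left_commute mult.commute)
    ultimately show ?thesis
      unfolding sum using plus minus by (simp only: right_diff_distrib minus_mult_left[symmetric])
  qed
qed

lemma sign_sum_K_gain:
  assumes t: "\<theta> \<in> {0..1}" and u: "\<bar>u\<bar> < 1" and a: "\<bar>a\<bar> \<le> 1" and b: "\<bar>b\<bar> \<le> 1"
  shows "sign_sum (\<lambda>a b. \<theta>\<^sup>2 * K (\<theta> * u) a b) a b + \<theta>\<^sup>2 * (1 - \<theta>\<^sup>2) ^ 3 * (a\<^sup>2 * b\<^sup>2)
    \<le> sign_sum (\<lambda>a b. K u (\<theta> * a) (\<theta> * b)) a b"
proof -
  define v m where "v = \<theta> * u" and "m = (1 + \<theta>\<^sup>2) / 2"
  have t2: "\<theta>\<^sup>2 \<le> 1" using t by (simp add: power_le_one)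
  have v: "v\<^sup>2 \<le> \<theta>\<^sup>2" "\<bar>v\<bar> < 1"
  proof -
    have "u\<^sup>2 \<le> 1" using u by (simp add: abs_square_le_1)
    then show "v\<^sup>2 \<le> \<theta>\<^sup>2" by (simp add: v_def power_mult_distrib mult_left_le)
    have "\<bar>\<theta>\<bar> * \<bar>u\<bar> \<le> 1 * \<bar>u\<bar>" using t by (intro mult_right_mono) auto
    then show "\<bar>v\<bar> < 1" using u by (simp add: v_def abs_mult)
  qed
  \<comment> \<open>The gain between \<open>s = \<theta>\<^sup>2\<close> and \<open>s = 1\<close> is split at \<open>m\<close> since the tangent at \<open>s = 1\<close> gives no strict gain.\<close>
  have m: "\<theta>\<^sup>2 \<le> m" "m \<le> 1" using t2 by (auto simp: m_def)
  have "sign_sum (H 1 v) \<bar>a\<bar> \<bar>b\<bar> + 8 * (1 - m) * (1 - 1)\<^sup>2 * (\<bar>a\<bar>\<^sup>2 * \<bar>b\<bar>\<^sup>2) \<le> sign_sum (H m v) \<bar>a\<bar> \<bar>b\<bar>"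
    using a b v m by (intro sign_sum_H_gain) auto
  moreover have "sign_sum (H m v) \<bar>a\<bar> \<bar>b\<bar> + 8 * (m - \<theta>\<^sup>2) * (1 - m)\<^sup>2 * (\<bar>a\<bar>\<^sup>2 * \<bar>b\<bar>\<^sup>2) \<le> sign_sum (H (\<theta>\<^sup>2) v) \<bar>a\<bar> \<bar>b\<bar>"
    using a b v m by (intro sign_sum_H_gain) auto
  \<comment> \<open>Both \<open>m - \<theta>\<^sup>2\<close> and \<open>1 - m\<close> equal
    \<open>(1 - \<theta>\<^sup>2) / 2\<close>, which absorbs the 8.\<close>
  moreover have "8 * (m - \<theta>\<^sup>2) * (1 - m)\<^sup>2 = (1 - \<theta>\<^sup>2) ^ 3"
    by (simp add: m_def power2_eq_square power3_eq_cube field_simps)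
  ultimately have "sign_sum (H 1 v) a b + (1 - \<theta>\<^sup>2) ^ 3 * (a\<^sup>2 * b\<^sup>2) \<le> sign_sum (H (\<theta>\<^sup>2) v) a b"
    by (simp add: sign_sum_abs)
  then have "\<theta>\<^sup>2 * (sign_sum (H 1 v) a b + (1 - \<theta>\<^sup>2) ^ 3 * (a\<^sup>2 * b\<^sup>2)) \<le> \<theta>\<^sup>2 * sign_sum (H (\<theta>\<^sup>2) v) a b"
    by (rule mult_left_mono) simp
  moreover have "K (\<theta> * u) a b = H 1 v a b" for a b
    by (simp add: K_def H_def v_def)
  then have "\<theta>\<^sup>2 * sign_sum (H 1 v) a b = sign_sum (\<lambda>a b. \<theta>\<^sup>2 * K (\<theta> * u) a b) a b"
    by (simp add: sign_sum_def distrib_left)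
  moreover have "K u (\<theta> * a) (\<theta> * b) = \<theta>\<^sup>2 * H (\<theta>\<^sup>2) v a b" for a b
  proof -
    have "(\<theta> * a + \<theta> * b)\<^sup>2 = \<theta>\<^sup>2 * (a + b)\<^sup>2" "\<theta> * a * (\<theta> * b) = \<theta>\<^sup>2 * (a * b)" "u * (\<theta> * a + \<theta> * b) = v * (a + b)"
      by (simp_all add: v_def power2_eq_square algebra_simps)
    then show ?thesis by (simp add: K_def H_def)
  qed
  then have "\<theta>\<^sup>2 * sign_sum (H (\<theta>\<^sup>2) v) a b = sign_sum (\<lambda>a b. K u (\<theta> * a) (\<theta> * b)) a b"
    by (simp add: sign_sum_def distrib_left)
  ultimately show ?thesis by (simp add: distrib_left)
qed

section \<open>Integrating the pointwise gain over two symmetric channels\<close>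

lemma integral_sign_sum:
  fixes F :: "real \<Rightarrow> real \<Rightarrow> real"
  assumes A: "chan A" "even_chan A" and B: "chan B" "even_chan B"
    and m[measurable]: "(\<lambda>z. F (fst z) (snd z)) \<in> borel_measurable (borel \<Otimes>\<^sub>M borel)"
    and bd: "\<And>a b. \<bar>a\<bar> \<le> 1 \<Longrightarrow> \<bar>b\<bar> \<le> 1 \<Longrightarrow> \<bar>F a b\<bar> \<le> C"
  shows "(\<integral>z. sign_sum F (bias (fst z)) (bias (snd z)) \<partial>(A \<Otimes>\<^sub>M B)) = 4 * (\<integral>x. \<integral>y. F (bias x) (bias y) \<partial>B \<partial>A)"
    and "integrable (A \<Otimes>\<^sub>M B) (\<lambda>z. sign_sum F (bias (fst z)) (bias (snd z)))"
proof -
  let ?I = "\<lambda>s t z. F (bias (s (fst z))) (bias (t (snd z)))"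
  have mF: "(\<lambda>z. F (f z) (g z)) \<in> borel_measurable M"
    if [measurable]: "f \<in> borel_measurable M" "g \<in> borel_measurable M" for f g and M :: "'z measure"
    using measurable_compose[OF measurable_Pair[OF that] m] by simp
  have ms: "(\<lambda>z. ?I s t z) \<in> borel_measurable (borel \<Otimes>\<^sub>M borel)"
    if [measurable]: "s \<in> borel_measurable borel" "t \<in> borel_measurable borel" for s t :: "ereal \<Rightarrow> ereal"
    by (rule mF) measurable
  have bds: "\<bar>F (bias x) (bias y)\<bar> \<le> C" for x y by (rule bd) auto
  have P: "(\<integral>z. ?I s t z \<partial>(A \<Otimes>\<^sub>M B)) = (\<integral>x. \<integral>y. F (bias (s x)) (bias (t y)) \<partial>B \<partial>A)"
      "integrable (A \<Otimes>\<^sub>M B) (?I s t)"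
    if "s \<in> borel_measurable borel" "t \<in> borel_measurable borel" for s t
    using integral_pair_bounded(1,3)[OF A(1) B(1), where f = "\<lambda>x y. F (bias (s x)) (bias (t y))", OF ms[OF that] bds]
    by simp_all
  have id: "(\<lambda>x. x) \<in> borel_measurable (borel :: ereal measure)"
    and um: "uminus \<in> borel_measurable (borel :: ereal measure)" by measurable
  have [measurable]: "(\<lambda>x. \<integral>y. F (bias x) (bias y) \<partial>B) \<in> borel_measurable borel"
    using borel_measurable_integrable[OF integral_pair_bounded(4)[OF A(1) B(1),
        where f = "\<lambda>x y. F (bias x) (bias y)", OF ms[OF id id] bds]] chan_sets[OF A(1)]
    by (simp cong: measurable_cong_sets)
  have [measurable]: "(\<lambda>y. F a (bias y)) \<in> borel_measurable borel" for a
    by (rule mF) measurable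
  have t: "(\<integral>x. \<integral>y. F (bias (s x)) (bias (- y)) \<partial>B \<partial>A) = (\<integral>x. \<integral>y. F (bias (s x)) (bias y) \<partial>B \<partial>A)" for s
    by (subst integral_uminus[OF B, where f = "\<lambda>y. F _ (bias y)"]) auto
  have s: "(\<integral>x. \<integral>y. F (bias (- x)) (bias y) \<partial>B \<partial>A) = (\<integral>x. \<integral>y. F (bias x) (bias y) \<partial>B \<partial>A)"
    by (rule integral_uminus[OF A, where f = "\<lambda>x. \<integral>y. F (bias x) (bias y) \<partial>B"]) measurable
  note i = P(2)[OF id id] P(2)[OF id um] P(2)[OF um id] P(2)[OF um um]
  have e: "sign_sum F (bias (fst z)) (bias (snd z)) =
      ?I (\<lambda>x. x) (\<lambda>x. x) z + ?I (\<lambda>x. x) uminus z + ?I uminus (\<lambda>x. x) z + ?I uminus uminus z" for z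
    by (simp add: sign_sum_def)
  show "integrable (A \<Otimes>\<^sub>M B) (\<lambda>z. sign_sum F (bias (fst z)) (bias (snd z)))"
    unfolding e by (intro Bochner_Integration.integrable_add i)
  have "(\<integral>z. sign_sum F (bias (fst z)) (bias (snd z)) \<partial>(A \<Otimes>\<^sub>M B)) =
      (\<integral>z. ?I (\<lambda>x. x) (\<lambda>x. x) z \<partial>(A \<Otimes>\<^sub>M B)) + (\<integral>z. ?I (\<lambda>x. x) uminus z \<partial>(A \<Otimes>\<^sub>M B)) +
      (\<integral>z. ?I uminus (\<lambda>x. x) z \<partial>(A \<Otimes>\<^sub>M B)) + (\<integral>z. ?I uminus uminus z \<partial>(A \<Otimes>\<^sub>M B))"
    unfolding e
    by (subst Bochner_Integration.integral_add, intro Bochner_Integration.integrable_add i, rule i,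
        subst Bochner_Integration.integral_add, intro Bochner_Integration.integrable_add i, rule i,
        subst Bochner_Integration.integral_add, rule i, rule i) (rule refl)
  also have "\<dots> = 4 * (\<integral>x. \<integral>y. F (bias x) (bias y) \<partial>B \<partial>A)"
    unfolding P(1)[OF id id] P(1)[OF id um] P(1)[OF um id] P(1)[OF um um] t s by simp
  finally show "(\<integral>z. sign_sum F (bias (fst z)) (bias (snd z)) \<partial>(A \<Otimes>\<^sub>M B)) = 4 * (\<integral>x. \<integral>y. F (bias x) (bias y) \<partial>B \<partial>A)" .
qed

lemma J_0: "J N 0 = (\<integral>r. (bias r)\<^sup>2 \<partial>N)"
  by (simp add: J_def)

text \<open>\<open>sign_sum_K_gain\<close> integrated over \<open>A\<close> and \<open>B\<close>:
  the four sign patterns have equal integrals, whence the 4, and the squared biases integrate to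
  \<open>J A 0\<close> and \<open>J B 0\<close>.\<close>

lemma stringy_tree:
  assumes A: "chan A" "even_chan A" and B: "chan B" "even_chan B" and t: "\<theta> \<in> {0..1}" and u: "\<bar>u\<bar> < 1"
  shows "\<theta>\<^sup>2 * J (prod_chan A B) (\<theta> * u) + \<theta>\<^sup>2 * (1 - \<theta>\<^sup>2) ^ 3 / 4 * (J A 0 * J B 0)
    \<le> J (prod_chan (degrade \<theta> A) (degrade \<theta> B)) u"
proof -
  have tu: "\<bar>\<theta> * u\<bar> < 1" using abs_degrade_less_1[OF t u] .
  let ?F1 = "\<lambda>a b. K u (\<theta> * a) (\<theta> * b)" and ?F2 = "\<lambda>a b. \<theta>\<^sup>2 * K (\<theta> * u) a b"
  let ?\<kappa> = "\<theta>\<^sup>2 * (1 - \<theta>\<^sup>2) ^ 3"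
  have m1: "(\<lambda>z. ?F1 (fst z) (snd z)) \<in> borel_measurable (borel \<Otimes>\<^sub>M borel)"
    and m2: "(\<lambda>z. ?F2 (fst z) (snd z)) \<in> borel_measurable (borel \<Otimes>\<^sub>M borel)"
    unfolding K_def by measurable
  have b1: "\<bar>?F1 a b\<bar> \<le> 2 / (1 - \<bar>u\<bar>)" if "\<bar>a\<bar> \<le> 1" "\<bar>b\<bar> \<le> 1" for a b
  proof -
    have "\<bar>\<theta> * a\<bar> \<le> 1" "\<bar>\<theta> * b\<bar> \<le> 1" using t that by (auto simp: abs_mult mult_le_one)
    then show ?thesis using K_bounds[OF u] by simp
  qed
  have b2: "\<bar>?F2 a b\<bar> \<le> \<theta>\<^sup>2 * (2 / (1 - \<bar>\<theta> * u\<bar>))" if "\<bar>a\<bar> \<le> 1" "\<bar>b\<bar> \<le> 1" for a b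
    using K_bounds[OF tu that] unfolding abs_mult by (intro mult_mono) auto
  note 1 = integral_sign_sum[OF A B m1 b1] and 2 = integral_sign_sum[OF A B m2 b2]
  have m3: "(\<lambda>z. (bias (fst z))\<^sup>2 * (bias (snd z))\<^sup>2) \<in> borel_measurable (borel \<Otimes>\<^sub>M borel)" by measurable
  have b3: "\<bar>(bias x)\<^sup>2 * (bias y)\<^sup>2\<bar> \<le> 1" for x y
    by (simp add: abs_mult mult_le_one abs_square_le_1)
  note 3 = integral_pair_bounded(1,3)[OF A(1) B(1) m3 b3]
  have "4 * (\<theta>\<^sup>2 * J (prod_chan A B) (\<theta> * u)) + ?\<kappa> * (J A 0 * J B 0) =
      (\<integral>z. sign_sum ?F2 (bias (fst z)) (bias (snd z)) + ?\<kappa> * ((bias (fst z))\<^sup>2 * (bias (snd z))\<^sup>2) \<partial>(A \<Otimes>\<^sub>M B))"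
    using 2 3 by (simp add: J_prod_chan[OF A(1) B(1) tu] J_0)
  also have "\<dots> \<le> (\<integral>z. sign_sum ?F1 (bias (fst z)) (bias (snd z)) \<partial>(A \<Otimes>\<^sub>M B))"
    using 1 2 3 sign_sum_K_gain[OF t u abs_bias_le_1 abs_bias_le_1]
    by (intro integral_mono Bochner_Integration.integrable_add integrable_mult_right) auto
  also have "\<dots> = 4 * J (prod_chan (degrade \<theta> A) (degrade \<theta> B)) u"
    using 1 by (simp add: J_prod_degrade[OF A(1) B(1) t u])
  finally show ?thesis by simp
qed

section \<open>Fixed points\<close>

text \<open>\<open>1 + u * bias r\<close> lies between \<open>1 - \<bar>u\<bar>\<close> and 2. Hence
  \<open>J N 0\<close> decides whether \<open>N\<close> is informative, and it bounds
  \<open>J N\<close> from below uniformly in \<open>u\<close>, in contrast to the upper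
  bound.\<close>

lemma J_le_J_0:
  assumes N: "chan N" and u: "\<bar>u\<bar> < 1"
  shows "J N u \<le> J N 0 / (1 - \<bar>u\<bar>)" "J N 0 / 2 \<le> J N u"
proof -
  have z: "\<bar>0::real\<bar> < 1" by simp
  note i0 = J_integrable[OF N z, simplified]
  have "J N u \<le> (\<integral>r. (bias r)\<^sup>2 / (1 - \<bar>u\<bar>) \<partial>N)"
    unfolding J_def
  proof (intro integral_mono J_integrable N u)
    fix r show "(bias r)\<^sup>2 / (1 + u * bias r) \<le> (bias r)\<^sup>2 / (1 - \<bar>u\<bar>)"
      using one_plus_mult_ge[OF abs_bias_le_1, of u r] u by (intro divide_left_mono) auto
  qed (use i0 in auto)
  then show "J N u \<le> J N 0 / (1 - \<bar>u\<bar>)" by (simp add: J_0)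
  have "(\<integral>r. (bias r)\<^sup>2 / 2 \<partial>N) \<le> J N u"
    unfolding J_def
  proof (intro integral_mono J_integrable N u)
    fix r
    have "\<bar>u * bias r\<bar> \<le> 1" using u mult_mono[of "\<bar>u\<bar>" 1 "\<bar>bias r\<bar>" 1] by (simp add: abs_mult)
    then have "1 + u * bias r \<le> 2" by linarith
    then show "(bias r)\<^sup>2 / 2 \<le> (bias r)\<^sup>2 / (1 + u * bias r)"
      using one_plus_mult_pos[OF u abs_bias_le_1, of r] by (intro divide_left_mono) auto
  qed (use i0 in auto)
  then show "J N 0 / 2 \<le> J N u" by (simp add: J_0)
qed

lemma J_0_nonneg: "0 \<le> J N 0"
  by (rule J_nonneg) simp

lemma J_eq_0: "chan N \<Longrightarrow> J N 0 = 0 \<Longrightarrow> \<bar>u\<bar> < 1 \<Longrightarrow> J N u = 0"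
  using J_le_J_0[of N u] J_nonneg[of u N] by simp

lemma chan_trivial: "chan trivial_dist" "J trivial_dist u = 0" "llr trivial_dist = trivial_dist"
proof -
  show "chan trivial_dist" by (simp add: chan_def prob_space_return integral_return)
  show "J trivial_dist u = 0" by (simp add: J_def integral_return)
  show "llr trivial_dist = trivial_dist"
  proof (rule measure_eqI)
    show "emeasure (llr trivial_dist) E = emeasure trivial_dist E" if "E \<in> sets (llr trivial_dist)" for E
      using that by (simp add: llr_def emeasure_density nn_integral_return)
  qed (simp add: llr_def)
qed

lemma nontrivial_iff: "chan N \<Longrightarrow> N \<noteq> trivial_dist \<longleftrightarrow> 0 < J N 0"
proof (cases "J N 0 = 0")
  case True
  assume N: "chan N"
  then have "N = trivial_dist"
    using True by (intro J_determines chan_trivial) (simp_all add: chan_trivial J_eq_0)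
  then show ?thesis by (simp add: chan_trivial)
next
  case False
  then show ?thesis using J_0_nonneg[of N] by (auto simp: chan_trivial)
qed

text \<open>The second term of \<open>integral_K\<close> is nonnegative: a further observation never
  hurts.\<close>

lemma prod_chan_ge:
  assumes A: "chan A" and B: "chan B"
  shows "A \<sqsubseteq> prod_chan A B"
  unfolding less_noisy_def
proof (intro allI impI)
  fix u :: real assume u: "\<bar>u\<bar> < 1"
  show "J A u \<le> J (prod_chan A B) u"
    unfolding J_prod_chan[OF A B u] unfolding J_def
  proof (intro integral_mono J_integrable A u)
    show "integrable A (\<lambda>x. \<integral>y. K u (bias x) (bias y) \<partial>B)"
      by (rule integral_pair_bounded(4)[OF A B _ abs_K_le[OF u]]) measurable
    fix x
    define a where "a = bias x"
    have a: "\<bar>a\<bar> \<le> 1" by (simp add: a_def)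
    have "0 \<le> (1 - a\<^sup>2)\<^sup>2 / (1 + u * a) ^ 3 * J B ((a + u) / (1 + u * a))"
    proof (cases "\<bar>a\<bar> = 1")
      case True
      then have "a\<^sup>2 = 1" by (metis power2_abs one_power2)
      then show ?thesis by simp
    next
      case False
      then have "\<bar>(a + u) / (1 + u * a)\<bar> < 1" using a by (intro posterior_bound u) auto
      then show ?thesis using one_plus_mult_pos[OF u a] by (intro mult_nonneg_nonneg J_nonneg) auto
    qed
    then show "(bias x)\<^sup>2 / (1 + u * bias x) \<le> (\<integral>y. K u (bias x) (bias y) \<partial>B)"
      unfolding a_def[symmetric] integral_K[OF B u a] by simp
  qed
qed

lemma prod_chan_trivial_0:
  assumes A: "chan A" and B: "chan B" and "J B 0 = 0"
  shows "J (prod_chan A B) 0 = J A 0"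
proof -
  have z: "\<bar>0::real\<bar> < 1" by simp
  have "(1 - (bias x)\<^sup>2)\<^sup>2 * J B (bias x) = 0" for x
  proof (cases "\<bar>bias x\<bar> = 1")
    case True
    then have "(bias x)\<^sup>2 = 1" by (metis power2_abs one_power2)
    then show ?thesis by simp
  next
    case False
    then have "\<bar>bias x\<bar> < 1" using abs_bias_le_1[of x] by linarith
    then show ?thesis using J_eq_0[OF B assms(3)] by simp
  qed
  then have "(\<integral>y. K 0 (bias x) (bias y) \<partial>B) = (bias x)\<^sup>2" for x
    by (simp only: integral_K[OF B z abs_bias_le_1] mult_zero_left add_0_right power_one div_by_1)
  then show ?thesis by (subst J_prod_chan[OF A B z]) (simp add: J_0)
qed

text \<open>Only the gain of the outermost product is counted. Those of inner products are
  nonnegative and dropped in \<open>star_degrade\<close>, since \<open>fixed_le\<close> asks only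
  that the average be positive.\<close>

definition star_gain :: "ereal measure \<Rightarrow> ereal measure \<Rightarrow> nat \<Rightarrow> real" where
  "star_gain S X d = (case d of 0 \<Rightarrow> 0 | Suc k \<Rightarrow> J X 0 * J (star S X k) 0)"

text \<open>In terms of \<open>x = \<theta>\<^sup>2 * y\<^sup>2\<close> the kernel is
  \<open>x / (1 - u\<^sup>2 * x)\<close>, which increases with slope at most
  \<open>1 / (1 - \<tau>\<^sup>2)\<^sup>2\<close> in the given range. In \<open>fixed_le\<close>,
  \<open>\<tau> = \<bar>u\<bar>\<close> yields continuity in \<theta> for each \<open>u\<close>, and
  a fixed \<open>\<tau> < 1\<close> makes it uniform in \<open>u\<close>.\<close>

lemma degrade_mono_param:
  assumes N: "chan N" "even_chan N" and t: "0 \<le> \<theta>" "\<theta> \<le> \<theta>'" "\<theta>' \<le> 1"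
    and u: "\<bar>u\<bar> < 1" and w: "\<theta>' * \<bar>u\<bar> \<le> \<tau>" "\<tau> < 1"
  shows "\<theta>\<^sup>2 * J N (\<theta> * u) \<le> \<theta>'\<^sup>2 * J N (\<theta>' * u)"
    and "\<theta>'\<^sup>2 * J N (\<theta>' * u) \<le> \<theta>\<^sup>2 * J N (\<theta> * u) + (\<theta>'\<^sup>2 - \<theta>\<^sup>2) / (1 - \<tau>\<^sup>2)\<^sup>2"
proof -
  have tu: "\<bar>t * u\<bar> < 1" if "0 \<le> t" "t \<le> 1" for t
    using u that mult_mono[of t 1 "\<bar>u\<bar>" "\<bar>u\<bar>"] by (simp add: abs_mult)
  have t1: "\<bar>\<theta> * u\<bar> < 1" "\<bar>\<theta>' * u\<bar> < 1" using t by (intro tu; simp)+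
  have tt: "\<theta>\<^sup>2 \<le> \<theta>'\<^sup>2" using t by (intro power_mono) auto
  have wt: "u\<^sup>2 * \<theta>'\<^sup>2 \<le> \<tau>\<^sup>2"
    using power_mono[OF w(1), of 2] t by (simp add: power_mult_distrib mult.commute)
  have "0 \<le> \<tau>" using w t by (meson abs_ge_zero mult_nonneg_nonneg order_trans)
  then have tau: "\<tau>\<^sup>2 < 1" using w by (simp add: abs_square_less_1)
  define f where "f t y = (t\<^sup>2 * y\<^sup>2) / (1 - u\<^sup>2 * (t\<^sup>2 * y\<^sup>2))" for t y :: real
  have J: "t\<^sup>2 * J N (t * u) = (\<integral>r. f t (bias r) \<partial>N)" "integrable N (\<lambda>r. f t (bias r))"
    if "\<bar>t * u\<bar> < 1" for t
  proof -
    have e: "f t (bias r) = t\<^sup>2 * ((bias r)\<^sup>2 / (1 - (t * u)\<^sup>2 * (bias r)\<^sup>2))" for r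
      by (simp add: f_def power_mult_distrib algebra_simps)
    show "t\<^sup>2 * J N (t * u) = (\<integral>r. f t (bias r) \<partial>N)"
      unfolding e J_even(1)[OF N that] by (rule integral_mult_right_zero[symmetric])
    show "integrable N (\<lambda>r. f t (bias r))"
      unfolding e using J_even(2)[OF N that] by (rule integrable_mult_right)
  qed
  have bounds: "f \<theta> y \<le> f \<theta>' y \<and> f \<theta>' y \<le> f \<theta> y + (\<theta>'\<^sup>2 - \<theta>\<^sup>2) / (1 - \<tau>\<^sup>2)\<^sup>2" if y: "\<bar>y\<bar> \<le> 1" for y
  proof -
    define a b where "a = \<theta>\<^sup>2 * y\<^sup>2" and "b = \<theta>'\<^sup>2 * y\<^sup>2"
    have y2: "y\<^sup>2 \<le> 1" using y by (simp add: abs_square_le_1)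
    have ab: "a \<le> b" "0 \<le> a" using tt by (auto simp: a_def b_def intro: mult_right_mono)
    have "(\<theta>'\<^sup>2 - \<theta>\<^sup>2) * y\<^sup>2 \<le> (\<theta>'\<^sup>2 - \<theta>\<^sup>2) * 1"
      using tt y2 by (intro mult_left_mono) auto
    then have ba: "b - a \<le> \<theta>'\<^sup>2 - \<theta>\<^sup>2" by (simp add: a_def b_def left_diff_distrib)
    have "b \<le> \<theta>'\<^sup>2" using y2 by (simp add: b_def mult_left_le)
    then have "u\<^sup>2 * b \<le> u\<^sup>2 * \<theta>'\<^sup>2" by (rule mult_left_mono) simp
    then have ub: "u\<^sup>2 * b \<le> \<tau>\<^sup>2" using wt by linarith
    have ua: "u\<^sup>2 * a \<le> u\<^sup>2 * b" using ab by (intro mult_left_mono) auto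
    have p: "0 < 1 - u\<^sup>2 * a" "0 < 1 - u\<^sup>2 * b" "0 < 1 - \<tau>\<^sup>2" using ua ub tau by linarith+
    have d: "f \<theta>' y - f \<theta> y = (b - a) / ((1 - u\<^sup>2 * a) * (1 - u\<^sup>2 * b))"
      unfolding f_def a_def[symmetric] b_def[symmetric]
      using p by (simp add: divide_simps) (simp add: algebra_simps)
    have "(1 - \<tau>\<^sup>2)\<^sup>2 \<le> (1 - u\<^sup>2 * a) * (1 - u\<^sup>2 * b)"
      unfolding power2_eq_square[of "1 - \<tau>\<^sup>2"] using ua ub p by (intro mult_mono) auto
    then have "(b - a) / ((1 - u\<^sup>2 * a) * (1 - u\<^sup>2 * b)) \<le> (\<theta>'\<^sup>2 - \<theta>\<^sup>2) / (1 - \<tau>\<^sup>2)\<^sup>2"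
      using ab ba p by (intro frac_le) auto
    moreover have "0 \<le> (b - a) / ((1 - u\<^sup>2 * a) * (1 - u\<^sup>2 * b))" using p ab by simp
    ultimately show ?thesis using d by linarith
  qed
  show "\<theta>\<^sup>2 * J N (\<theta> * u) \<le> \<theta>'\<^sup>2 * J N (\<theta>' * u)"
    unfolding J(1)[OF t1(1)] J(1)[OF t1(2)]
    using bounds[OF abs_bias_le_1] by (intro integral_mono J t1) auto
  have i: "integrable N (\<lambda>r. c :: real)" for c
    using chan_prob[OF N(1)] by (simp add: prob_space.finite_measure finite_measure.integrable_const)
  have "(\<integral>r. f \<theta>' (bias r) \<partial>N) \<le> (\<integral>r. f \<theta> (bias r) + (\<theta>'\<^sup>2 - \<theta>\<^sup>2) / (1 - \<tau>\<^sup>2)\<^sup>2 \<partial>N)"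
    using bounds[OF abs_bias_le_1] by (intro integral_mono Bochner_Integration.integrable_add J t1 i) auto
  also have "\<dots> = (\<integral>r. f \<theta> (bias r) \<partial>N) + (\<theta>'\<^sup>2 - \<theta>\<^sup>2) / (1 - \<tau>\<^sup>2)\<^sup>2"
    by (subst Bochner_Integration.integral_add[OF J(2)[OF t1(1)] i]) (simp only: integral_const_chan[OF N(1)])
  finally show "\<theta>'\<^sup>2 * J N (\<theta>' * u) \<le> \<theta>\<^sup>2 * J N (\<theta> * u) + (\<theta>'\<^sup>2 - \<theta>\<^sup>2) / (1 - \<tau>\<^sup>2)\<^sup>2"
    unfolding J(1)[OF t1(1)] J(1)[OF t1(2)] .
qed

lemma degrade_le:
  assumes N: "chan N" "even_chan N" and t: "\<theta> \<in> {0..1}"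
  shows "degrade \<theta> N \<sqsubseteq> N"
  unfolding less_noisy_def J_degrade[OF N(1) t]
  using degrade_mono_param(1)[OF N, of \<theta> 1] t by auto

text \<open>The survey stays undegraded on the right, which only helps by \<open>degrade_le\<close>;
  each further leaf is attached by \<open>stringy_tree\<close> and monotonicity of products.\<close>

lemma star_degrade:
  assumes S: "chan S" "even_chan S" and X: "chan X" "even_chan X" and t: "\<theta> \<in> {0..1}" and u: "\<bar>u\<bar> < 1"
  shows "\<theta>\<^sup>2 * J (star S X d) (\<theta> * u) + \<theta>\<^sup>2 * (1 - \<theta>\<^sup>2) ^ 3 / 4 * star_gain S X d \<le> J (star S (degrade \<theta> X) d) u"
  using u
proof (induction d arbitrary: u)
  case 0
  then show ?case using less_noisyD[OF degrade_le[OF S t] 0] by (simp add: star_gain_def J_degrade[OF S(1) t])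
next
  case (Suc d)
  let ?Y = "star S X d"
  note Y = chan_star[OF S(1) X(1), of d] even_star[OF S X, of d]
  note X' = chan_degrade[OF X(1) t]
  have g: "0 \<le> star_gain S X d" by (auto simp: star_gain_def J_0_nonneg split: nat.split)
  have "\<theta>\<^sup>2 \<le> 1" using t by (simp add: power_le_one)
  then have k: "0 \<le> \<theta>\<^sup>2 * (1 - \<theta>\<^sup>2) ^ 3 / 4" by simp
  have "degrade \<theta> ?Y \<sqsubseteq> star S (degrade \<theta> X) d"
    unfolding less_noisy_def J_degrade[OF Y(1) t]
    using Suc.IH mult_nonneg_nonneg[OF k g] by (meson add_increasing2 order_refl order_trans)
  then have "prod_chan (degrade \<theta> X) (degrade \<theta> ?Y) \<sqsubseteq> prod_chan (degrade \<theta> X) (star S (degrade \<theta> X) d)"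
    by (intro prod_chan_mono_right X' chan_degrade Y t chan_star S)
  then show ?case
    using stringy_tree[OF X Y t Suc.prems] less_noisyD[OF _ Suc.prems]
    by (fastforce simp: star_gain_def)
qed

lemma star_gain_bounds:
  assumes S: "chan S" and X: "chan X"
  shows "0 \<le> star_gain S X d" "\<bar>star_gain S X d\<bar> \<le> 1"
proof -
  show nn: "0 \<le> star_gain S X d" by (auto simp: star_gain_def J_0_nonneg split: nat.split)
  have "J N 0 \<le> 1" if "chan N" for N using J_le[OF that, of 0] by simp
  then have "star_gain S X d \<le> 1"
    using X chan_star[OF S X] by (auto simp: star_gain_def J_0_nonneg mult_le_one split: nat.split)
  then show "\<bar>star_gain S X d\<bar> \<le> 1" using nn by simp
qed

lemma BP_chan_degrade:
  assumes S: "chan S" "even_chan S" and N: "chan N" "even_chan N" and t: "\<theta> \<in> {0..1}" and d: "\<delta> \<in> {0..1}"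
    and u: "\<bar>u\<bar> < 1"
  shows "\<theta>\<^sup>2 * J (BP_chan \<delta> P S N) (\<theta> * u)
      + \<theta>\<^sup>2 * (1 - \<theta>\<^sup>2) ^ 3 / 4 * measure_pmf.expectation P (star_gain S (scale_chan \<delta> N))
    \<le> J (BP_chan \<delta> P S (degrade \<theta> N)) u"
proof -
  have tu: "\<bar>\<theta> * u\<bar> < 1" using abs_degrade_less_1[OF t u] .
  let ?X = "scale_chan \<delta> N" and ?\<kappa> = "\<theta>\<^sup>2 * (1 - \<theta>\<^sup>2) ^ 3 / 4"
  note X = chan_scale_chan[OF N(1) d] even_scale_chan[OF N(1) d N(2)]
  note X' = chan_degrade[OF X(1) t]
  have i1: "integrable (measure_pmf P) (\<lambda>k. J (star S ?X k) (\<theta> * u))"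
    using abs_J_le[OF chan_star[OF S(1) X(1)] tu] by (intro integrable_measure_pmf_bounded)
  have i2: "integrable (measure_pmf P) (star_gain S ?X)"
    using star_gain_bounds(2)[OF S(1) X(1)] by (intro integrable_measure_pmf_bounded)
  have i3: "integrable (measure_pmf P) (\<lambda>k. J (star S (degrade \<theta> ?X) k) u)"
    using abs_J_le[OF chan_star[OF S(1) X'] u] by (intro integrable_measure_pmf_bounded)
  have "\<theta>\<^sup>2 * J (BP_chan \<delta> P S N) (\<theta> * u) + ?\<kappa> * measure_pmf.expectation P (star_gain S ?X) =
      measure_pmf.expectation P (\<lambda>k. \<theta>\<^sup>2 * J (star S ?X k) (\<theta> * u) + ?\<kappa> * star_gain S ?X k)"
    unfolding J_BP_chan[OF S(1) N(1) d tu] using i1 i2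
    by (simp only: Bochner_Integration.integral_add integrable_mult_right integral_mult_right_zero)
  also have "\<dots> \<le> measure_pmf.expectation P (\<lambda>k. J (star S (degrade \<theta> ?X) k) u)"
    using i1 i2 i3 star_degrade[OF S X t u]
    by (intro integral_mono Bochner_Integration.integrable_add integrable_mult_right)
  also have "\<dots> = J (BP_chan \<delta> P S (degrade \<theta> N)) u"
    unfolding J_BP_chan[OF S(1) chan_degrade[OF N(1) t] d u] degrade_scale_chan[OF N(1) t d] ..
  finally show ?thesis .
qed

text \<open>For small \<theta>, \<open>\<theta>\<^sup>2 * J U (\<theta> * u)\<close> is small
  uniformly in \<open>u\<close>, since \<open>\<theta> * u\<close> stays away from \<plusminus>1,
  while \<open>J N u\<close> is at least \<open>J N 0 / 2\<close> for every
  \<open>u\<close>.\<close>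

lemma degrade_below_nontrivial:
  assumes N: "chan N" and nt: "0 < J N 0" and U: "chan U"
  obtains \<theta> where "\<theta> \<in> {0<..<1}" "degrade \<theta> U \<sqsubseteq> N"
proof -
  \<comment> \<open>As \<open>\<theta> \<le> 1 / 4\<close>,
    \<open>J U (\<theta> * u) \<le> 2\<close>; and
    \<open>2 * \<theta>\<^sup>2 \<le> 2 * \<theta> = J N 0 / 2\<close>.\<close>
  define \<theta> where "\<theta> = J N 0 / 4"
  have "J N 0 \<le> 1" using J_le[OF N, of 0] by simp
  then have t: "\<theta> \<in> {0<..<1}" "\<theta> \<le> 1 / 4" using nt by (auto simp: \<theta>_def)
  then have t': "\<theta> \<in> {0..1}" by auto
  have "degrade \<theta> U \<sqsubseteq> N"
    unfolding less_noisy_def J_degrade[OF U t']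
  proof (intro allI impI)
    fix u :: real assume u: "\<bar>u\<bar> < 1"
    have tu: "\<bar>\<theta> * u\<bar> \<le> 1 / 4" using t u mult_mono[of \<theta> "1/4" "\<bar>u\<bar>" 1] by (simp add: abs_mult)
    then have tu1: "\<bar>\<theta> * u\<bar> < 1" by linarith
    have "(\<theta> * u)\<^sup>2 \<le> (1/4)\<^sup>2" using power_mono[OF tu, of 2] by simp
    then have "1 / (1 - (\<theta> * u)\<^sup>2) \<le> 1 / (1 / 2)" by (intro divide_left_mono) (auto simp: power2_eq_square)
    then have "J U (\<theta> * u) \<le> 2" using J_le[OF U tu1] by simp
    then have "\<theta>\<^sup>2 * J U (\<theta> * u) \<le> \<theta>\<^sup>2 * 2" by (rule mult_left_mono) simp
    also have "\<dots> \<le> J N 0 / 2"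
      using t by (simp add: power2_eq_square) (simp add: \<theta>_def)
    also have "\<dots> \<le> J N u" by (rule J_le_J_0[OF N u])
    finally show "\<theta>\<^sup>2 * J U (\<theta> * u) \<le> J N u" .
  qed
  then show ?thesis using t that by blast
qed

text \<open>Without any gain, BP is constant (uninformative leaves or no leaves) or has at most one leaf and
  no survey. In the latter case only the excluded recursion has nontrivial fixed points.\<close>

lemma no_gain_fixed_le:
  assumes S: "chan S" and U: "chan U" and V: "chan V" and d: "\<delta> \<in> {0..1}"
    and fU: "BP_chan \<delta> P S U = U" and fV: "BP_chan \<delta> P S V = V"
    and nd: "\<not> (S = trivial_dist \<and> (AE d in measure_pmf P. d = 1) \<and> \<delta> \<in> {0, 1})"
    and g: "\<And>k. k \<in> set_pmf P \<Longrightarrow> star_gain S (scale_chan \<delta> U) k = 0"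
  shows "U \<sqsubseteq> V"
proof -
  let ?X = "scale_chan \<delta> U"
  note X = chan_scale_chan[OF U d] and XV = chan_scale_chan[OF V d]
  show ?thesis
  proof (cases "J ?X 0 = 0")
    case True
    then have "?X \<sqsubseteq> scale_chan \<delta> V"
      by (simp add: less_noisy_def J_eq_0[OF X] J_nonneg)
    then have "BP_chan \<delta> P S U \<sqsubseteq> BP_chan \<delta> P S V"
      by (intro BP_chan_mono S U V d)
    then show ?thesis by (simp only: fU fV)
  next
    case False
    then have X0: "0 < J ?X 0" using J_0_nonneg[of ?X] by linarith
    \<comment> \<open>A star containing an informative leaf is informative, so two or more leaves
      would give a positive gain; with one leaf the gain is \<open>J ?X 0 * J S 0\<close>.\<close>
    have small: "k = 0 \<or> (k = 1 \<and> J S 0 = 0)" if "k \<in> set_pmf P" for k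
    proof (cases k)
      case (Suc j)
      then have z: "J (star S ?X j) 0 = 0" using g[OF that] X0 by (simp add: star_gain_def)
      have "j = 0"
      proof (rule ccontr)
        assume "j \<noteq> 0"
        then obtain i where "j = Suc i" by (cases j) auto
        then have "J ?X 0 \<le> J (star S ?X j) 0"
          using less_noisyD[OF prod_chan_ge[OF X chan_star[OF S X]], of 0 i] by simp
        then show False using z X0 by simp
      qed
      then show ?thesis using z Suc by simp
    qed simp
    show ?thesis
    proof (cases "1 \<in> set_pmf P")
      case False
      then have z: "k = 0" if "k \<in> set_pmf P" for k using small[OF that] that by auto
      have "J (BP_chan \<delta> P S N) u = J S u" if N: "chan N" and u: "\<bar>u\<bar> < 1" for N u
      proof -
        have "J (BP_chan \<delta> P S N) u = measure_pmf.expectation P (\<lambda>k. J S u)"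
          unfolding J_BP_chan[OF S N d u]
          by (intro integral_cong_AE) (auto simp: AE_measure_pmf_iff dest!: z)
        then show ?thesis by simp
      qed
      from this[OF U] this[OF V] show ?thesis unfolding fU fV by (simp add: less_noisy_def)
    next
      case True
      then have S0: "J S 0 = 0" using small[OF True] by simp
      have z: "\<bar>0::real\<bar> < 1" by simp
      have e: "J (star S ?X k) 0 = J ?X 0 * indicator {1} k" if "k \<in> set_pmf P" for k
        using small[OF that] S0 prod_chan_trivial_0[OF X S S0] by auto
      \<comment> \<open>Only a single leaf contributes, so BP multiplies \<open>J U 0\<close> by
        \<open>(1 - 2 * \<delta>)\<^sup>2 * pmf P 1\<close>. A nonzero fixed value forces both
        factors to be 1, which with \<open>S\<close> trivial is the excluded case.\<close>
      have "J U 0 = J (BP_chan \<delta> P S U) 0" by (simp only: fU)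
      also have "\<dots> = measure_pmf.expectation P (\<lambda>k. J ?X 0 * indicator {1} k)"
        unfolding J_BP_chan[OF S U d z] using e by (intro integral_cong_AE) (auto simp: AE_measure_pmf_iff)
      also have "\<dots> = J ?X 0 * pmf P 1"
        by (simp add: measure_pmf_single)
      also have "J ?X 0 = (1 - 2 * \<delta>)\<^sup>2 * J U 0" by (simp add: J_scale_chan[OF U d])
      finally have "J U 0 = (1 - 2 * \<delta>)\<^sup>2 * pmf P 1 * J U 0" by (simp add: mult_ac)
      moreover have "J U 0 \<noteq> 0" using X0 by (auto simp: J_scale_chan[OF U d])
      ultimately have one: "(1 - 2 * \<delta>)\<^sup>2 * pmf P 1 = 1" by simp
      have le: "(1 - 2 * \<delta>)\<^sup>2 \<le> 1" using d by (auto simp: abs_square_le_1 abs_le_iff)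
      have "(1 - 2 * \<delta>)\<^sup>2 * pmf P 1 \<le> 1 * pmf P 1" using le by (intro mult_right_mono) auto
      then have p1: "pmf P 1 = 1" using one pmf_le_1[of P 1] by linarith
      then have "(1 - 2 * \<delta>)\<^sup>2 = 1" using one by simp
      then have "\<delta> = 0 \<or> \<delta> = 1" by (auto simp: power2_eq_1_iff)
      moreover have "AE d in measure_pmf P. d = 1"
        using p1 measure_pmf.prob_eq_1[of "{1}" P] by (simp add: measure_pmf_single)
      moreover have "S = trivial_dist" using nontrivial_iff[OF S] S0 by auto
      ultimately show ?thesis using nd by auto
    qed
  qed
qed

text \<open>Only \<open>U\<close> and the survey are degraded, so symmetry is asked of these two.
  \<open>V\<close> enters through its nontriviality, its fixed point equation and the monotonicity
  of BP.\<close>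

lemma fixed_le:
  assumes S: "chan S" "even_chan S" and U: "chan U" "even_chan U" and V: "chan V" and d: "\<delta> \<in> {0..1}"
    and fU: "BP_chan \<delta> P S U = U" and fV: "BP_chan \<delta> P S V = V" and ntV: "0 < J V 0"
    and nd: "\<not> (S = trivial_dist \<and> (AE d in measure_pmf P. d = 1) \<and> \<delta> \<in> {0, 1})"
  shows "U \<sqsubseteq> V"
proof (cases "\<forall>k\<in>set_pmf P. star_gain S (scale_chan \<delta> U) k = 0")
  case True
  then show ?thesis using no_gain_fixed_le[OF S(1) U(1) V d fU fV nd] by blast
next
  case False
  let ?g = "star_gain S (scale_chan \<delta> U)"
  note gb = star_gain_bounds[OF S(1) chan_scale_chan[OF U(1) d]]
  have gpos: "0 < measure_pmf.expectation P ?g"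
  proof -
    have "measure_pmf.expectation P ?g \<noteq> 0"
      using False gb integral_nonneg_eq_0_iff_AE[OF integrable_measure_pmf_bounded[OF gb(2), where P = P]]
      by (auto simp: AE_measure_pmf_iff)
    moreover have "0 \<le> measure_pmf.expectation P ?g" using gb by (intro integral_nonneg_AE) auto
    ultimately show ?thesis by linarith
  qed
  define T where "T = {\<theta>\<in>{0..1}. degrade \<theta> U \<sqsubseteq> V}"
  obtain \<theta>\<^sub>1 where t1: "\<theta>\<^sub>1 \<in> {0<..<1}" "degrade \<theta>\<^sub>1 U \<sqsubseteq> V"
    using degrade_below_nontrivial[OF V ntV U(1)] by blast
  then have T1: "\<theta>\<^sub>1 \<in> T" by (auto simp: T_def)
  have bT: "bdd_above T" by (auto simp: T_def intro!: bdd_aboveI[of _ 1])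
  define \<theta> where "\<theta> = Sup T"
  have t0: "0 < \<theta>" using cSup_upper[OF T1 bT] t1 by (simp add: \<theta>_def)
  have t1': "\<theta> \<le> 1" unfolding \<theta>_def using T1 by (intro cSup_least) (auto simp: T_def)
  then have t: "\<theta> \<in> {0..1}" using t0 by auto
  \<comment> \<open>The supremum is attained. Closedness can be checked for each \<open>u\<close>
    separately, so a modulus of continuity depending on \<open>u\<close> suffices here.\<close>
  have \<theta>T: "degrade \<theta> U \<sqsubseteq> V"
    unfolding less_noisy_def J_degrade[OF U(1) t]
  proof (intro allI impI)
    fix u :: real assume u: "\<bar>u\<bar> < 1"
    have u2: "0 < 1 - u\<^sup>2" using u by (simp add: abs_square_less_1)
    show "\<theta>\<^sup>2 * J U (\<theta> * u) \<le> J V u"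
    proof (rule field_le_epsilon)
      fix e :: real assume e: "0 < e"
      \<comment> \<open>The 2 compensates \<open>\<theta> + \<theta>' \<le> 2\<close>, the square
        the slope bound of \<open>degrade_mono_param\<close>.\<close>
      define \<eta> where "\<eta> = e * (1 - u\<^sup>2)\<^sup>2 / 2"
      have "0 < \<eta>" using e u2 by (simp add: \<eta>_def)
      then obtain \<theta>' where th: "\<theta>' \<in> T" "\<theta> - \<eta> < \<theta>'"
        using less_cSup_iff[of T "\<theta> - \<eta>"] T1 bT by (auto simp: \<theta>_def)
      have th': "0 \<le> \<theta>'" "\<theta>' \<le> \<theta>" "degrade \<theta>' U \<sqsubseteq> V" "\<theta>' \<in> {0..1}"
        using th(1) cSup_upper[OF th(1) bT] by (auto simp: T_def \<theta>_def)
      have "\<theta>\<^sup>2 - \<theta>'\<^sup>2 = (\<theta> - \<theta>') * (\<theta> + \<theta>')" by (simp add: power2_eq_square algebra_simps)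
      also have "\<dots> \<le> \<eta> * 2" using th th' t t1' \<open>0 < \<eta>\<close> by (intro mult_mono) auto
      finally have "(\<theta>\<^sup>2 - \<theta>'\<^sup>2) / (1 - u\<^sup>2)\<^sup>2 \<le> \<eta> * 2 / (1 - u\<^sup>2)\<^sup>2"
        by (intro divide_right_mono) auto
      also have "\<dots> = e" using u2 by (simp add: \<eta>_def)
      finally have 1: "(\<theta>\<^sup>2 - \<theta>'\<^sup>2) / (1 - u\<^sup>2)\<^sup>2 \<le> e" .
      have "\<theta> * \<bar>u\<bar> \<le> \<bar>u\<bar>" using t mult_right_mono[of \<theta> 1 "\<bar>u\<bar>"] by simp
      then have "\<theta>\<^sup>2 * J U (\<theta> * u) \<le> \<theta>'\<^sup>2 * J U (\<theta>' * u) + (\<theta>\<^sup>2 - \<theta>'\<^sup>2) / (1 - u\<^sup>2)\<^sup>2"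
        using degrade_mono_param(2)[OF U th'(1,2) t1' u, of "\<bar>u\<bar>"] u by simp
      also have "\<theta>'\<^sup>2 * J U (\<theta>' * u) \<le> J V u"
        using less_noisyD[OF th'(3) u] by (simp add: J_degrade[OF U(1) th'(4)])
      finally show "\<theta>\<^sup>2 * J U (\<theta> * u) \<le> J V u + e" using 1 by linarith
    qed
  qed
  have "\<theta> = 1"
  proof (rule ccontr)
    assume "\<theta> \<noteq> 1"
    then have tl: "\<theta> < 1" using t1' by simp
    define c where "c = \<theta>\<^sup>2 * (1 - \<theta>\<^sup>2) ^ 3 / 4 * measure_pmf.expectation P ?g"
    have "\<theta>\<^sup>2 < 1" using tl t0 by (simp add: abs_square_less_1)
    then have c: "0 < c" unfolding c_def using t0 gpos by simp
    \<comment> \<open>Applying BP to both sides of \<open>degrade \<theta> U \<sqsubseteq> V\<close>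
      reproduces the inequality with the extra \<open>c\<close>, which is free of
      \<open>u\<close>.\<close>
    have strict: "\<theta>\<^sup>2 * J U (\<theta> * u) + c \<le> J V u" if u: "\<bar>u\<bar> < 1" for u
    proof -
      have "\<theta>\<^sup>2 * J U (\<theta> * u) + c \<le> J (BP_chan \<delta> P S (degrade \<theta> U)) u"
        using BP_chan_degrade[OF S U t d u, of P] unfolding fU c_def .
      also have "\<dots> \<le> J (BP_chan \<delta> P S V) u"
        by (rule less_noisyD[OF BP_chan_mono u])
          (intro S chan_degrade U t V d scale_chan_mono \<theta>T)+
      finally show ?thesis by (simp only: fV)
    qed
    \<comment> \<open>A ceiling below 1 for the increased parameter:
      \<open>\<theta>' * \<bar>u\<bar> \<le> \<tau>\<close> then holds for all \<open>u\<close>, and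
      a small enough increment costs at most \<open>c\<close> for all \<open>u\<close>
      simultaneously.\<close>
    define \<tau> where "\<tau> = (1 + \<theta>) / 2"
    have tau: "\<theta> < \<tau>" "\<tau> < 1" using tl by (auto simp: \<tau>_def)
    have tau2: "0 < 1 - \<tau>\<^sup>2" using tau t0 by (simp add: abs_square_less_1)
    define \<theta>' where "\<theta>' = min \<tau> (\<theta> + c * (1 - \<tau>\<^sup>2)\<^sup>2 / 2)"
    have "0 < c * (1 - \<tau>\<^sup>2)\<^sup>2 / 2" using c tau2 by simp
    then have th': "\<theta> < \<theta>'" "\<theta>' \<le> \<tau>" using tau by (auto simp: \<theta>'_def)
    then have th'': "\<theta>' \<in> {0..1}" "\<theta>' \<le> 1" using t0 tau by auto
    have "\<theta>'\<^sup>2 - \<theta>\<^sup>2 = (\<theta>' - \<theta>) * (\<theta>' + \<theta>)" by (simp add: power2_eq_square algebra_simps)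
    also have "\<dots> \<le> (c * (1 - \<tau>\<^sup>2)\<^sup>2 / 2) * 2"
    proof (rule mult_mono)
      have "\<theta>' \<le> \<theta> + c * (1 - \<tau>\<^sup>2)\<^sup>2 / 2" by (simp add: \<theta>'_def)
      then show "\<theta>' - \<theta> \<le> c * (1 - \<tau>\<^sup>2)\<^sup>2 / 2" by linarith
    qed (use th' th'' t0 tl c in auto)
    finally have "(\<theta>'\<^sup>2 - \<theta>\<^sup>2) / (1 - \<tau>\<^sup>2)\<^sup>2 \<le> c"
      using tau2 by (simp add: divide_le_eq)
    note close = this
    have "degrade \<theta>' U \<sqsubseteq> V"
      unfolding less_noisy_def J_degrade[OF U(1) th''(1)]
    proof (intro allI impI)
      fix u :: real assume u: "\<bar>u\<bar> < 1"
      have "\<theta>' * \<bar>u\<bar> \<le> \<theta>' * 1" using u th'' by (intro mult_left_mono) auto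
      then have "\<theta>' * \<bar>u\<bar> \<le> \<tau>" using th' by linarith
      then have "\<theta>'\<^sup>2 * J U (\<theta>' * u) \<le> \<theta>\<^sup>2 * J U (\<theta> * u) + (\<theta>'\<^sup>2 - \<theta>\<^sup>2) / (1 - \<tau>\<^sup>2)\<^sup>2"
        using t0 th' th'' tau u by (intro degrade_mono_param(2)[OF U]) auto
      then show "\<theta>'\<^sup>2 * J U (\<theta>' * u) \<le> J V u" using close strict[OF u] by linarith
    qed
    then have "\<theta>' \<in> T" using th'' by (simp add: T_def)
    then have "\<theta>' \<le> \<theta>" unfolding \<theta>_def using bT by (rule cSup_upper)
    then show False using th' by simp
  qed
  then show ?thesis using \<theta>T J_degrade[OF U(1) t] by (simp add: less_noisy_def)
qed

section \<open>Iteration and convergence\<close>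

lemma monotone_iterates:
  assumes S: "chan S" and N: "chan N" and d: "\<delta> \<in> {0..1}"
    and start: "if up then N \<sqsubseteq> BP_chan \<delta> P S N else BP_chan \<delta> P S N \<sqsubseteq> N"
  obtains M where "chan M" "BP_chan \<delta> P S M = M" "J_converges (\<lambda>h. (BP_chan \<delta> P S ^^ h) N) M"
    "\<And>h. if up then (BP_chan \<delta> P S ^^ h) N \<sqsubseteq> M else M \<sqsubseteq> (BP_chan \<delta> P S ^^ h) N"
proof -
  let ?N = "\<lambda>h. (BP_chan \<delta> P S ^^ h) N"
  have cN: "chan (?N h)" for h by (rule BP_iterate_llr[OF S N d])
  have mono: "BP_chan \<delta> P S A \<sqsubseteq> BP_chan \<delta> P S B" if "chan A" "chan B" "A \<sqsubseteq> B" for A B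
    using that by (intro BP_chan_mono scale_chan_mono S d)
  have step: "if up then ?N h \<sqsubseteq> ?N (Suc h) else ?N (Suc h) \<sqsubseteq> ?N h" for h
  proof (induction h)
    case 0
    then show ?case using start by simp
  next
    case (Suc h)
    then show ?case using mono[OF cN[of h] cN[of "Suc h"]] mono[OF cN[of "Suc h"] cN[of h]]
      by (cases up) auto
  qed
  have ch: "chain up ?N"
    unfolding chain_def
  proof (intro allI impI)
    fix m n :: nat assume "m \<le> n"
    then show "if up then ?N m \<sqsubseteq> ?N n else ?N n \<sqsubseteq> ?N m"
    proof (induction n rule: dec_induct)
      case (step n)
      then show ?case using \<open>\<And>h. if up then ?N h \<sqsubseteq> ?N (Suc h) else ?N (Suc h) \<sqsubseteq> ?N h\<close>[of n]
        by (cases up) (auto simp del: funpow.simps intro: less_noisy_trans)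
    qed simp
  qed
  obtain M where M: "chan M" and c: "J_converges ?N M"
    using monotone_J_limit[OF cN ch] by blast
  have "J_converges (\<lambda>h. BP_chan \<delta> P S (?N h)) (BP_chan \<delta> P S M)"
    by (rule BP_chan_tendsto[OF S cN M d c ch])
  then have c1: "J_converges (\<lambda>h. ?N (Suc h)) (BP_chan \<delta> P S M)" by simp
  have "BP_chan \<delta> P S M = M"
  proof (rule J_determines[OF chan_BP_chan[OF S M d] M])
    fix u :: real assume u: "\<bar>u\<bar> < 1"
    show "J (BP_chan \<delta> P S M) u = J M u"
      using J_convergesD[OF c1 u] LIMSEQ_Suc[OF J_convergesD[OF c u]] by (rule LIMSEQ_unique)
  qed
  moreover have "if up then ?N h \<sqsubseteq> M else M \<sqsubseteq> ?N h" for h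
  proof (cases up)
    case True
    then have "J (?N h) u \<le> J M u" if u: "\<bar>u\<bar> < 1" for u
      using ch u by (intro LIMSEQ_le_const[OF J_convergesD[OF c u]] exI[of _ h]) (auto simp: chain_def less_noisy_def)
    then show ?thesis using True by (simp add: less_noisy_def)
  next
    case False
    then have "J M u \<le> J (?N h) u" if u: "\<bar>u\<bar> < 1" for u
      using ch u by (intro LIMSEQ_le_const2[OF J_convergesD[OF c u]] exI[of _ h]) (auto simp: chain_def less_noisy_def)
    then show ?thesis using False by (simp add: less_noisy_def)
  qed
  ultimately show ?thesis using that M c by blast
qed

lemma iterate_mono:
  assumes S: "chan S" and A: "chan A" and B: "chan B" and d: "\<delta> \<in> {0..1}" and le: "A \<sqsubseteq> B"
  shows "(BP_chan \<delta> P S ^^ h) A \<sqsubseteq> (BP_chan \<delta> P S ^^ h) B"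
proof (induction h)
  case (Suc h)
  then show ?case
    using BP_iterate_llr(1)[OF S A d] BP_iterate_llr(1)[OF S B d]
    by (auto intro!: BP_chan_mono scale_chan_mono S d)
qed (use le in simp)

lemma iterate_even:
  assumes S: "chan S" "even_chan S" and N: "chan N" "even_chan N" and d: "\<delta> \<in> {0..1}"
  shows "even_chan ((BP_chan \<delta> P S ^^ h) N)"
  using BP_iterate_llr(1)[OF S(1) N(1) d]
  by (induction h) (auto simp: N intro!: even_BP_chan S d)

text \<open>Revealing the bit attains the bound of \<open>J_le\<close>, so it is the top of the
  order.\<close>

lemma perfect_chan_exists:
  obtains T where "chan T" "even_chan T" "\<And>N. chan N \<Longrightarrow> N \<sqsubseteq> T"
proof
  define T where "T = distr (measure_pmf (bernoulli_pmf (1/2))) borel (\<lambda>b. if b then \<infinity> else -\<infinity> :: ereal)"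
  have int: "(\<integral>r. f r \<partial>T) = (f \<infinity> + f (-\<infinity>)) / 2" if "f \<in> borel_measurable borel" for f :: "ereal \<Rightarrow> real"
    unfolding T_def using that by (subst integral_distr) (auto simp: field_simps)
  show T: "chan T"
    unfolding chan_def using int[of bias]
    by (auto simp: T_def intro!: prob_space.prob_space_distr measure_pmf.prob_space_axioms)
  have J: "J T u = 1 / (1 - u\<^sup>2)" if u: "\<bar>u\<bar> < 1" for u
  proof -
    have "1 + u > 0" "1 - u > 0" using u by auto
    then have "(1 / (1 + u) + 1 / (1 - u)) / 2 = 1 / ((1 + u) * (1 - u))" by (simp add: divide_simps)
    also have "(1 + u) * (1 - u) = 1 - u\<^sup>2" by (simp add: power2_eq_square algebra_simps)
    finally have sum: "(1 / (1 + u) + 1 / (1 - u)) / 2 = 1 / (1 - u\<^sup>2)" .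
    have "J T u = ((bias \<infinity>)\<^sup>2 / (1 + u * bias \<infinity>) + (bias (-\<infinity>))\<^sup>2 / (1 + u * bias (-\<infinity>))) / 2"
      unfolding J_def by (rule int) measurable
    also have "\<dots> = (1 / (1 + u) + 1 / (1 - u)) / 2" by simp
    finally show ?thesis unfolding sum .
  qed
  show "even_chan T" by (simp add: even_chan_def J)
  show "N \<sqsubseteq> T" if "chan N" for N using J_le[OF that] by (simp add: less_noisy_def J)
qed

lemma BP_chan_limit:
  assumes S: "chan S" "even_chan S" and d: "\<delta> \<in> {0..1}"
    and nd: "\<not> (S = trivial_dist \<and> (AE d in measure_pmf P. d = 1) \<and> \<delta> \<in> {0, 1})"
  obtains U where "chan U" "even_chan U" "BP_chan \<delta> P S U = U"
    "\<And>N. chan N \<Longrightarrow> N \<noteq> trivial_dist \<Longrightarrow> J_converges (\<lambda>h. (BP_chan \<delta> P S ^^ h) N) U"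
proof -
  obtain T where T: "chan T" "even_chan T" and top: "\<And>N. chan N \<Longrightarrow> N \<sqsubseteq> T"
    using perfect_chan_exists by blast
  have "BP_chan \<delta> P S T \<sqsubseteq> T" by (intro top chan_BP_chan S T d)
  then obtain U where U: "chan U" and fU: "BP_chan \<delta> P S U = U"
    and cU: "J_converges (\<lambda>h. (BP_chan \<delta> P S ^^ h) T) U"
    using monotone_iterates[OF S(1) T(1) d, of False P] by auto
  have eU: "even_chan U" by (rule even_J_converges[OF iterate_even[OF S T d] cU])
  have "J_converges (\<lambda>h. (BP_chan \<delta> P S ^^ h) N) U" if N: "chan N" and nt: "N \<noteq> trivial_dist" for N
  proof -
    have upper: "(BP_chan \<delta> P S ^^ h) N \<sqsubseteq> (BP_chan \<delta> P S ^^ h) T" for h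
      by (intro iterate_mono S N T d top)
    \<comment> \<open>The upper bound already tends to \<open>U\<close>; what remains is a lower
      bound with the same limit.\<close>
    have "\<exists>L. (\<forall>h. L h \<sqsubseteq> (BP_chan \<delta> P S ^^ h) N) \<and> J_converges L U"
    proof (cases "J U 0 = 0")
      case True
      have "J_converges (\<lambda>h. trivial_dist) U"
        using J_eq_0[OF U True] by (simp add: J_converges_def chan_trivial)
      moreover have "trivial_dist \<sqsubseteq> (BP_chan \<delta> P S ^^ h) N" for h
        by (simp add: less_noisy_def chan_trivial J_nonneg)
      ultimately show ?thesis by (intro exI[of _ "\<lambda>h. trivial_dist"]) blast
    next
      case False
      then have U0: "0 < J U 0" using J_0_nonneg[of U] by linarith
      obtain \<theta> where t: "\<theta> \<in> {0<..<1}" and le: "degrade \<theta> U \<sqsubseteq> N"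
        using degrade_below_nontrivial[OF N _ U] nt nontrivial_iff[OF N] by blast
      then have t': "\<theta> \<in> {0..1}" by auto
      let ?D = "degrade \<theta> U"
      note D = chan_degrade[OF U t'] even_degrade[OF U eU t']
      \<comment> \<open>The gain is nonnegative and \<open>U\<close> is fixed, so BP raises its
        degraded version. The iterates therefore increase, and their limit is nontrivial.\<close>
      have "?D \<sqsubseteq> BP_chan \<delta> P S ?D"
        unfolding less_noisy_def
      proof (intro allI impI)
        fix u :: real assume u: "\<bar>u\<bar> < 1"
        have "\<theta>\<^sup>2 \<le> 1" using t' by (simp add: power_le_one)
        moreover have "0 \<le> measure_pmf.expectation P (star_gain S (scale_chan \<delta> U))"
          using star_gain_bounds(1)[OF S(1) chan_scale_chan[OF U d]] by (intro integral_nonneg_AE) auto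
        ultimately have "0 \<le> \<theta>\<^sup>2 * (1 - \<theta>\<^sup>2) ^ 3 / 4 * measure_pmf.expectation P (star_gain S (scale_chan \<delta> U))"
          by simp
        then show "J ?D u \<le> J (BP_chan \<delta> P S ?D) u"
          using BP_chan_degrade[OF S U eU t' d u, of P] by (simp only: fU J_degrade[OF U t'])
      qed
      then obtain V where V: "chan V" and fV: "BP_chan \<delta> P S V = V"
        and cV: "J_converges (\<lambda>h. (BP_chan \<delta> P S ^^ h) ?D) V"
        and DV: "\<And>h. (BP_chan \<delta> P S ^^ h) ?D \<sqsubseteq> V"
        using monotone_iterates[OF S(1) D(1) d, of True P] by auto
      have "\<theta>\<^sup>2 * J U 0 \<le> J V 0"
        using less_noisyD[OF DV[of 0], of 0] by (simp add: J_degrade[OF U t'])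
      then have "0 < J V 0" using U0 t by (smt (verit) greaterThanLessThan_iff mult_pos_pos zero_less_power)
      then have "U \<sqsubseteq> V" by (rule fixed_le[OF S U eU V d fU fV _ nd])
      moreover have "V \<sqsubseteq> U"
        unfolding less_noisy_def
      proof (intro allI impI)
        fix u :: real assume u: "\<bar>u\<bar> < 1"
        have "(BP_chan \<delta> P S ^^ h) ?D \<sqsubseteq> (BP_chan \<delta> P S ^^ h) T" for h
          by (intro iterate_mono S D T d top)
        then show "J V u \<le> J U u"
          using u by (intro LIMSEQ_le[OF J_convergesD[OF cV u] J_convergesD[OF cU u]]) (auto simp: less_noisy_def)
      qed
      ultimately have "V = U" using less_noisy_antisym[OF U V] by simp
      then have "J_converges (\<lambda>h. (BP_chan \<delta> P S ^^ h) ?D) U" using cV by simp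
      moreover have "(BP_chan \<delta> P S ^^ h) ?D \<sqsubseteq> (BP_chan \<delta> P S ^^ h) N" for h
        by (intro iterate_mono S D N d le)
      ultimately show ?thesis by (intro exI[of _ "\<lambda>h. (BP_chan \<delta> P S ^^ h) ?D"]) blast
    qed
    then obtain L where L: "\<And>h. L h \<sqsubseteq> (BP_chan \<delta> P S ^^ h) N" "J_converges L U" by blast
    show ?thesis
      unfolding J_converges_def
    proof (intro allI impI)
      fix u :: real assume u: "\<bar>u\<bar> < 1"
      show "(\<lambda>h. J ((BP_chan \<delta> P S ^^ h) N) u) \<longlonglongrightarrow> J U u"
        by (rule tendsto_sandwich[OF _ _ J_convergesD[OF L(2) u] J_convergesD[OF cU u]])
          (auto intro!: always_eventually less_noisyD[OF L(1) u] less_noisyD[OF upper u])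
    qed
  qed
  then show ?thesis using that U eU fU by blast
qed

theorem corollary3:
  fixes \<delta> :: real and P :: "nat pmf" and \<mu>s :: "ereal measure"
  assumes "\<delta> \<in> {0..1}"
    and "symmetric_dist \<mu>s"
    and "\<not> (\<mu>s = trivial_dist \<and> (AE d in measure_pmf P. d = 1) \<and> \<delta> \<in> {0, 1})"
  shows
    "(\<forall>\<mu> \<mu>'. BP_fixed_point \<delta> P \<mu>s \<mu> \<and> \<mu> \<noteq> trivial_dist \<and>
        BP_fixed_point \<delta> P \<mu>s \<mu>' \<and> \<mu>' \<noteq> trivial_dist \<longrightarrow> \<mu> = \<mu>') \<and>
     (\<forall>\<mu>. BP_fixed_point \<delta> P \<mu>s \<mu> \<and> \<mu> \<noteq> trivial_dist \<longrightarrow> symmetric_dist \<mu>) \<and>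
     (\<exists>\<nu>. BP_fixed_point \<delta> P \<mu>s \<nu> \<and> symmetric_dist \<nu> \<and>
        (\<forall>\<mu>. LLR_dist \<mu> \<and> \<mu> \<noteq> trivial_dist \<longrightarrow>
           weakly_converges (\<lambda>h. (BP \<delta> P \<mu>s ^^ h) \<mu>) \<nu>) \<and>
        (\<forall>\<mu>. BP_fixed_point \<delta> P \<mu>s \<mu> \<and> \<mu> \<noteq> trivial_dist \<longrightarrow> \<nu> = \<mu>) \<and>
        ((\<nexists>\<mu>. BP_fixed_point \<delta> P \<mu>s \<mu> \<and> \<mu> \<noteq> trivial_dist) \<longrightarrow> \<nu> = trivial_dist))"
proof -
  note d = assms(1)
  obtain S where S: "chan S" and \<mu>s: "\<mu>s = llr S"
    using LLR_imp_llr[OF symmetric_dist_imp_LLR[OF assms(2)]] by blast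
  have eS: "even_chan S" using assms(2) symmetric_dist_llr[OF S] by (simp add: \<mu>s)
  have triv: "llr N = trivial_dist \<longleftrightarrow> N = trivial_dist" if "chan N" for N
    using llr_inj[OF that chan_trivial(1)] by (auto simp: chan_trivial)
  have "\<not> (S = trivial_dist \<and> (AE d in measure_pmf P. d = 1) \<and> \<delta> \<in> {0, 1})"
    using assms(3) by (simp add: \<mu>s triv[OF S])
  then obtain U where U: "chan U" and eU: "even_chan U" and fU: "BP_chan \<delta> P S U = U"
    and conv: "\<And>N. chan N \<Longrightarrow> N \<noteq> trivial_dist \<Longrightarrow> J_converges (\<lambda>h. (BP_chan \<delta> P S ^^ h) N) U"
    using BP_chan_limit[OF S eS d] by blast
  have fixed: "BP_fixed_point \<delta> P \<mu>s (llr U)"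
    using BP_llr[OF S U d, of P] by (simp add: BP_fixed_point_def LLR_llr[OF U] \<mu>s fU)
  have sym: "symmetric_dist (llr U)" using symmetric_dist_llr[OF U] eU by simp
  \<comment> \<open>The iterates of a fixed point are constant, so their convergence to
    \<open>U\<close> identifies it; its symmetry is inherited from \<open>U\<close>.\<close>
  have unique: "llr U = \<mu>" if f: "BP_fixed_point \<delta> P \<mu>s \<mu>" and nt: "\<mu> \<noteq> trivial_dist" for \<mu>
  proof -
    obtain N where N: "chan N" and \<mu>: "\<mu> = llr N"
      using f LLR_imp_llr[of \<mu>] by (auto simp: BP_fixed_point_def)
    have "llr (BP_chan \<delta> P S N) = llr N"
      using f BP_llr[OF S N d, of P] by (simp add: BP_fixed_point_def \<mu> \<mu>s)
    then have "BP_chan \<delta> P S N = N" by (rule llr_inj[OF chan_BP_chan[OF S N d] N])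
    then have it: "(BP_chan \<delta> P S ^^ h) N = N" for h by (induction h) simp_all
    have "N \<noteq> trivial_dist" using nt triv[OF N] by (simp add: \<mu>)
    then have "J_converges (\<lambda>h. N) U" using conv[OF N] by (simp add: it)
    then have "N = U"
      by (intro J_determines N U) (auto simp: J_converges_def LIMSEQ_const_iff)
    then show ?thesis by (simp add: \<mu>)
  qed
  have wconv: "weakly_converges (\<lambda>h. (BP \<delta> P \<mu>s ^^ h) \<mu>) (llr U)"
    if l: "LLR_dist \<mu>" and nt: "\<mu> \<noteq> trivial_dist" for \<mu>
  proof -
    obtain N where N: "chan N" and \<mu>: "\<mu> = llr N" using LLR_imp_llr[OF l] by blast
    have "N \<noteq> trivial_dist" using nt triv[OF N] by (simp add: \<mu>)
    then show ?thesis
      unfolding \<mu> \<mu>s BP_iterate_llr(2)[OF S N d]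
      by (intro weakly_converges_llr BP_iterate_llr(1)[OF S N d] U conv N)
  qed
  show ?thesis
  proof (intro conjI allI impI exI[of _ "llr U"])
    show "\<mu> = \<mu>'" if "BP_fixed_point \<delta> P \<mu>s \<mu> \<and> \<mu> \<noteq> trivial_dist \<and>
        BP_fixed_point \<delta> P \<mu>s \<mu>' \<and> \<mu>' \<noteq> trivial_dist" for \<mu> \<mu>'
      using that unique[of \<mu>] unique[of \<mu>'] by simp
    show "symmetric_dist \<mu>" if "BP_fixed_point \<delta> P \<mu>s \<mu> \<and> \<mu> \<noteq> trivial_dist" for \<mu>
      using that unique[of \<mu>] sym by simp
    show "weakly_converges (\<lambda>h. (BP \<delta> P \<mu>s ^^ h) \<mu>) (llr U)" if "LLR_dist \<mu> \<and> \<mu> \<noteq> trivial_dist" for \<mu>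
      using that wconv by simp
    show "llr U = \<mu>" if "BP_fixed_point \<delta> P \<mu>s \<mu> \<and> \<mu> \<noteq> trivial_dist" for \<mu>
      using that unique by simp
    show "llr U = trivial_dist" if "\<nexists>\<mu>. BP_fixed_point \<delta> P \<mu>s \<mu> \<and> \<mu> \<noteq> trivial_dist"
      using that fixed by blast
  qed (fact fixed, fact sym)
qed

end
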